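(* Let $U$ be a non-empty open subset of $\mathbb{R}^d$ and let $g:U\to\mathbb{R}$ be a Lipschitz function. Let $\omega_0$ and $\omega_1$ be weight functions on $U$ such that at least one of them satisfies the compact boundedness condition on $U$ and $\omega_0(x)=\omega_1(x)e^{g(x)}$ for all $x\in U$. Let $r_\omega=\omega_0/\omega_1$. (i) Then $\omega_0$ and $\omega_1$ both satisfy the compact boundedness condition on $U$ and $r_\omega$ is locally Lipschitz on $U$. (ii) If $U=\mathbb{R}^d$ then $$\left[W^{1,p}(\mathbb{R}^d,\omega_0),W^{1,p}(\mathbb{R}^d,\omega_1)\right]_\theta=W^{1,p}(\mathbb{R}^d,\omega_\theta)$$ to within equivalence of norms, for every $p\in[1,\infty)$ and $\theta\in(0,1)$. (iii) If, for some $q\in[1,\infty)$, whenever $\phi\in W^{1,q}_0(U,\omega_0)\cap W^{1,q}_0(U,\omega_1)$ there exists a sequence of functions in $Lip_c(U)$ which converges to $\phi$ in $W^{1,q}(U,\omega_0)$ or in $W^{1,q}(U,\omega_1)$ and is a bounded sequence in the other space, then $$\left[W^{1,p}_0(U,\omega_0),W^{1,p}_0(U,\omega_1)\right]_\theta=W^{1,p}_0(U,\omega_\theta)$$ to within equivalence of norms, for every $p\in[1,\infty)$ and $\theta\in(0,1)$. (iv) Let $p\in[1,\infty)$. If $W^{1,p}_0(U,\omega_j)=W^{1,p}(U,\omega_j)$ for $j=0,1$ and $\mathcal{W}^p_0(U,\theta,r_\omega)=\mathcal{W}^p(U,\theta,r_\omega)$ for all $\theta\in(0,1)$, then $$\left[W^{1,p}(U,\omega_0),W^{1,p}(U,\omega_1)\right]_\theta=W^{1,p}(U,\omega_\theta)$$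 to within equivalence of norms, for that value of $p$ and for every $\theta\in(0,1)$.
   Context: $d$ is a positive integer. A weight function on $U$ is a Lebesgue measurable function $\omega:U\to(0,\infty)$. It satisfies the compact boundedness condition on $U$ if $0<\inf_{x\in K}\omega(x)\le\sup_{x\in K}\omega(x)<\infty$ for every compact $K\subset U$. Given $\omega_0,\omega_1$, put $\omega_\theta=\omega_0^{1-\theta}\omega_1^{\theta}$. For $p\in[1,\infty)$, $m\in\mathbb{N}$: $L^p(U,\omega,\mathbb{C}^m)$ is the space of measurable $\phi=(\phi_1,\dots,\phi_m):U\to\mathbb{C}^m$ with $\|\phi\|=\left(\sum_{i=1}^m\int_U|\phi_i|^p\omega\,dx\right)^{1/p}<\infty$; $L^p(U,\omega)$ is the case $m=1$. $W^{1,p}(U,\omega)$ is the space of $\phi:U\to\mathbb{C}$ having a weak (distributional) gradient $\nabla\phi$ on $U$ with $(\phi,\nabla\phi)\in L^p(U,\omega,\mathbb{C}^{d+1})$, normed by $\|\phi\|_{W^{1,p}(U,\omega)}=\|(\phi,\nabla\phi)\|_{L^p(U,\omega,\mathbb{C}^{d+1})}$. (Functions are identified when equal a.e.) A function on $U$ is locally Lipschitz if its restriction to each compact subset of $U$ is Lipschitz. $Lip_c(U)$ is the space of Lipschitz functions $U\to\mathbb{C}$ whose support is a compact subset of $U$. $W^{1,p}_0(U,\omega)$ is the closure of $Lip_c(U)$ in $W^{1,p}(U,\omega)$, with the same norm. (Under the compact boundedness condition $W^{1,p}(U,\omega)$ is a Banach space containing $Lip_c(U)$.) $\mathcal{W}^p(U,\theta,r_\omega)$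 is the space of $\phi\in W^{1,p}(U,\omega_\theta)$ such that $\phi|\nabla\log(r_\omega)|\in L^p(U,\omega_\theta)$, with norm $\left(\|\phi\|^p_{W^{1,p}(U,\omega_\theta)}+\int_U|\phi|^p|\nabla\log(r_\omega)|^p\omega_\theta\,dx\right)^{1/p}$, where $|\cdot|$ is the Euclidean norm on $\mathbb{C}^d$. $\mathcal{W}^p_0(U,\theta,r_\omega)$ is the closure of $Lip_c(U)$ in $\mathcal{W}^p(U,\theta,r_\omega)$. $[A_0,A_1]_\theta$ is Calderón's complex interpolation space of a Banach couple $(A_0,A_1)$: let $\mathbb{S}=\{z\in\mathbb{C}:0\le\mathrm{Re}\,z\le1\}$ and let $\mathcal{F}(A_0,A_1)$ be the space of functions $f:\mathbb{S}\to A_0+A_1$ that are continuous and bounded on $\mathbb{S}$, analytic in its interior, and such that $t\mapsto f(j+it)$ is a bounded continuous map of $\mathbb{R}$ into $A_j$, $j=0,1$, with norm $\|f\|_{\mathcal F}=\max_{j=0,1}\sup_{t\in\mathbb{R}}\|f(j+it)\|_{A_j}$. Then $[A_0,A_1]_\theta=\{f(\theta):f\in\mathcal{F}(A_0,A_1)\}$ with norm $\|a\|=\inf\{\|f\|_{\mathcal{F}}:f(\theta)=a\}$. *)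

theory Defs
  imports "HOL-Analysis.Analysis"
begin

text \<open>
  A function on an open set \<open>U\<close> is represented by a function on the whole of \<open>real ^ 'n\<close> whose
  values outside \<open>U\<close> are irrelevant.  Functions that agree almost everywhere on \<open>U\<close> are not
  formally identified: each function space is a set of representatives closed under such
  changes, with a seminorm that does not see them.
\<close>

section \<open>Seminormed spaces of complex functions and complex interpolation\<close>

record 'x fun_space =
  fcarrier :: "('x \<Rightarrow> complex) set"
  fnorm :: "('x \<Rightarrow> complex) \<Rightarrow> real"

definition fclosure :: "'x fun_space \<Rightarrow> ('x \<Rightarrow> complex) set \<Rightarrow> ('x \<Rightarrow> complex) set" where
  "fclosure X A = {\<phi> \<in> fcarrier X.
     \<forall>e>0. \<exists>\<psi> \<in> A \<inter> fcarrier X. fnorm X (\<lambda>x. \<phi> x - \<psi> x) < e}"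

definition fconverges :: "'x fun_space \<Rightarrow> (nat \<Rightarrow> 'x \<Rightarrow> complex) \<Rightarrow> ('x \<Rightarrow> complex) \<Rightarrow> bool" where
  "fconverges X \<psi> \<phi> \<longleftrightarrow> (\<forall>n. \<psi> n \<in> fcarrier X) \<and> \<phi> \<in> fcarrier X \<and>
     (\<lambda>n. fnorm X (\<lambda>x. \<psi> n x - \<phi> x)) \<longlonglongrightarrow> 0"

definition fbounded_seq :: "'x fun_space \<Rightarrow> (nat \<Rightarrow> 'x \<Rightarrow> complex) \<Rightarrow> bool" where
  "fbounded_seq X \<psi> \<longleftrightarrow> (\<forall>n. \<psi> n \<in> fcarrier X) \<and> (\<exists>B. \<forall>n. fnorm X (\<psi> n) \<le> B)"

definition fspace_equiv :: "'x fun_space \<Rightarrow> 'x fun_space \<Rightarrow> bool" (infix "\<cong>\<^sub>N" 50) where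
  "X \<cong>\<^sub>N Y \<longleftrightarrow> fcarrier X = fcarrier Y \<and>
     (\<exists>c>0. \<exists>C>0. \<forall>\<phi> \<in> fcarrier X. c * fnorm Y \<phi> \<le> fnorm X \<phi> \<and> fnorm X \<phi> \<le> C * fnorm Y \<phi>)"

definition fsum :: "'x fun_space \<Rightarrow> 'x fun_space \<Rightarrow> 'x fun_space" where
  "fsum A0 A1 = \<lparr>
     fcarrier = {\<lambda>x. a0 x + a1 x | a0 a1. a0 \<in> fcarrier A0 \<and> a1 \<in> fcarrier A1},
     fnorm = (\<lambda>a. Inf {fnorm A0 a0 + fnorm A1 a1 | a0 a1.
       a0 \<in> fcarrier A0 \<and> a1 \<in> fcarrier A1 \<and> a = (\<lambda>x. a0 x + a1 x)})\<rparr>"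

definition bounded_continuous_into ::
    "'x fun_space \<Rightarrow> 't::topological_space set \<Rightarrow> ('t \<Rightarrow> 'x \<Rightarrow> complex) \<Rightarrow> bool" where
  "bounded_continuous_into X S f \<longleftrightarrow>
     (\<forall>s\<in>S. f s \<in> fcarrier X) \<and>
     (\<exists>B. \<forall>s\<in>S. fnorm X (f s) \<le> B) \<and>
     (\<forall>s\<in>S. ((\<lambda>w. fnorm X (\<lambda>x. f w x - f s x)) \<longlongrightarrow> 0) (at s within S))"

definition analytic_into ::
    "'x fun_space \<Rightarrow> complex set \<Rightarrow> (complex \<Rightarrow> 'x \<Rightarrow> complex) \<Rightarrow> bool" where
  "analytic_into X S f \<longleftrightarrow>
     (\<forall>z\<in>S. \<exists>D \<in> fcarrier X.
        ((\<lambda>w. fnorm X (\<lambda>x. (f w x - f z x) / (w - z) - D x)) \<longlongrightarrow> 0) (at z))"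

definition strip :: "complex set" where
  "strip = {z. 0 \<le> Re z \<and> Re z \<le> 1}"

definition calderon_F :: "'x fun_space \<Rightarrow> 'x fun_space \<Rightarrow> (complex \<Rightarrow> 'x \<Rightarrow> complex) set" where
  "calderon_F A0 A1 = {f.
     bounded_continuous_into (fsum A0 A1) strip f \<and>
     analytic_into (fsum A0 A1) (interior strip) f \<and>
     bounded_continuous_into A0 UNIV (\<lambda>t::real. f (Complex 0 t)) \<and>
     bounded_continuous_into A1 UNIV (\<lambda>t::real. f (Complex 1 t))}"

definition calderon_norm ::
    "'x fun_space \<Rightarrow> 'x fun_space \<Rightarrow> (complex \<Rightarrow> 'x \<Rightarrow> complex) \<Rightarrow> real" where
  "calderon_norm A0 A1 f =
     max (SUP t::real. fnorm A0 (f (Complex 0 t))) (SUP t::real. fnorm A1 (f (Complex 1 t)))"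

definition complex_interp :: "'x fun_space \<Rightarrow> 'x fun_space \<Rightarrow> real \<Rightarrow> 'x fun_space" where
  "complex_interp A0 A1 \<theta> = \<lparr>
     fcarrier = {f (of_real \<theta>) | f. f \<in> calderon_F A0 A1},
     fnorm = (\<lambda>a. Inf {calderon_norm A0 A1 f | f. f \<in> calderon_F A0 A1 \<and> f (of_real \<theta>) = a})\<rparr>"

section \<open>Weights and Lipschitz functions\<close>

definition weight_on :: "(real ^ 'n) set \<Rightarrow> (real ^ 'n \<Rightarrow> real) \<Rightarrow> bool" where
  "weight_on U \<omega> \<longleftrightarrow> \<omega> \<in> borel_measurable (lebesgue_on U) \<and> (\<forall>x\<in>U. 0 < \<omega> x)"

text \<open>Infimum and supremum are taken in the extended reals, so that the empty compact set
  imposes no condition.\<close>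

definition compactly_bounded :: "(real ^ 'n) set \<Rightarrow> (real ^ 'n \<Rightarrow> real) \<Rightarrow> bool" where
  "compactly_bounded U \<omega> \<longleftrightarrow>
     (\<forall>K. compact K \<and> K \<subseteq> U \<longrightarrow>
        0 < (INF x\<in>K. ereal (\<omega> x)) \<and> (SUP x\<in>K. ereal (\<omega> x)) < \<infinity>)"

definition interp_weight ::
    "(real ^ 'n \<Rightarrow> real) \<Rightarrow> (real ^ 'n \<Rightarrow> real) \<Rightarrow> real \<Rightarrow> real ^ 'n \<Rightarrow> real" where
  "interp_weight \<omega>0 \<omega>1 \<theta> x = \<omega>0 x powr (1 - \<theta>) * \<omega>1 x powr \<theta>"

definition weight_ratio :: "(real ^ 'n \<Rightarrow> real) \<Rightarrow> (real ^ 'n \<Rightarrow> real) \<Rightarrow> real ^ 'n \<Rightarrow> real" where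
  "weight_ratio \<omega>0 \<omega>1 x = \<omega>0 x / \<omega>1 x"

definition locally_lipschitz_on :: "(real ^ 'n) set \<Rightarrow> (real ^ 'n \<Rightarrow> real) \<Rightarrow> bool" where
  "locally_lipschitz_on U f \<longleftrightarrow> (\<forall>K. compact K \<and> K \<subseteq> U \<longrightarrow> (\<exists>L. L-lipschitz_on K f))"

text \<open>The support is the closure relative to \<open>U\<close> of the set where the function is non-zero.\<close>

definition Lip_c :: "(real ^ 'n) set \<Rightarrow> (real ^ 'n \<Rightarrow> complex) set" where
  "Lip_c U = {\<phi>. (\<exists>L. L-lipschitz_on U \<phi>) \<and> compact (U \<inter> closure {x \<in> U. \<phi> x \<noteq> 0})}"

section \<open>Weak gradients\<close>

definition partial_deriv :: "'n \<Rightarrow> (real ^ 'n \<Rightarrow> complex) \<Rightarrow> real ^ 'n \<Rightarrow> complex" where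
  "partial_deriv i f x = frechet_derivative f (at x) (axis i 1)"

primrec C_k :: "nat \<Rightarrow> (real ^ 'n \<Rightarrow> complex) \<Rightarrow> bool" where
  "C_k 0 f \<longleftrightarrow> continuous_on UNIV f"
| "C_k (Suc k) f \<longleftrightarrow> (\<forall>x. f differentiable (at x)) \<and> (\<forall>i. C_k k (partial_deriv i f))"

definition test_functions :: "(real ^ 'n) set \<Rightarrow> (real ^ 'n \<Rightarrow> complex) set" where
  "test_functions U = {\<eta>. (\<forall>k. C_k k \<eta>) \<and>
     compact (closure {x. \<eta> x \<noteq> 0}) \<and> closure {x. \<eta> x \<noteq> 0} \<subseteq> U}"

definition locally_integrable_on ::
    "(real ^ 'n \<Rightarrow> 'b::{banach, second_countable_topology}) \<Rightarrow> (real ^ 'n) set \<Rightarrow> bool" where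
  "locally_integrable_on f U \<longleftrightarrow> (\<forall>K. compact K \<and> K \<subseteq> U \<longrightarrow> integrable (lebesgue_on K) f)"

definition has_weak_gradient ::
    "(real ^ 'n) set \<Rightarrow> (real ^ 'n \<Rightarrow> complex) \<Rightarrow> (real ^ 'n \<Rightarrow> complex ^ 'n) \<Rightarrow> bool" where
  "has_weak_gradient U \<phi> G \<longleftrightarrow>
     locally_integrable_on \<phi> U \<and> locally_integrable_on G U \<and>
     (\<forall>\<eta> \<in> test_functions U. \<forall>i.
        (LINT x|lebesgue_on U. \<phi> x * partial_deriv i \<eta> x) =
        - (LINT x|lebesgue_on U. (G x $ i) * \<eta> x))"

text \<open>A weak gradient is unique up to null subsets of \<open>U\<close>, and every use below is insensitive to
  the choice.\<close>

definition weak_gradient ::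
    "(real ^ 'n) set \<Rightarrow> (real ^ 'n \<Rightarrow> complex) \<Rightarrow> real ^ 'n \<Rightarrow> complex ^ 'n" where
  "weak_gradient U \<phi> = (SOME G. has_weak_gradient U \<phi> G)"

section \<open>Weighted Lebesgue and Sobolev spaces\<close>

definition Lp :: "real \<Rightarrow> (real ^ 'n) set \<Rightarrow> (real ^ 'n \<Rightarrow> real) \<Rightarrow> (real ^ 'n \<Rightarrow> complex ^ 'm) set" where
  "Lp p U \<omega> = {\<phi>. \<phi> \<in> borel_measurable (lebesgue_on U) \<and>
     (\<forall>i. integrable (lebesgue_on U) (\<lambda>x. cmod (\<phi> x $ i) powr p * \<omega> x))}"

definition Lp_norm ::
    "real \<Rightarrow> (real ^ 'n) set \<Rightarrow> (real ^ 'n \<Rightarrow> real) \<Rightarrow> (real ^ 'n \<Rightarrow> complex ^ 'm) \<Rightarrow> real" where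
  "Lp_norm p U \<omega> \<phi> =
     (\<Sum>i\<in>UNIV. LINT x|lebesgue_on U. cmod (\<phi> x $ i) powr p * \<omega> x) powr (1 / p)"

text \<open>The \<open>(d+1)\<close>-tuple \<open>(\<phi>, \<nabla>\<phi>)\<close>: the index \<open>None\<close> carries the function, \<open>Some i\<close> the \<open>i\<close>-th
  component of its weak gradient.\<close>

definition with_gradient ::
    "(real ^ 'n) set \<Rightarrow> (real ^ 'n \<Rightarrow> complex) \<Rightarrow> real ^ 'n \<Rightarrow> complex ^ ('n option)" where
  "with_gradient U \<phi> x =
     (\<chi> k. case k of None \<Rightarrow> \<phi> x | Some i \<Rightarrow> weak_gradient U \<phi> x $ i)"

definition W1 :: "real \<Rightarrow> (real ^ 'n) set \<Rightarrow> (real ^ 'n \<Rightarrow> real) \<Rightarrow> (real ^ 'n) fun_space" where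
  "W1 p U \<omega> = \<lparr>
     fcarrier = {\<phi>. (\<exists>G. has_weak_gradient U \<phi> G) \<and> with_gradient U \<phi> \<in> Lp p U \<omega>},
     fnorm = (\<lambda>\<phi>. Lp_norm p U \<omega> (with_gradient U \<phi>))\<rparr>"

definition W1_0 :: "real \<Rightarrow> (real ^ 'n) set \<Rightarrow> (real ^ 'n \<Rightarrow> real) \<Rightarrow> (real ^ 'n) fun_space" where
  "W1_0 p U \<omega> = \<lparr>fcarrier = fclosure (W1 p U \<omega>) (Lip_c U), fnorm = fnorm (W1 p U \<omega>)\<rparr>"

definition grad_log_ratio ::
    "(real ^ 'n) set \<Rightarrow> (real ^ 'n \<Rightarrow> real) \<Rightarrow> (real ^ 'n \<Rightarrow> real) \<Rightarrow> real ^ 'n \<Rightarrow> complex ^ 'n" where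
  "grad_log_ratio U \<omega>0 \<omega>1 = weak_gradient U (\<lambda>x. complex_of_real (ln (weight_ratio \<omega>0 \<omega>1 x)))"

text \<open>The scalar space \<open>L\<^sup>p(U, \<omega>)\<close> is the space of \<open>complex ^ 1\<close>-valued functions, through \<^const>\<open>vec\<close>.\<close>

definition calW ::
    "real \<Rightarrow> (real ^ 'n) set \<Rightarrow> real \<Rightarrow> (real ^ 'n \<Rightarrow> real) \<Rightarrow> (real ^ 'n \<Rightarrow> real) \<Rightarrow> (real ^ 'n) fun_space" where
  "calW p U \<theta> \<omega>0 \<omega>1 = \<lparr>
     fcarrier = {\<phi> \<in> fcarrier (W1 p U (interp_weight \<omega>0 \<omega>1 \<theta>)).
       (\<lambda>x. vec (\<phi> x * of_real (norm (grad_log_ratio U \<omega>0 \<omega>1 x))) :: complex ^ 1)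
         \<in> Lp p U (interp_weight \<omega>0 \<omega>1 \<theta>)},
     fnorm = (\<lambda>\<phi>.
       (fnorm (W1 p U (interp_weight \<omega>0 \<omega>1 \<theta>)) \<phi> powr p +
        (LINT x|lebesgue_on U.
           cmod (\<phi> x) powr p * norm (grad_log_ratio U \<omega>0 \<omega>1 x) powr p * interp_weight \<omega>0 \<omega>1 \<theta> x))
       powr (1 / p))\<rparr>"

definition calW_0 ::
    "real \<Rightarrow> (real ^ 'n) set \<Rightarrow> real \<Rightarrow> (real ^ 'n \<Rightarrow> real) \<Rightarrow> (real ^ 'n \<Rightarrow> real) \<Rightarrow> (real ^ 'n) fun_space" where
  "calW_0 p U \<theta> \<omega>0 \<omega>1 =
     \<lparr>fcarrier = fclosure (calW p U \<theta> \<omega>0 \<omega>1) (Lip_c U), fnorm = fnorm (calW p U \<theta> \<omega>0 \<omega>1)\<rparr>"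

end

theory Submission
  imports Defs "HOL-Complex_Analysis.Complex_Analysis"
begin

text \<open>
  Mollifying an extension of \<open>g\<close> gives a smooth Lipschitz function \<open>\<gamma>\<close> on the whole space with
  \<open>g - \<gamma>\<close> bounded on \<open>U\<close>, so that all weights can be compared through \<open>exp \<gamma>\<close>, and
  multiplication by smooth functions of \<open>\<gamma>\<close> needs only test functions, not the differentiability of
  Lipschitz functions almost everywhere.

  A function \<open>\<phi>\<close> in the middle space is the value at \<open>\<theta>\<close> of
  \<open>z \<mapsto> exp (z\<^sup>2 - \<theta>\<^sup>2) exp ((z - \<theta>) \<gamma> / p) \<phi>\<close>: since \<open>\<nabla>\<gamma>\<close> is bounded, the Gaussian factor absorbs
  the polynomial growth in \<open>z\<close> of the gradient.  Conversely, Stein and Weiss's change of measure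
  argument for weighted \<open>L\<^sup>p\<close> spaces, applied to the components of \<open>(f, \<nabla>f)\<close>, bounds \<open>f \<theta>\<close> in the
  middle space; here \<open>\<gamma>\<close> is replaced by its integer part, which turns the dual pairing into a finite
  combination of fixed functionals with entire coefficients.  That \<open>f \<theta>\<close> lies in the closure of the
  compactly supported Lipschitz functions follows by multiplying with the cutoffs \<open>exp (- \<gamma>\<^sup>2 / n)\<close>.
\<close>

section \<open>Calculus of smooth functions\<close>

text \<open>Everything hinges on the size of the multiplier. Since \<omega>_s = \<omega>_1 exp ((1 -
  s) g), a factor of modulus exp ((Re z - \<theta>) \<gamma> / p), raised to the power p, turns the
  weight of index \<theta> into that of index Re z up to a constant; hence the division by p. Inside
  the strip the product lies in general in neither endpoint space and must be split: a logistic
  partition of unity in \<gamma> sends each region to the endpoint whose weight is the smaller one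
  there. In the converse direction the exponents of the dual element depend on \<gamma>, and
  analyticity of f into a sum space says nothing directly about an integral against a z-dependent
  dual element; with integer values of \<gamma>, only finitely many fixed functionals occur on a
  truncated set. Truncation also makes the quantity to be bounded finite, so that a Young-type
  inequality may leave half of it on the right, to be absorbed. This works alike for p = 1 and p >
  1. As the goal is equivalence of norms, every inequality may lose a constant.\<close>

lemma partial_deriv_eqI: "(f has_derivative f') (at x) \<Longrightarrow> partial_deriv i f x = f' (axis i 1)"
  unfolding partial_deriv_def by (metis frechet_derivative_at)

lemma C_k_Suc_imp: "C_k (Suc k) f \<Longrightarrow> C_k k f"
proof (induction k arbitrary: f)
  case 0
  then show ?case
    by (auto simp: continuous_on_eq_continuous_at differentiable_imp_continuous_within)
next
  case (Suc k)
  then show ?case by (metis C_k.simps(2))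
qed

lemma C_k_const: "C_k k (\<lambda>x::real^'n. c)"
proof (induction k arbitrary: c)
  case (Suc k)
  have "partial_deriv i (\<lambda>x::real^'n. c) = (\<lambda>x. 0)" for i
    by (rule ext, subst partial_deriv_eqI[of _ "\<lambda>_. 0"]) auto
  then show ?case using Suc by simp
qed auto

lemma C_k_add: "C_k k f \<Longrightarrow> C_k k g \<Longrightarrow> C_k k (\<lambda>x. f x + g x)"
proof (induction k arbitrary: f g)
  case 0
  then show ?case by (auto intro: continuous_intros)
next
  case (Suc k)
  have "partial_deriv i (\<lambda>x. f x + g x) = (\<lambda>x. partial_deriv i f x + partial_deriv i g x)" for i
  proof
    fix x
    have "(f has_derivative frechet_derivative f (at x)) (at x)"
         "(g has_derivative frechet_derivative g (at x)) (at x)"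
      using Suc.prems by (metis C_k.simps(2) frechet_derivative_works)+
    from partial_deriv_eqI[OF has_derivative_add[OF this]]
    show "partial_deriv i (\<lambda>x. f x + g x) x = partial_deriv i f x + partial_deriv i g x"
      by (simp add: partial_deriv_def)
  qed
  then show ?case using Suc by auto
qed

lemma partial_deriv_mult:
  assumes "f differentiable (at x)" "g differentiable (at x)"
  shows "partial_deriv i (\<lambda>x. f x * g x) x = f x * partial_deriv i g x + partial_deriv i f x * g x"
proof -
  have "(f has_derivative frechet_derivative f (at x)) (at x)"
    "(g has_derivative frechet_derivative g (at x)) (at x)"
    using assms frechet_derivative_works by auto
  from partial_deriv_eqI[OF has_derivative_mult[OF this]]
  show ?thesis by (simp add: partial_deriv_def)
qed

lemma C_k_mult: "C_k k f \<Longrightarrow> C_k k g \<Longrightarrow> C_k k (\<lambda>x. f x * g x)"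
proof (induction k arbitrary: f g)
  case 0
  then show ?case by (auto intro: continuous_intros)
next
  case (Suc k)
  have "partial_deriv i (\<lambda>x. f x * g x) = (\<lambda>x. f x * partial_deriv i g x + partial_deriv i f x * g x)" for i
    using Suc.prems by (intro ext partial_deriv_mult) auto
  then show ?case using Suc C_k_Suc_imp[OF Suc.prems(1)] C_k_Suc_imp[OF Suc.prems(2)]
    by (auto intro!: C_k_add)
qed

lemma C_k_prod: "finite I \<Longrightarrow> (\<And>i. i \<in> I \<Longrightarrow> C_k k (f i)) \<Longrightarrow> C_k k (\<lambda>x. \<Prod>i\<in>I. f i x)"
  by (induction I rule: finite_induct) (auto intro: C_k_const C_k_mult)

text \<open>The whole sequence of derivatives is part of the witness, so that an induction on the
  order of differentiability can run over all \<open>hd j\<close> at once.\<close>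

definition smooth_line :: "(real \<Rightarrow> complex) \<Rightarrow> bool" where
  "smooth_line h \<longleftrightarrow> (\<exists>hd. hd 0 = h \<and>
     (\<forall>j t. (hd j has_vector_derivative hd (Suc j) t) (at t)))"

lemma has_derivative_line:
  fixes \<gamma> :: "real^'n \<Rightarrow> real" and h :: "real \<Rightarrow> complex"
  assumes "(\<gamma> has_derivative \<gamma>') (at x)" "(h has_vector_derivative h') (at (\<gamma> x))"
  shows "((\<lambda>x. h (\<gamma> x)) has_derivative (\<lambda>v. \<gamma>' v *\<^sub>R h')) (at x)"
  using has_derivative_compose[OF assms(1) assms(2)[unfolded has_vector_derivative_def]] .

lemma has_derivative_Re_of_real:
  fixes \<gamma> :: "real^'n \<Rightarrow> real"
  assumes "(\<lambda>x. complex_of_real (\<gamma> x)) differentiable (at x)"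
  shows "(\<gamma> has_derivative (\<lambda>v. Re (frechet_derivative (\<lambda>x. complex_of_real (\<gamma> x)) (at x) v))) (at x)"
proof -
  have "((\<lambda>x. complex_of_real (\<gamma> x)) has_derivative frechet_derivative (\<lambda>x. complex_of_real (\<gamma> x)) (at x)) (at x)"
    using assms frechet_derivative_works by blast
  from has_derivative_compose[OF this bounded_linear_imp_has_derivative[OF bounded_linear_Re]]
  show ?thesis by simp
qed

lemma partial_deriv_of_real_eq:
  fixes \<gamma> :: "real^'n \<Rightarrow> real"
  assumes "(\<gamma> has_derivative \<gamma>') (at x)"
  shows "partial_deriv i (\<lambda>x. complex_of_real (\<gamma> x)) x = of_real (\<gamma>' (axis i 1))"
  using has_derivative_compose[OF assms bounded_linear_imp_has_derivative[OF bounded_linear_of_real]]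
  by (rule partial_deriv_eqI)

lemma partial_deriv_line:
  fixes \<gamma> :: "real^'n \<Rightarrow> real"
  assumes "(\<lambda>x. complex_of_real (\<gamma> x)) differentiable (at x)" "(h has_vector_derivative h') (at (\<gamma> x))"
  shows "(\<lambda>x. h (\<gamma> x)) differentiable (at x)"
    "partial_deriv i (\<lambda>x. h (\<gamma> x)) x = h' * partial_deriv i (\<lambda>x. of_real (\<gamma> x)) x"
proof -
  note d = has_derivative_Re_of_real[OF assms(1)]
  note c = has_derivative_line[OF d assms(2)]
  show "(\<lambda>x. h (\<gamma> x)) differentiable (at x)" using c differentiableI by blast
  show "partial_deriv i (\<lambda>x. h (\<gamma> x)) x = h' * partial_deriv i (\<lambda>x. of_real (\<gamma> x)) x"
    by (subst partial_deriv_eqI[OF c], subst partial_deriv_of_real_eq[OF d]) (simp add: scaleR_conv_of_real)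
qed

lemma C_k_line:
  fixes \<gamma> :: "real^'n \<Rightarrow> real"
  assumes h: "smooth_line h" and \<gamma>: "\<And>k. C_k k (\<lambda>x. complex_of_real (\<gamma> x))"
  shows "C_k k (\<lambda>x. h (\<gamma> x))"
proof -
  obtain hd where hd: "hd 0 = h" "\<And>j t. (hd j has_vector_derivative hd (Suc j) t) (at t)"
    using h unfolding smooth_line_def by metis
  have diff: "(\<lambda>x. complex_of_real (\<gamma> x)) differentiable (at x)" for x
    using \<gamma>[of 1] by simp
  \<comment> \<open>General in \<open>j\<close>, because the chain rule replaces \<open>hd j\<close>
    by \<open>hd (Suc j)\<close> while the order drops by one.\<close>
  have "C_k k (\<lambda>x. hd j (\<gamma> x))" for j
  proof (induction k arbitrary: j)
    case 0
    have "(\<lambda>x. hd j (\<gamma> x)) differentiable (at x)" for x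
      using partial_deriv_line(1)[OF diff hd(2)] .
    then show ?case
      by (auto simp: continuous_on_eq_continuous_at differentiable_imp_continuous_within)
  next
    case (Suc k)
    have "(\<lambda>x. hd j (\<gamma> x)) differentiable (at x)" for x
      using partial_deriv_line(1)[OF diff hd(2)] .
    moreover have "partial_deriv i (\<lambda>x. hd j (\<gamma> x)) =
        (\<lambda>x. hd (Suc j) (\<gamma> x) * partial_deriv i (\<lambda>x. of_real (\<gamma> x)) x)" for i
      using partial_deriv_line(2)[OF diff hd(2)] by (intro ext)
    moreover have "C_k k (partial_deriv i (\<lambda>x. complex_of_real (\<gamma> x)))" for i
      using \<gamma>[of "Suc k"] by simp
    ultimately show ?case using Suc by (auto intro: C_k_mult)
  qed
  then show ?thesis using hd(1) by metis
qed

text \<open>Complex derivatives of every order, restricted to the real axis, form the required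
  sequence. A neighbourhood \<open>A\<close> of the axis is enough, which admits the logistic
  function with its poles off the axis.\<close>

lemma smooth_line_holomorphic:
  assumes "H holomorphic_on A" "open A" "\<And>t. complex_of_real t \<in> A"
  shows "smooth_line (\<lambda>t. H (of_real t))"
  unfolding smooth_line_def
proof (intro exI[of _ "\<lambda>j t. (deriv ^^ j) H (complex_of_real t)"] conjI allI)
  fix j t
  have "(deriv ^^ j) H holomorphic_on A"
    using assms by (metis holomorphic_higher_deriv)
  then have "((deriv ^^ j) H has_field_derivative (deriv ^^ Suc j) H (complex_of_real t)) (at (of_real t))"
    using assms holomorphic_derivI by fastforce
  from has_vector_derivative_real_field[OF this]
  show "((\<lambda>t. (deriv ^^ j) H (complex_of_real t)) has_vector_derivative
     (deriv ^^ Suc j) H (complex_of_real t)) (at t)" .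
qed auto

section \<open>Bump functions\<close>

text \<open>The classical function exp (-1/t), extended by 0, with a polynomial in 1/t as factor:
  this makes the family closed under differentiation.\<close>

definition flat_exp :: "real poly \<Rightarrow> real \<Rightarrow> real" where
  "flat_exp P t = (if t > 0 then poly P (1/t) * exp (- (1/t)) else 0)"

lemma poly_exp_tendsto_0: "((\<lambda>x::real. poly P x * exp (- x)) \<longlongrightarrow> 0) at_top"
proof -
  have "((\<lambda>x::real. \<Sum>i\<le>degree P. coeff P i * (x ^ i / exp x)) \<longlongrightarrow> (\<Sum>i\<le>degree P. coeff P i * 0)) at_top"
    by (intro tendsto_sum tendsto_mult tendsto_const tendsto_power_div_exp_0)
  then show ?thesis
    by (simp add: poly_altdef sum_distrib_left exp_minus divide_inverse mult_ac)
qed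

lemma flat_exp_tendsto_0: "(flat_exp P \<longlongrightarrow> 0) (at_right 0)"
proof -
  have "((\<lambda>t::real. poly P (inverse t) * exp (- inverse t)) \<longlongrightarrow> 0) (at_right 0)"
    using filterlim_compose[OF poly_exp_tendsto_0 filterlim_inverse_at_top_right] .
  moreover have "\<forall>\<^sub>F t in at_right 0. poly P (inverse t) * exp (- inverse t) = flat_exp P t"
    unfolding flat_exp_def eventually_at_filter by (auto simp: inverse_eq_divide)
  ultimately show ?thesis by (rule Lim_transform_eventually)
qed

text \<open>For t > 0 the product rule gives (1/t)^2 (P - P')(1/t) exp (-1/t), whence the polynomial
  X^2 (P - P'). The point 0 is the only delicate one.\<close>

lemma flat_exp_deriv:
  "(flat_exp P has_real_derivative flat_exp (monom 1 2 * (P - pderiv P)) t) (at t)"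
proof -
  consider "t < 0" | "t > 0" | "t = 0" by linarith
  then show ?thesis
  proof cases
    case 1
    have "((\<lambda>t. 0) has_real_derivative 0) (at t)" by simp
    then have "(flat_exp P has_real_derivative 0) (at t)"
      by (rule has_field_derivative_transform_within_open[where S="{..<0}"])
        (use 1 in \<open>auto simp: flat_exp_def\<close>)
    then show ?thesis using 1 by (simp add: flat_exp_def)
  next
    case 2
    have "((\<lambda>t. poly P (1/t) * exp (- (1/t))) has_real_derivative
       (poly (pderiv P) (1/t) * (- 1 / t^2)) * exp (- (1/t)) + poly P (1/t) * (exp (- (1/t)) * (1/t^2))) (at t)"
      using 2 by (auto intro!: derivative_eq_intros DERIV_chain'[OF _ poly_DERIV] simp: power2_eq_square divide_simps)
    also have "(poly (pderiv P) (1/t) * (- 1 / t^2)) * exp (- (1/t)) + poly P (1/t) * (exp (- (1/t)) * (1/t^2))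
       = flat_exp (monom 1 2 * (P - pderiv P)) t"
      using 2 by (simp add: flat_exp_def poly_monom field_simps)
    finally show ?thesis
      by (rule has_field_derivative_transform_within_open[where S="{0<..}"])
        (use 2 in \<open>auto simp: flat_exp_def\<close>)
  next
    case 3
    \<comment> \<open>Division by the argument multiplies the polynomial by X, so the right
      difference quotient at 0 is again a \<open>flat_exp\<close> and tends to 0.\<close>
    have 1: "((\<lambda>h. flat_exp P h / h) \<longlongrightarrow> 0) (at_right 0)"
    proof (rule Lim_transform_eventually[OF flat_exp_tendsto_0[of "monom 1 1 * P"]])
      show "\<forall>\<^sub>F t in at_right 0. flat_exp (monom 1 1 * P) t = flat_exp P t / t"
        unfolding flat_exp_def eventually_at_filter by (auto simp: poly_monom)
    qed
    have 2: "((\<lambda>h. flat_exp P h / h) \<longlongrightarrow> 0) (at_left 0)"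
      by (rule Lim_transform_eventually[OF tendsto_const[of 0]])
        (auto simp: flat_exp_def eventually_at_filter)
    have "((\<lambda>h. flat_exp P h / h) \<longlongrightarrow> 0) (at 0)"
      using 1 2 by (simp add: filterlim_at_split)
    then show ?thesis using 3 by (simp add: has_field_derivative_iff flat_exp_def)
  qed
qed

lemma smooth_line_flat_exp: "smooth_line (\<lambda>t. of_real (flat_exp P t))"
  unfolding smooth_line_def
proof (intro exI[of _ "\<lambda>j t. complex_of_real (flat_exp (((\<lambda>P. monom 1 2 * (P - pderiv P)) ^^ j) P) t)"] conjI allI)
  fix j t
  show "((\<lambda>t. complex_of_real (flat_exp (((\<lambda>P. monom 1 2 * (P - pderiv P)) ^^ j) P) t)) has_vector_derivative
        complex_of_real (flat_exp (((\<lambda>P. monom 1 2 * (P - pderiv P)) ^^ Suc j) P) t)) (at t)"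
    using has_vector_derivative_of_real[OF flat_exp_deriv[of "((\<lambda>P. monom 1 2 * (P - pderiv P)) ^^ j) P" t]]
    by simp
qed simp

lemma C_k_affine: "C_k k (\<lambda>x::real^'n. complex_of_real (c * (x $ i - a)))"
proof (cases k)
  case 0
  then show ?thesis by (auto intro!: continuous_intros)
next
  case (Suc k')
  have d: "((\<lambda>x::real^'n. complex_of_real (c * (x $ i - a))) has_derivative
      (\<lambda>v. complex_of_real (c * (v $ i)))) (at x)" for x
    by (auto intro!: derivative_eq_intros bounded_linear_imp_has_derivative bounded_linear_vec_nth)
  then have "(\<lambda>x::real^'n. complex_of_real (c * (x $ i - a))) differentiable at x" for x
    using differentiableI by blast
  moreover have "partial_deriv j (\<lambda>x::real^'n. complex_of_real (c * (x $ i - a))) =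
     (\<lambda>x. complex_of_real (c * (axis j 1 $ i)))" for j
    by (rule ext) (rule partial_deriv_eqI[OF d])
  ultimately show ?thesis using Suc C_k_const by auto
qed

text \<open>The factor \<open>c\<close> steepens the flanks: as it grows, the bumps tend pointwise
  to the indicator of the open box, always with values in [0,1] and support in the closed
  box.\<close>

definition box_bump :: "real \<Rightarrow> real^'n \<Rightarrow> real^'n \<Rightarrow> real^'n \<Rightarrow> real" where
  "box_bump c a b x = (\<Prod>i\<in>UNIV. flat_exp 1 (c * (x $ i - a $ i)) * flat_exp 1 (c * (b $ i - x $ i)))"

lemma C_k_box_bump: "C_k k (\<lambda>x. complex_of_real (box_bump c a b x))"
proof -
  have "C_k k (\<lambda>x. complex_of_real (flat_exp 1 (c * (x $ i - a $ i))))" for i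
    by (rule C_k_line[OF smooth_line_flat_exp]) (rule C_k_affine)
  moreover have "C_k k (\<lambda>x. complex_of_real (flat_exp 1 (c * (b $ i - x $ i))))" for i
  proof (rule C_k_line[OF smooth_line_flat_exp])
    fix k
    show "C_k k (\<lambda>x. complex_of_real (c * (b $ i - x $ i)))"
      using C_k_affine[of k "-c" i "b $ i"] by (simp add: algebra_simps)
  qed
  ultimately show ?thesis unfolding box_bump_def of_real_prod of_real_mult
    by (intro C_k_prod C_k_mult) auto
qed

lemma flat_exp_1_bounds: "0 \<le> flat_exp 1 t" "flat_exp 1 t \<le> 1"
  by (auto simp: flat_exp_def)

lemma box_bump_bounds: "0 \<le> box_bump c a b x" "box_bump c a b x \<le> 1"
  unfolding box_bump_def by (auto intro!: prod_nonneg prod_le_1 mult_le_one simp: flat_exp_1_bounds)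

lemma box_bump_eq_0: "c > 0 \<Longrightarrow> x \<notin> box a b \<Longrightarrow> box_bump c a b x = 0"
  unfolding box_bump_def mem_box_cart
  by (auto simp: flat_exp_def zero_less_mult_iff)

lemma box_bump_pos: "c > 0 \<Longrightarrow> x \<in> box a b \<Longrightarrow> box_bump c a b x > 0"
  unfolding box_bump_def mem_box_cart
  by (auto simp: flat_exp_def intro!: prod_pos)

lemma box_bump_tendsto:
  "(\<lambda>n. box_bump (real (Suc n)) a b x) \<longlonglongrightarrow> indicator (box a b) x"
proof (cases "x \<in> box a b")
  case True
  have *: "(\<lambda>n. flat_exp 1 (real (Suc n) * t)) \<longlonglongrightarrow> 1" if "t > 0" for t
  proof -
    have "(\<lambda>n. exp (- (1 / t * (1 / real (Suc n))))) \<longlonglongrightarrow> exp (- (1/t * 0))"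
      using LIMSEQ_inverse_real_of_nat
      by (intro tendsto_intros) (simp add: inverse_eq_divide)
    then show ?thesis using that by (simp add: flat_exp_def mult.commute)
  qed
  have "(\<lambda>n. box_bump (real (Suc n)) a b x) \<longlonglongrightarrow> (\<Prod>i::'a\<in>UNIV. 1 * 1)"
    unfolding box_bump_def using True
    by (intro tendsto_prod tendsto_mult *) (auto simp: mem_box_cart)
  then show ?thesis using True by simp
next
  case False
  then show ?thesis by (simp add: box_bump_eq_0)
qed

lemma test_functionsI:
  assumes "\<And>k. C_k k \<eta>" "compact K" "K \<subseteq> U" "\<And>x. x \<notin> K \<Longrightarrow> \<eta> x = 0"
  shows "\<eta> \<in> test_functions U"
proof -
  have "closure {x. \<eta> x \<noteq> 0} \<subseteq> K"
    using assms by (intro closure_minimal) (auto simp: compact_imp_closed)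
  moreover from this have "compact (closure {x. \<eta> x \<noteq> 0})"
    using \<open>compact K\<close> by (metis closed_closure compact_Int_closed inf.absorb_iff2)
  ultimately show ?thesis
    using assms unfolding test_functions_def by auto
qed

lemma box_bump_test: "c > 0 \<Longrightarrow> cbox a b \<subseteq> U \<Longrightarrow> (\<lambda>x. complex_of_real (box_bump c a b x)) \<in> test_functions U"
  by (intro test_functionsI[of _ "cbox a b"] C_k_box_bump)
    (use box_subset_cbox[of a b] in \<open>auto intro!: box_bump_eq_0\<close>)

section \<open>Smooth approximation of Lipschitz functions\<close>

text \<open>McShane's extension: the infimum of the cones g y + L |x - y| with apex over U is again
  \<open>L\<close>-Lipschitz, and on U the cone with apex at the point itself attains it.\<close>

lemma lipschitz_extension_real:
  fixes g :: "'a::metric_space \<Rightarrow> real"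
  assumes lip: "L-lipschitz_on U g" and ne: "U \<noteq> {}"
  obtains G where "L-lipschitz_on UNIV G" "\<And>x. x \<in> U \<Longrightarrow> G x = g x"
proof -
  define G where "G x = (INF y\<in>U. g y + L * dist x y)" for x
  have L: "L \<ge> 0" using lip by (rule lipschitz_on_nonneg)
  have glip: "g x \<le> g y + L * dist x y" if "x \<in> U" "y \<in> U" for x y
    using lipschitz_onD[OF lip that] by (auto simp: dist_real_def)
  obtain u where u: "u \<in> U" using ne by auto
  have bdd: "bdd_below ((\<lambda>y. g y + L * dist x y) ` U)" for x
  proof (rule bdd_belowI2[where m="g u - L * dist x u"])
    fix y assume "y \<in> U"
    have "g u \<le> g y + L * dist u y" using glip u \<open>y \<in> U\<close> by blast
    also have "\<dots> \<le> g y + L * (dist x u + dist x y)"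
      using L by (intro add_left_mono mult_left_mono) (metis dist_commute dist_triangle)
    finally show "g u - L * dist x u \<le> g y + L * dist x y" by (simp add: algebra_simps)
  qed
  have eq: "G x = g x" if "x \<in> U" for x
    unfolding G_def
  proof (rule antisym)
    show "(INF y\<in>U. g y + L * dist x y) \<le> g x"
      using cINF_lower[OF bdd that, of x] by simp
    show "g x \<le> (INF y\<in>U. g y + L * dist x y)"
      using glip that by (intro cINF_greatest) (auto intro: ne)
  qed
  have le: "G x \<le> G x' + L * dist x x'" for x x'
  proof -
    have "G x - L * dist x x' \<le> G x'"
      unfolding G_def[of x']
    proof (rule cINF_greatest[OF ne])
      fix y assume "y \<in> U"
      have "G x \<le> g y + L * dist x y" unfolding G_def by (rule cINF_lower[OF bdd \<open>y \<in> U\<close>])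
      also have "\<dots> \<le> g y + L * (dist x x' + dist x' y)"
        using L by (intro add_left_mono mult_left_mono) (auto simp: dist_triangle)
      finally show "G x - L * dist x x' \<le> g y + L * dist x' y" by (simp add: algebra_simps)
    qed
    then show ?thesis by simp
  qed
  have "L-lipschitz_on UNIV G"
  proof (rule lipschitz_onI[OF _ L])
    fix x y show "dist (G x) (G y) \<le> L * dist x y"
      using le[of x y] le[of y x] by (auto simp: dist_real_def dist_commute)
  qed
  then show ?thesis using eq that by blast
qed

text \<open>The kernel is complex-valued and carries no normalisation, so that a partial derivative
  of the kernel is again a kernel; the induction in \<open>C_k_mollify\<close> feeds it
  back.\<close>

definition mollify :: "(real^'n \<Rightarrow> real) \<Rightarrow> (real^'n \<Rightarrow> complex) \<Rightarrow> real^'n \<Rightarrow> complex" where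
  "mollify g \<rho> x = (LINT y|lborel. of_real (g y) * \<rho> (x - y))"

lemma lborel_integral_restrict:
  fixes f :: "real^'n \<Rightarrow> 'b::euclidean_space"
  assumes "continuous_on UNIV f" "\<And>y. y \<notin> cbox a b \<Longrightarrow> f y = 0"
  shows "integrable lborel f" "(LINT y|lborel. f y) = integral (cbox a b) f"
proof -
  have eq: "f = (\<lambda>y. indicator (cbox a b) y *\<^sub>R f y)"
    using assms(2) by (auto simp: indicator_def)
  have i: "integrable lborel (\<lambda>y. indicator (cbox a b) y *\<^sub>R f y)"
    by (intro borel_integrable_compact continuous_on_subset[OF assms(1)]) auto
  show "integrable lborel f" using i eq by simp
  have "(LINT y|lborel. f y) = (LINT y:cbox a b|lborel. f y)"
    unfolding set_lebesgue_integral_def using eq by simp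
  also have "\<dots> = integral (cbox a b) f"
    using i by (intro set_borel_integral_eq_integral) (simp add: set_integrable_def)
  finally show "(LINT y|lborel. f y) = integral (cbox a b) f" .
qed

lemma lborel_integral_shift:
  fixes f :: "real^'n \<Rightarrow> 'b::euclidean_space"
  assumes "f \<in> borel_measurable borel"
  shows "(LINT y|lborel. f (c + y)) = (LINT y|lborel. f y)"
proof -
  have "(LINT y|lborel. f y) = (LINT y|distr lborel borel ((+) c). f y)"
    by (simp add: lborel_distr_plus)
  also have "\<dots> = (LINT y|lborel. f (c + y))"
    using assms by (intro integral_distr) auto
  finally show ?thesis by simp
qed

lemma shifted_support:
  fixes x :: "real^'n"
  assumes "\<And>z. z \<notin> cbox (-1) 1 \<Longrightarrow> \<rho> z = 0" "x \<in> ball x0 1" "y \<notin> cbox (x0 - 2) (x0 + 2)"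
  shows "\<rho> (x - y) = 0"
proof (rule assms(1), rule notI)
  assume *: "x - y \<in> cbox (-1) 1"
  have "\<bar>x $ i - x0 $ i\<bar> < 1" for i
    using assms(2) component_le_norm_cart[of "x - x0" i] by (simp add: dist_norm norm_minus_commute)
  then have b: "x $ i - x0 $ i < 1 \<and> x0 $ i - x $ i < 1" for i
    by (metis abs_less_iff minus_diff_eq)
  have "x0 $ i - 2 \<le> y $ i \<and> y $ i \<le> x0 $ i + 2" for i
    using b[of i] *[unfolded mem_box_cart, rule_format, of i] by simp
  then show False using assms(3) by (auto simp: mem_box_cart)
qed

text \<open>As x moves in a unit ball, the support of the integrand stays in one fixed box. This
  turns the mollification into an integral over a compact box, to which the Leibniz rule
  applies.\<close>

lemma mollify_local:
  fixes x0 :: "real^'n"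
  assumes g: "continuous_on UNIV g" and \<rho>: "continuous_on UNIV \<rho>"
    and supp: "\<And>z. z \<notin> cbox (-1) 1 \<Longrightarrow> \<rho> z = 0" and x: "x \<in> ball x0 1"
  shows "mollify g \<rho> x = integral (cbox (x0 - 2) (x0 + 2)) (\<lambda>y. of_real (g y) * \<rho> (x - y))"
  unfolding mollify_def
proof (rule lborel_integral_restrict)
  show "continuous_on UNIV (\<lambda>y. complex_of_real (g y) * \<rho> (x - y))"
    by (intro continuous_intros g continuous_on_compose2[OF \<rho>]) auto
  fix y assume "y \<notin> cbox (x0 - 2) (x0 + 2)"
  then show "of_real (g y) * \<rho> (x - y) = 0"
    using shifted_support[of \<rho> x x0 y] supp x by simp
qed

lemma mollify_deriv:
  fixes x0 :: "real^'n"
  assumes g: "continuous_on UNIV g" and \<rho>: "C_k (Suc 0) \<rho>"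
    and supp: "\<And>z. z \<notin> cbox (-1) 1 \<Longrightarrow> \<rho> z = 0"
    and supp': "\<And>i z. z \<notin> cbox (-1) 1 \<Longrightarrow> partial_deriv i \<rho> z = 0"
  shows "mollify g \<rho> differentiable (at x0)"
    "partial_deriv i (mollify g \<rho>) x0 = mollify g (partial_deriv i \<rho>) x0"
proof -
  let ?B = "cbox (x0 - 2) (x0 + 2)"
  define fx where "fx x t = Blinfun (\<lambda>v. of_real (g t) * frechet_derivative \<rho> (at (x - t)) v)" for x t
  have cont: "continuous_on UNIV \<rho>" using C_k_Suc_imp[OF \<rho>] by simp
  have D: "(\<rho> has_derivative frechet_derivative \<rho> (at z)) (at z)" for z
    using \<rho> frechet_derivative_works by auto
  have bl: "bounded_linear (frechet_derivative \<rho> (at z))" for z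
    using D has_derivative_bounded_linear by blast
  have fx: "blinfun_apply (fx x t) = (\<lambda>v. of_real (g t) * frechet_derivative \<rho> (at (x - t)) v)" for x t
    unfolding fx_def by (intro bounded_linear_Blinfun_apply bounded_linear_mult_const bounded_linear_const_mult bl)
  have fxa: "blinfun_apply (fx x t) (axis i 1) = of_real (g t) * partial_deriv i \<rho> (x - t)" for x t i
    unfolding fx partial_deriv_def by simp
  \<comment> \<open>Continuity in the operator norm is tested on basis vectors, where it reduces to
    continuity of the partial derivatives of the kernel.\<close>
  have c: "continuous_on S (\<lambda>(x, t). fx x t)" for S
  proof (rule continuous_on_blinfun_componentwise)
    fix v :: "real^'n" assume "v \<in> Basis"
    then obtain i where v: "v = axis i 1" by (auto simp: Basis_vec_def)
    have pc: "continuous_on UNIV (partial_deriv i \<rho>)" using \<rho> by simp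
    have "continuous_on S (\<lambda>p. complex_of_real (g (snd p)) * partial_deriv i \<rho> (fst p - snd p))"
      by (intro continuous_intros continuous_on_compose2[OF pc] continuous_on_compose2[OF g]) auto
    then show "continuous_on S (\<lambda>p. blinfun_apply (case p of (x, t) \<Rightarrow> fx x t) v)"
      by (simp add: v case_prod_beta fxa)
  qed
  have L: "((\<lambda>x. integral ?B (\<lambda>y. of_real (g y) * \<rho> (x - y))) has_derivative
     blinfun_apply (integral ?B (fx x0))) (at x0 within ball x0 1)"
  proof (rule leibniz_rule[OF _ _ c])
    fix x t
    show "((\<lambda>x. of_real (g t) * \<rho> (x - t)) has_derivative blinfun_apply (fx x t)) (at x within ball x0 1)"
    proof -
      have "((\<lambda>x. \<rho> (x - t)) has_derivative frechet_derivative \<rho> (at (x - t))) (at x)"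
        using has_derivative_compose[OF has_derivative_diff[OF has_derivative_ident has_derivative_const] D, of t x UNIV]
        by simp
      then show ?thesis unfolding fx
        by (rule has_derivative_at_withinI[OF has_derivative_mult_right])
    qed
    show "(\<lambda>y. of_real (g y) * \<rho> (x - y)) integrable_on ?B"
      by (intro integrable_continuous continuous_intros continuous_on_compose2[OF cont]
          continuous_on_subset[OF g]) auto
  qed auto
  have L': "(mollify g \<rho> has_derivative blinfun_apply (integral ?B (fx x0))) (at x0)"
    using L[unfolded at_within_open[OF centre_in_ball[THEN iffD2, OF zero_less_one] open_ball]]
    by (rule has_derivative_transform_within_open[of _ _ _ _ "ball x0 1"])
      (auto simp: mollify_local[OF g cont supp])
  then show "mollify g \<rho> differentiable (at x0)" using differentiableI by blast
  have "continuous_on ?B (fx x0)"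
    using continuous_on_compose2[OF c[of UNIV], of ?B "\<lambda>t. (x0, t)"] by (auto simp: continuous_on_Pair)
  then have "blinfun_apply (integral ?B (fx x0)) (axis i 1) = integral ?B (\<lambda>t. fx x0 t (axis i 1))"
    by (intro blinfun_apply_integral integrable_continuous)
  also have "\<dots> = mollify g (partial_deriv i \<rho>) x0"
    unfolding fxa using \<rho> supp' by (intro mollify_local[symmetric] g) auto
  finally show "partial_deriv i (mollify g \<rho>) x0 = mollify g (partial_deriv i \<rho>) x0"
    using partial_deriv_eqI[OF L'] by simp
qed

lemma partial_deriv_support:
  assumes "\<And>z. z \<notin> K \<Longrightarrow> f z = 0" "closed K" "x \<notin> K"
  shows "partial_deriv i f x = 0"
proof -
  have "((\<lambda>x. 0) has_derivative (\<lambda>v. 0)) (at x)" by simp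
  then have "(f has_derivative (\<lambda>v. 0)) (at x)"
    by (rule has_derivative_transform_within_open[of _ _ _ _ "-K"]) (use assms in auto)
  then show ?thesis using partial_deriv_eqI by fastforce
qed

lemma C_k_mollify:
  assumes g: "continuous_on UNIV g" and "\<And>k. C_k k \<rho>"
    and "\<And>z. z \<notin> cbox (-1) 1 \<Longrightarrow> \<rho> z = 0"
  shows "C_k k (mollify g \<rho>)"
  using assms(2,3)
proof (induction k arbitrary: \<rho>)
  case 0
  have "mollify g \<rho> differentiable (at x)" for x
    by (rule mollify_deriv(1)[OF g 0(1) 0(2)]) (auto intro: partial_deriv_support[of "cbox (-1) 1"] 0(2))
  then show ?case
    by (auto simp: continuous_on_eq_continuous_at differentiable_imp_continuous_within)
next
  case (Suc k)
  have s: "\<And>i z. z \<notin> cbox (-1) 1 \<Longrightarrow> partial_deriv i \<rho> z = 0"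
    by (rule partial_deriv_support[of "cbox (-1) 1"]) (auto intro: Suc.prems(2))
  note d = mollify_deriv[OF g Suc.prems(1) Suc.prems(2) s]
  have "C_k k (partial_deriv i (mollify g \<rho>))" for i
  proof -
    have "partial_deriv i (mollify g \<rho>) = mollify g (partial_deriv i \<rho>)"
      using d(2) by (intro ext) auto
    moreover have "C_k j (partial_deriv i \<rho>)" for j
      using Suc.prems(1)[of "Suc j"] by simp
    ultimately show ?thesis using Suc.IH[OF _ s] by simp
  qed
  then show ?case using d(1) by simp
qed

text \<open>Convolution with a normalised bump of unit size: averaging preserves the Lipschitz
  constant and moves a Lipschitz function by a bounded amount. No small parameter occurs, since a
  bounded error in the exponent changes weights only by bounded factors.\<close>

lemma smooth_approximation:
  fixes g :: "real^'n \<Rightarrow> real"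
  assumes lip: "L-lipschitz_on UNIV g"
  obtains \<gamma> C where "\<And>k. C_k k (\<lambda>x. complex_of_real (\<gamma> x))" "L-lipschitz_on UNIV \<gamma>"
    "\<And>x. \<bar>\<gamma> x - g x\<bar> \<le> C"
proof -
  define r where "r = box_bump 1 (-1) (1::real^'n)"
  define c where "c = (LINT y|lborel. r (- y))"
  define \<gamma> where "\<gamma> x = (LINT y|lborel. g y * r (x - y)) / c" for x
  have L: "L \<ge> 0" using lip by (rule lipschitz_on_nonneg)
  have g: "continuous_on UNIV g" using lip lipschitz_on_continuous_on by blast
  have rC: "C_k k (\<lambda>x. complex_of_real (r x))" for k unfolding r_def by (rule C_k_box_bump)
  then have "continuous_on UNIV (\<lambda>x. complex_of_real (r x))" by (metis C_k.simps(1))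
  then have r: "continuous_on UNIV r"
    by (metis (no_types, lifting) Re_complex_of_real continuous_on_Re continuous_on_cong)
  have supp: "r z = 0" if "z \<notin> cbox (-1) 1" for z
    using that box_subset_cbox[of "-1" 1] unfolding r_def by (intro box_bump_eq_0) auto
  have r0: "0 \<le> r z" for z unfolding r_def by (rule box_bump_bounds)
  have rm: "r \<in> borel_measurable borel" using r by (rule borel_measurable_continuous_onI)
  have supp2: "r (x - y) = 0" if "y \<notin> cbox (x - 2) (x + 2)" for x y
    using shifted_support[of r x x y] supp that by auto
  have cr: "continuous_on UNIV (\<lambda>y. f y * r (x - y))" if "continuous_on UNIV f" for f :: "real^'n \<Rightarrow> real" and x
    by (intro continuous_intros that continuous_on_compose2[OF r]) auto
  have int: "integrable lborel (\<lambda>y. f y * r (x - y))" if "continuous_on UNIV f" for f :: "real^'n \<Rightarrow> real" and x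
    by (rule lborel_integral_restrict(1)[OF cr[OF that], of "x-2" "x+2"]) (simp add: supp2)
  have rint: "integrable lborel (\<lambda>y. r (x - y))" for x using int[of "\<lambda>_. 1" x] by simp
  have c_eq: "(LINT y|lborel. r (x - y)) = c" for x
  proof -
    have "(\<lambda>y. r (x - y)) \<in> borel_measurable borel" using rm by measurable
    from lborel_integral_shift[OF this, of x] show ?thesis unfolding c_def by simp
  qed
  \<comment> \<open>The kernel is strictly positive on an open box, which has positive measure, so
    its integral can be divided by.\<close>
  have c0: "c > 0"
  proof -
    have "c \<ge> 0" unfolding c_def by (intro integral_nonneg_AE) (simp add: r0)
    moreover have "c \<noteq> 0"
    proof
      assume "c = 0"
      then have "AE y in lborel. r (- y) = 0"
        unfolding c_def using rint[of 0] r0 by (subst (asm) integral_nonneg_eq_0_iff_AE) auto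
      then have "AE y in lborel. y \<notin> box (-1) (1::real^'n)"
      proof eventually_elim
        case (elim y)
        show ?case
        proof
          assume "y \<in> box (-1) 1"
          then have "- y \<in> box (-1) 1" by (simp add: mem_box_cart minus_less_iff)
          then show False using box_bump_pos[of 1 "-y" "-1" 1] elim by (simp add: r_def)
        qed
      qed
      then have "box (-1) (1::real^'n) \<in> null_sets lborel"
        by (subst (asm) AE_iff_null_sets[symmetric]) auto
      then have "measure lborel (box (-1) (1::real^'n)) = 0" by (simp add: measure_eq_0_null_sets)
      moreover have "measure lborel (box (-1) (1::real^'n)) > 0"
        by (subst measure_lborel_box) (auto simp: Basis_vec_def inner_axis intro!: prod_pos)
      ultimately show False by simp
    qed
    ultimately show ?thesis by simp
  qed
  have C: "C_k k (\<lambda>x. complex_of_real (\<gamma> x))" for k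
  proof -
    have "(\<lambda>x. complex_of_real (\<gamma> x)) = (\<lambda>x. mollify g (\<lambda>x. of_real (r x)) x * of_real (1 / c))"
    proof
      fix x
      have "mollify g (\<lambda>x. of_real (r x)) x = of_real (LINT y|lborel. g y * r (x - y))"
        unfolding mollify_def of_real_mult[symmetric] by (rule integral_complex_of_real)
      then show "complex_of_real (\<gamma> x) = mollify g (\<lambda>x. of_real (r x)) x * of_real (1 / c)"
        by (simp add: \<gamma>_def)
    qed
    moreover have "C_k k (\<lambda>x. mollify g (\<lambda>x. of_real (r x)) x * of_real (1 / c))"
      by (intro C_k_mult C_k_const C_k_mollify g rC) (simp add: supp)
    ultimately show ?thesis by simp
  qed
  \<comment> \<open>The kernel at x - y vanishes outside the cube [-1,1]^d, on which the Euclidean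
    norm is at most the l1 norm and thus at most the dimension.\<close>
  have close: "\<bar>\<gamma> x - g x\<bar> \<le> L * real CARD('n)" for x
  proof -
    have "c * (\<gamma> x - g x) = (LINT y|lborel. g y * r (x - y)) - g x * (LINT y|lborel. r (x - y))"
      using c0 by (simp add: \<gamma>_def c_eq algebra_simps)
    also have "\<dots> = (LINT y|lborel. g y * r (x - y) - g x * r (x - y))"
      using int[OF g] rint by simp
    finally have "c * (\<gamma> x - g x) = (LINT y|lborel. g y * r (x - y) - g x * r (x - y))" .
    then have "\<bar>c * (\<gamma> x - g x)\<bar> \<le> (LINT y|lborel. \<bar>g y * r (x - y) - g x * r (x - y)\<bar>)"
      by simp
    also have "\<dots> \<le> (LINT y|lborel. (L * real CARD('n)) * r (x - y))"
    proof (rule integral_mono)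
      show "integrable lborel (\<lambda>y. \<bar>g y * r (x - y) - g x * r (x - y)\<bar>)"
        using int[OF g] rint by auto
      show "integrable lborel (\<lambda>y. (L * real CARD('n)) * r (x - y))" using rint by simp
      fix y
      show "\<bar>g y * r (x - y) - g x * r (x - y)\<bar> \<le> L * real CARD('n) * r (x - y)"
      proof (cases "x - y \<in> cbox (-1) 1")
        case True
        have "norm (x - y) \<le> (\<Sum>i\<in>UNIV. \<bar>(x - y) $ i\<bar>)" by (rule norm_le_l1_cart)
        also have "\<dots> \<le> (\<Sum>i\<in>(UNIV::'n set). 1)"
          using True by (intro sum_mono) (simp add: mem_box_cart abs_le_iff, smt (verit))
        finally have n: "dist y x \<le> real CARD('n)" by (simp add: dist_norm norm_minus_commute)
        have "\<bar>g y - g x\<bar> \<le> L * dist y x"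
          using lipschitz_onD[OF lip, of y x] by (simp add: dist_real_def)
        also have "\<dots> \<le> L * real CARD('n)" using n L by (rule mult_left_mono)
        finally show ?thesis
          using r0[of "x - y"] by (simp add: left_diff_distrib[symmetric] abs_mult mult_right_mono)
      next
        case False then show ?thesis by (simp add: supp)
      qed
    qed
    also have "\<dots> = L * real CARD('n) * c" by (simp add: c_eq)
    finally show ?thesis using c0 by (simp add: abs_mult)
  qed
  have "L-lipschitz_on UNIV \<gamma>"
  proof (rule lipschitz_onI[OF _ L])
    fix x x' :: "real^'n"
    define h where "h = x - x'"
    have gh: "continuous_on UNIV (\<lambda>y. g (h + y))"
      by (intro continuous_on_compose2[OF g] continuous_intros) auto
    have "(\<lambda>y. g y * r (x - y)) \<in> borel_measurable borel"
      using cr[OF g] by (rule borel_measurable_continuous_onI)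
    \<comment> \<open>Translation by h = x - x' moves the increment from the kernel to
      \<open>g\<close>, where the Lipschitz bound applies.\<close>
    from lborel_integral_shift[OF this, of h]
    have "c * (\<gamma> x - \<gamma> x') = (LINT y|lborel. g (h + y) * r (x' - y)) - (LINT y|lborel. g y * r (x' - y))"
      using c0 by (simp add: \<gamma>_def algebra_simps h_def)
    also have "\<dots> = (LINT y|lborel. g (h + y) * r (x' - y) - g y * r (x' - y))"
      using int[OF g] int[OF gh] by simp
    finally have "\<bar>c * (\<gamma> x - \<gamma> x')\<bar> \<le> (LINT y|lborel. \<bar>g (h + y) * r (x' - y) - g y * r (x' - y)\<bar>)"
      by simp
    also have "\<dots> \<le> (LINT y|lborel. (L * dist x x') * r (x' - y))"
    proof (rule integral_mono)
      show "integrable lborel (\<lambda>y. \<bar>g (h + y) * r (x' - y) - g y * r (x' - y)\<bar>)"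
        using int[OF g] int[OF gh] by auto
      show "integrable lborel (\<lambda>y. (L * dist x x') * r (x' - y))" using rint by simp
      fix y
      have "\<bar>g (h + y) - g y\<bar> \<le> L * dist x x'"
        using lipschitz_onD[OF lip, of "h + y" y] by (simp add: dist_real_def dist_norm h_def)
      then show "\<bar>g (h + y) * r (x' - y) - g y * r (x' - y)\<bar> \<le> L * dist x x' * r (x' - y)"
        using r0[of "x' - y"] by (simp add: left_diff_distrib[symmetric] abs_mult mult_right_mono)
    qed
    also have "\<dots> = L * dist x x' * c" by (simp add: c_eq)
    finally show "dist (\<gamma> x) (\<gamma> x') \<le> L * dist x x'"
      using c0 by (simp add: abs_mult dist_real_def)
  qed
  then show ?thesis using C close that by blast
qed

section \<open>Weak gradients\<close>

lemma integrable_lebesgue_on_iff: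
  fixes f :: "real^'n \<Rightarrow> 'b::{banach, second_countable_topology}"
  assumes "S \<in> sets lebesgue"
  shows "integrable (lebesgue_on S) f \<longleftrightarrow> integrable lebesgue (\<lambda>x. indicator S x *\<^sub>R f x)"
  using assms by (intro integrable_restrict_space) auto

lemma integral_lebesgue_on:
  fixes f :: "real^'n \<Rightarrow> 'b::{banach, second_countable_topology}"
  assumes "S \<in> sets lebesgue"
  shows "(LINT x|lebesgue_on S. f x) = (LINT x|lebesgue. indicator S x *\<^sub>R f x)"
  using assms by (intro integral_restrict_space) auto

lemma AE_lebesgue_on_iff:
  assumes "S \<in> sets lebesgue"
  shows "(AE x in lebesgue_on S. P x) \<longleftrightarrow> (AE x in lebesgue. x \<in> S \<longrightarrow> P x)"
  using assms by (intro AE_restrict_space_iff) auto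

lemma open_sets_lebesgue: "open (U :: (real^'n) set) \<Longrightarrow> U \<in> sets lebesgue"
  by simp

lemma compact_sets_lebesgue: "compact (K :: (real^'n) set) \<Longrightarrow> K \<in> sets lebesgue"
  by (simp add: compact_imp_closed)

lemma locally_integrable_measurable:
  fixes f :: "real^'n \<Rightarrow> 'b::{banach, second_countable_topology}"
  assumes U: "open U" and f: "locally_integrable_on f U"
  shows "f \<in> borel_measurable (lebesgue_on U)"
proof -
  obtain \<D> where D: "countable \<D>" "\<D> \<subseteq> Pow U" "\<And>X. X \<in> \<D> \<Longrightarrow> \<exists>a b. X = cbox a b" "\<Union>\<D> = U"
    using open_countable_Union_open_cbox[OF U] by metis
  show ?thesis
  proof (rule measurable_piecewise_restrict[OF D(1)])
    fix X assume X: "X \<in> \<D>"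
    then have c: "compact X" "X \<subseteq> U" using D(2) D(3)[OF X] by (auto intro: compact_cbox)
    then show "X \<inter> space (lebesgue_on U) \<in> sets (lebesgue_on U)"
      using U by (auto simp: sets_restrict_space_iff intro: compact_sets_lebesgue Int_absorb2)
    have "f \<in> borel_measurable (lebesgue_on X)"
      using f c unfolding locally_integrable_on_def by (auto intro: borel_measurable_integrable)
    then show "f \<in> borel_measurable (restrict_space (lebesgue_on U) X)"
      using c U by (simp add: restrict_restrict_space compact_sets_lebesgue Int_absorb1)
  qed (use D(4) in auto)
qed

lemma locally_integrable_mult:
  fixes f c :: "real^'n \<Rightarrow> complex"
  assumes U: "open U" and f: "locally_integrable_on f U"
    and K: "compact K" "K \<subseteq> U" and c: "c \<in> borel_measurable lebesgue"
    and B: "\<And>x. x \<in> K \<Longrightarrow> norm (c x) \<le> B" and c0: "\<And>x. x \<in> U \<Longrightarrow> x \<notin> K \<Longrightarrow> c x = 0"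
  shows "integrable (lebesgue_on U) (\<lambda>x. f x * c x)"
proof -
  have i: "integrable (lebesgue_on K) f" using f K unfolding locally_integrable_on_def by auto
  have "integrable (lebesgue_on K) (\<lambda>x. f x * c x)"
  proof (rule Bochner_Integration.integrable_bound)
    show "integrable (lebesgue_on K) (\<lambda>x. B * norm (f x))" using i by auto
    have "c \<in> borel_measurable (lebesgue_on K)" using c by (rule measurable_restrict_space1)
    then show "(\<lambda>x. f x * c x) \<in> borel_measurable (lebesgue_on K)"
      using i by (intro borel_measurable_times) (auto intro: borel_measurable_integrable)
    show "AE x in lebesgue_on K. norm (f x * c x) \<le> norm (B * norm (f x))"
    proof (rule AE_I2)
      fix x assume "x \<in> space (lebesgue_on K)"
      then have "norm (c x) \<le> \<bar>B\<bar>" using B by fastforce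
      then show "norm (f x * c x) \<le> norm (B * norm (f x))"
        by (simp add: norm_mult abs_mult mult.commute[of "cmod (f x)"] mult_right_mono)
    qed
  qed
  moreover have "(\<lambda>x. indicator U x *\<^sub>R (f x * c x)) = (\<lambda>x. indicator K x *\<^sub>R (f x * c x))"
    using K(2) c0 by (auto simp: indicator_def fun_eq_iff)
  ultimately show ?thesis
    using U K by (simp only: integrable_lebesgue_on_iff compact_sets_lebesgue open_sets_lebesgue)
qed

lemma C_k_continuous: "C_k k f \<Longrightarrow> continuous_on UNIV f"
proof (induction k)
  case (Suc k)
  then show ?case using C_k_Suc_imp by blast
qed simp

lemma test_function_bounded:
  assumes "\<eta> \<in> test_functions U"
  obtains K B where "compact K" "K \<subseteq> U" "\<And>x. x \<notin> K \<Longrightarrow> \<eta> x = 0"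
    "\<And>x. norm (\<eta> x) \<le> B"
proof -
  let ?K = "closure {x. \<eta> x \<noteq> 0}"
  have K: "compact ?K" "?K \<subseteq> U" and c: "continuous_on UNIV \<eta>"
    using assms unfolding test_functions_def by (auto dest: C_k_continuous)
  have s: "\<eta> x = 0" if "x \<notin> ?K" for x using that closure_subset[of "{x. \<eta> x \<noteq> 0}"] by blast
  have "compact (\<eta> ` ?K)" using K c by (intro compact_continuous_image) (auto intro: continuous_on_subset)
  then obtain B where B: "\<And>x. x \<in> ?K \<Longrightarrow> norm (\<eta> x) \<le> B"
    by (metis bounded_iff compact_imp_bounded imageI)
  have "norm (\<eta> x) \<le> \<bar>B\<bar>" for x using B[of x] s[of x] by (cases "x \<in> ?K") auto
  then show ?thesis using that K s by blast
qed

lemma test_function_partial_deriv: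
  assumes "\<eta> \<in> test_functions U"
  shows "partial_deriv i \<eta> \<in> test_functions U"
proof -
  obtain K B where K: "compact K" "K \<subseteq> U" "\<And>x. x \<notin> K \<Longrightarrow> \<eta> x = 0"
    using test_function_bounded[OF assms] by metis
  have "C_k k \<eta>" for k using assms by (auto simp: test_functions_def)
  then have "C_k k (partial_deriv i \<eta>)" for k using C_k.simps(2) by blast
  then show ?thesis
    using K by (intro test_functionsI[of _ K]) (auto intro: partial_deriv_support[of K] compact_imp_closed)
qed

lemma test_function_mult:
  assumes "\<eta> \<in> test_functions U" "\<And>k. C_k k m"
  shows "(\<lambda>x. m x * \<eta> x) \<in> test_functions U"
proof -
  obtain K B where K: "compact K" "K \<subseteq> U" "\<And>x. x \<notin> K \<Longrightarrow> \<eta> x = 0"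
    using test_function_bounded[OF assms(1)] by metis
  then show ?thesis using assms
    by (intro test_functionsI[of _ K] C_k_mult) (auto simp: test_functions_def)
qed

lemma continuous_lebesgue_measurable: "continuous_on UNIV f \<Longrightarrow> f \<in> borel_measurable lebesgue"
  by (simp add: borel_measurable_continuous_onI measurable_completion)

lemma integrable_times_test:
  fixes f :: "real^'n \<Rightarrow> complex"
  assumes U: "open U" and f: "locally_integrable_on f U" and \<eta>: "\<eta> \<in> test_functions U"
  shows "integrable (lebesgue_on U) (\<lambda>x. f x * \<eta> x)"
proof -
  obtain K B where K: "compact K" "K \<subseteq> U" "\<And>x. x \<notin> K \<Longrightarrow> \<eta> x = 0" "\<And>x. norm (\<eta> x) \<le> B"
    using test_function_bounded[OF \<eta>] by metis
  have "continuous_on UNIV \<eta>" using \<eta> by (auto simp: test_functions_def dest: C_k_continuous)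
  then show ?thesis
    using K by (intro locally_integrable_mult[OF U f K(1,2), of _ B] continuous_lebesgue_measurable) auto
qed

lemma borel_indicator_lebesgue:
  "S \<in> sets borel \<Longrightarrow> (indicator S :: real^'n \<Rightarrow> complex) \<in> borel_measurable lebesgue"
  by (rule borel_measurable_indicator) auto

text \<open>Boxes form an intersection-stable generator of the Borel sets, so a Dynkin argument
  gives vanishing integrals over all of them; the complement step uses that the total integral is 0,
  as the support lies in one box. Lebesgue sets differ from Borel sets by null sets, and a density
  with vanishing integrals is 0 almost everywhere.\<close>

lemma AE_zero_if_box_integrals_zero:
  fixes F :: "real^'n \<Rightarrow> real"
  assumes i: "integrable lebesgue F" and supp: "\<And>x. x \<notin> box a b \<Longrightarrow> F x = 0"
    and z: "\<And>c d. (LINT x:box c d|lebesgue. F x) = 0"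
  shows "AE x in lebesgue. F x = 0"
proof -
  have si: "set_integrable lebesgue A F" if "A \<in> sets lebesgue" for A
    unfolding set_integrable_def using that i by (rule integrable_mult_indicator)
  have tot: "(LINT x|lebesgue. F x) = 0"
  proof -
    have "(LINT x|lebesgue. F x) = (LINT x:box a b|lebesgue. F x)"
      unfolding set_lebesgue_integral_def using supp
      by (intro Bochner_Integration.integral_cong) (auto simp: indicator_def)
    then show ?thesis using z by simp
  qed
  let ?E = "range (\<lambda>(a, b). box a b :: (real^'n) set)"
  have borel: "(LINT x:A|lebesgue. F x) = 0" if "A \<in> sets borel" for A
  proof -
    have "Int_stable ?E" by (auto simp: Int_stable_def box_Int_box)
    moreover have "?E \<subseteq> Pow UNIV" by simp
    moreover have "A \<in> sigma_sets UNIV ?E" using that by (simp add: borel_eq_box)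
    ultimately show ?thesis
    proof (induction rule: sigma_sets_induct_disjoint)
      case (basic A) then show ?case using z by auto
    next
      case empty then show ?case by (simp add: set_lebesgue_integral_def)
    next
      case (compl A)
      then have A: "A \<in> sets borel" by (simp add: borel_eq_box)
      have "(LINT x:UNIV|lebesgue. F x) = (LINT x:A \<union> (UNIV - A)|lebesgue. F x)" by simp
      also have "\<dots> = (LINT x:A|lebesgue. F x) + (LINT x:UNIV - A|lebesgue. F x)"
        using A by (intro set_integral_Un si) auto
      finally show ?case using compl tot by (simp add: set_lebesgue_integral_def)
    next
      case (union A)
      then have A: "A i \<in> sets borel" for i by (auto simp: borel_eq_box)
      have "(LINT x:(\<Union>i. A i)|lebesgue. F x) = (\<Sum>i. LINT x:A i|lebesgue. F x)"
        using A union(1) by (intro lebesgue_integral_countable_add si)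
          (auto simp: disjoint_family_on_def)
      then show ?case using union by simp
    qed
  qed
  have "(LINT x:A|lebesgue. F x) = 0" if A: "A \<in> sets lebesgue" for A
  proof -
    obtain S N N' where S: "A = S \<union> N" "N \<subseteq> N'" "N' \<in> null_sets lborel" "S \<in> sets lborel"
      using sets_completionE[OF A] by metis
    have "AE x in lebesgue. x \<notin> N'" using S(3) by (intro AE_completion AE_not_in)
    then have "AE x in lebesgue. indicator A x *\<^sub>R F x = indicator S x *\<^sub>R F x"
      by eventually_elim (use S in \<open>auto simp: indicator_def\<close>)
    then have "(LINT x:A|lebesgue. F x) = (LINT x:S|lebesgue. F x)"
      unfolding set_lebesgue_integral_def using si[OF A] si[of S] S
      by (intro integral_cong_AE) (auto simp: set_integrable_def intro: borel_measurable_integrable)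
    then show ?thesis using borel S by simp
  qed
  then show ?thesis
    using i by (intro density_unique_real[of _ _ "\<lambda>_. 0"]) auto
qed

text \<open>Test with bumps that converge to the indicator of the box. The indicator of the closed
  box, which is compact in U, dominates them all.\<close>

lemma box_integral_zero:
  fixes f :: "real^'n \<Rightarrow> complex"
  assumes U: "open U" and f: "locally_integrable_on f U"
    and z: "\<And>\<eta>. \<eta> \<in> test_functions U \<Longrightarrow> (LINT x|lebesgue_on U. f x * \<eta> x) = 0"
    and c: "cbox a b \<subseteq> U"
  shows "(LINT x|lebesgue_on U. f x * indicator (box a b) x) = 0"
proof -
  define \<eta> where "\<eta> n x = complex_of_real (box_bump (real (Suc n)) a b x)" for n x
  have t: "\<eta> n \<in> test_functions U" for n
    using box_bump_test[of "real (Suc n)" a b U] c by (simp add: \<eta>_def[abs_def])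
  have "(\<lambda>n. LINT x|lebesgue_on U. f x * \<eta> n x) \<longlonglongrightarrow> (LINT x|lebesgue_on U. f x * indicator (box a b) x)"
  proof (rule integral_dominated_convergence[where w="\<lambda>x. norm (f x * indicator (cbox a b) x)"])
    have m: "(indicator (cbox a b) :: _ \<Rightarrow> complex) \<in> borel_measurable lebesgue"
      by (rule borel_indicator_lebesgue) simp
    have "integrable (lebesgue_on U) (\<lambda>x. f x * indicator (cbox a b) x)"
      by (rule locally_integrable_mult[OF U f compact_cbox c m, where B=1]) (auto simp: indicator_def)
    then show "integrable (lebesgue_on U) (\<lambda>x. norm (f x * indicator (cbox a b) x))" by (rule integrable_norm)
    show "(\<lambda>x. f x * indicator (box a b) x) \<in> borel_measurable (lebesgue_on U)"
      by (rule borel_measurable_times[OF locally_integrable_measurable[OF U f]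
            measurable_restrict_space1[OF borel_indicator_lebesgue]]) simp
    show "(\<lambda>x. f x * \<eta> n x) \<in> borel_measurable (lebesgue_on U)" for n
      using integrable_times_test[OF U f t] by (rule borel_measurable_integrable)
    show "AE x in lebesgue_on U. (\<lambda>n. f x * \<eta> n x) \<longlonglongrightarrow> f x * indicator (box a b) x"
    proof (rule AE_I2)
      fix x
      have "(\<lambda>n. complex_of_real (box_bump (real (Suc n)) a b x)) \<longlonglongrightarrow> complex_of_real (indicator (box a b) x)"
        by (intro tendsto_of_real box_bump_tendsto)
      then show "(\<lambda>n. f x * \<eta> n x) \<longlonglongrightarrow> f x * indicator (box a b) x"
        unfolding \<eta>_def by (intro tendsto_mult tendsto_const) (auto simp: indicator_def)
    qed
    show "AE x in lebesgue_on U. norm (f x * \<eta> n x) \<le> norm (f x * indicator (cbox a b) x)" for n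
    proof (rule AE_I2)
      fix x
      show "norm (f x * \<eta> n x) \<le> norm (f x * indicator (cbox a b) x)"
      proof (cases "x \<in> box a b")
        case True
        then have "x \<in> cbox a b" using box_subset_cbox by blast
        then show ?thesis using box_bump_bounds[of "real (Suc n)" a b x]
          by (auto simp: \<eta>_def norm_mult mult_left_le simp del: of_nat_Suc)
      next
        case False
        then show ?thesis using box_bump_eq_0[of "real (Suc n)" x a b] by (simp add: \<eta>_def)
      qed
    qed
  qed
  then show ?thesis using z[OF t] by (simp add: LIMSEQ_const_iff)
qed

text \<open>The fundamental lemma of the calculus of variations. It is localised to boxes with
  closure in U, because \<open>f\<close> is only locally integrable.\<close>

lemma weak_zero_AE:
  fixes f :: "real^'n \<Rightarrow> complex"
  assumes U: "open U" and f: "locally_integrable_on f U"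
    and z: "\<And>\<eta>. \<eta> \<in> test_functions U \<Longrightarrow> (LINT x|lebesgue_on U. f x * \<eta> x) = 0"
  shows "AE x in lebesgue_on U. f x = 0"
proof -
  note Us = open_sets_lebesgue[OF U]
  obtain \<D> where D: "countable \<D>" "\<D> \<subseteq> Pow U" "\<And>X. X \<in> \<D> \<Longrightarrow> \<exists>a b. X = cbox a b" "\<Union>\<D> = U"
    using open_countable_Union_open_cbox[OF U] by metis
  have main: "AE x in lebesgue. x \<in> box a b \<longrightarrow> f x = 0" if c: "cbox a b \<subseteq> U" for a b
  proof -
    have box: "box a b \<subseteq> U" using c box_subset_cbox by blast
    have i: "integrable lebesgue (\<lambda>x. indicator (box a b) x *\<^sub>R f x)"
    proof -
      have m: "(indicator (box a b) :: _ \<Rightarrow> complex) \<in> borel_measurable lebesgue"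
        by (rule borel_indicator_lebesgue) simp
      have "integrable (lebesgue_on U) (\<lambda>x. f x * indicator (box a b) x)"
        by (rule locally_integrable_mult[OF U f compact_cbox c m, where B=1])
          (use box_subset_cbox[of a b] in \<open>auto simp: indicator_def\<close>)
      then have "integrable lebesgue (\<lambda>x. indicator U x *\<^sub>R (f x * indicator (box a b) x))"
        using Us by (simp add: integrable_lebesgue_on_iff)
      also have "(\<lambda>x. indicator U x *\<^sub>R (f x * indicator (box a b) x)) = (\<lambda>x. indicator (box a b) x *\<^sub>R f x)"
        using box by (auto simp: indicator_def fun_eq_iff)
      finally show ?thesis .
    qed
    have zero: "(LINT x:box c d|lebesgue. indicator (box a b) x *\<^sub>R f x) = 0" for c d
    proof -
      \<comment> \<open>A non-empty intersection box has its closed box inside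
        \<open>cbox a b\<close> and hence in U. An empty open box may still have a non-empty,
        degenerate closed box reaching outside U, so it is treated apart.\<close>
      obtain c' d' where cd: "box c d \<inter> box a b = box c' d'" unfolding box_Int_box by blast
      show ?thesis
      proof (cases "box c' d' = {}")
        case True
        then have "(\<lambda>x. indicator (box c d) x *\<^sub>R indicator (box a b) x *\<^sub>R f x) = (\<lambda>x. 0)"
          using cd by (auto simp: indicator_def fun_eq_iff)
        then show ?thesis unfolding set_lebesgue_integral_def by (simp only: integral_zero)
      next
        case False
        then have "cbox c' d' = closure (box c d \<inter> box a b)" using cd closure_box[OF False] by simp
        also have "\<dots> \<subseteq> cbox a b" by (intro closure_minimal) (use box_subset_cbox[of a b] in auto)
        finally have "cbox c' d' \<subseteq> U" using \<open>cbox a b \<subseteq> U\<close> by blast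
        from box_integral_zero[OF U f z this]
        have "(LINT x|lebesgue. indicator U x *\<^sub>R (f x * indicator (box c' d') x)) = 0"
          using Us by (simp add: integral_lebesgue_on)
        also have "(\<lambda>x. indicator U x *\<^sub>R (f x * indicator (box c' d') x)) =
           (\<lambda>x. indicator (box c d) x *\<^sub>R indicator (box a b) x *\<^sub>R f x)"
          using box cd[symmetric] by (auto simp: indicator_def fun_eq_iff)
        finally show ?thesis by (simp add: set_lebesgue_integral_def)
      qed
    qed
    have part: "AE x in lebesgue. L (indicator (box a b) x *\<^sub>R f x) = 0"
      if L: "bounded_linear L" for L :: "complex \<Rightarrow> real"
    proof (rule AE_zero_if_box_integrals_zero[of _ a b])
      interpret L: bounded_linear L by fact
      show "integrable lebesgue (\<lambda>x. L (indicator (box a b) x *\<^sub>R f x))"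
        by (rule integrable_bounded_linear[OF L i])
      show "L (indicator (box a b) x *\<^sub>R f x) = 0" if "x \<notin> box a b" for x
        using that by (simp add: L.zero)
      fix c d
      have "integrable lebesgue (\<lambda>x. indicator (box c d) x *\<^sub>R indicator (box a b) x *\<^sub>R f x)"
        by (intro integrable_mult_indicator i) auto
      from integral_bounded_linear[OF L this] zero[of c d]
      show "(LINT x:box c d|lebesgue. L (indicator (box a b) x *\<^sub>R f x)) = 0"
        by (simp add: set_lebesgue_integral_def L.scaleR L.zero mult.assoc)
    qed
    show ?thesis
      using part[OF bounded_linear_Re] part[OF bounded_linear_Im]
      by eventually_elim (auto simp: complex_eq_iff)
  qed
  have "AE x in lebesgue. \<forall>X\<in>\<D>. x \<in> X \<longrightarrow> f x = 0"
  proof (subst AE_ball_countable[OF D(1)], rule ballI)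
    fix X assume X: "X \<in> \<D>"
    then obtain a b where ab: "X = cbox a b" using D(3) by blast
    \<comment> \<open>The cover of U consists of closed boxes while \<open>main\<close> speaks of
      open ones; their boundaries are null sets.\<close>
    have "AE x in lebesgue. x \<notin> cbox a b - box a b"
      using negligible_frontier_interval[of a b] by (intro AE_not_in) (simp add: negligible_iff_null_sets)
    moreover have "AE x in lebesgue. x \<in> box a b \<longrightarrow> f x = 0" using X D(2) ab by (intro main) auto
    ultimately show "AE x in lebesgue. x \<in> X \<longrightarrow> f x = 0" by eventually_elim (auto simp: ab)
  qed
  then have "AE x in lebesgue. x \<in> U \<longrightarrow> f x = 0" by eventually_elim (use D(4) in auto)
  then show ?thesis using AE_lebesgue_on_iff[OF Us] by blast
qed

lemma integrable_vec_iff: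
  fixes F :: "'x \<Rightarrow> complex^'n"
  shows "integrable M F \<longleftrightarrow> (\<forall>i. integrable M (\<lambda>x. F x $ i))"
proof
  assume "integrable M F"
  then show "\<forall>i. integrable M (\<lambda>x. F x $ i)"
    using integrable_bounded_linear[OF bounded_linear_vec_nth] by blast
next
  assume *: "\<forall>i. integrable M (\<lambda>x. F x $ i)"
  have bl: "bounded_linear (axis i :: complex \<Rightarrow> complex^'n)" for i
    by (simp add: linear_conv_bounded_linear[symmetric]) (auto intro!: linearI simp: vec_eq_iff axis_def)
  have "F x = (\<Sum>i\<in>UNIV. axis i (F x $ i))" for x
    by (auto simp: vec_eq_iff axis_def if_distrib cong: if_cong)
  moreover have "integrable M (\<lambda>x. \<Sum>i\<in>UNIV. axis i (F x $ i) :: complex^'n)"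
    using * by (intro Bochner_Integration.integrable_sum integrable_bounded_linear[OF bl]) auto
  ultimately show "integrable M F" by simp
qed

lemma locally_integrable_vec_iff:
  fixes F :: "real^'n \<Rightarrow> complex^'m"
  shows "locally_integrable_on F U \<longleftrightarrow> (\<forall>i. locally_integrable_on (\<lambda>x. F x $ i) U)"
  unfolding locally_integrable_on_def by (subst integrable_vec_iff) blast

lemma locally_integrable_on_add:
  "locally_integrable_on f U \<Longrightarrow> locally_integrable_on g U \<Longrightarrow> locally_integrable_on (\<lambda>x. f x + g x) U"
  unfolding locally_integrable_on_def by auto

lemma locally_integrable_on_diff:
  "locally_integrable_on f U \<Longrightarrow> locally_integrable_on g U \<Longrightarrow> locally_integrable_on (\<lambda>x. f x - g x) U"
  unfolding locally_integrable_on_def by auto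

lemma locally_integrable_on_times_continuous:
  fixes f c :: "real^'n \<Rightarrow> complex"
  assumes f: "locally_integrable_on f U" and c: "continuous_on UNIV c"
  shows "locally_integrable_on (\<lambda>x. c x * f x) U"
  unfolding locally_integrable_on_def
proof (intro allI impI, elim conjE)
  fix K assume K: "compact K" "K \<subseteq> U"
  have i: "integrable (lebesgue_on K) f" using f K unfolding locally_integrable_on_def by auto
  have "compact (c ` K)" using K c by (intro compact_continuous_image) (auto intro: continuous_on_subset)
  then obtain B where B: "\<And>x. x \<in> K \<Longrightarrow> norm (c x) \<le> B"
    by (metis bounded_iff compact_imp_bounded imageI)
  show "integrable (lebesgue_on K) (\<lambda>x. c x * f x)"
  proof (rule Bochner_Integration.integrable_bound)
    show "integrable (lebesgue_on K) (\<lambda>x. B * norm (f x))" using i by auto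
    show "(\<lambda>x. c x * f x) \<in> borel_measurable (lebesgue_on K)"
      by (rule borel_measurable_times[OF measurable_restrict_space1[OF continuous_lebesgue_measurable[OF c]]
            borel_measurable_integrable[OF i]])
    show "AE x in lebesgue_on K. norm (c x * f x) \<le> norm (B * norm (f x))"
    proof (rule AE_I2)
      fix x assume "x \<in> space (lebesgue_on K)"
      then have "norm (c x) \<le> \<bar>B\<bar>" using B by fastforce
      then show "norm (c x * f x) \<le> norm (B * norm (f x))"
        by (simp add: norm_mult abs_mult mult_right_mono)
    qed
  qed
qed

lemma test_functions_C_k: "\<eta> \<in> test_functions U \<Longrightarrow> C_k k \<eta>"
  unfolding test_functions_def by blast

lemma weak_gradient_unique:
  assumes U: "open U" and 1: "has_weak_gradient U \<phi> G" and 2: "has_weak_gradient U \<phi> G'"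
  shows "AE x in lebesgue_on U. G x = G' x"
proof -
  have "AE x in lebesgue_on U. G x $ i - G' x $ i = 0" for i
  proof (rule weak_zero_AE[OF U])
    have l: "locally_integrable_on (\<lambda>x. G x $ i) U" "locally_integrable_on (\<lambda>x. G' x $ i) U"
      using 1 2 by (auto simp: has_weak_gradient_def locally_integrable_vec_iff)
    then show "locally_integrable_on (\<lambda>x. G x $ i - G' x $ i) U" by (rule locally_integrable_on_diff)
    fix \<eta> assume \<eta>: "\<eta> \<in> test_functions U"
    have "(LINT x|lebesgue_on U. (G x $ i) * \<eta> x) = (LINT x|lebesgue_on U. (G' x $ i) * \<eta> x)"
    proof -
      have "(LINT x|lebesgue_on U. \<phi> x * partial_deriv i \<eta> x) = - (LINT x|lebesgue_on U. (G x $ i) * \<eta> x)"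
        "(LINT x|lebesgue_on U. \<phi> x * partial_deriv i \<eta> x) = - (LINT x|lebesgue_on U. (G' x $ i) * \<eta> x)"
        using 1 2 \<eta> unfolding has_weak_gradient_def by blast+
      then show ?thesis by simp
    qed
    then show "(LINT x|lebesgue_on U. (G x $ i - G' x $ i) * \<eta> x) = 0"
      using integrable_times_test[OF U l(1) \<eta>] integrable_times_test[OF U l(2) \<eta>]
      by (simp add: left_diff_distrib)
  qed
  then have "AE x in lebesgue_on U. \<forall>i. G x $ i - G' x $ i = 0"
    by (subst AE_all_countable) blast
  then show ?thesis by eventually_elim (simp add: vec_eq_iff)
qed

lemma has_weak_gradient_add:
  assumes U: "open U" and 1: "has_weak_gradient U \<phi> G" and 2: "has_weak_gradient U \<psi> H"
  shows "has_weak_gradient U (\<lambda>x. \<phi> x + \<psi> x) (\<lambda>x. G x + H x)"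
proof -
  have l: "locally_integrable_on \<phi> U" "locally_integrable_on \<psi> U"
    "locally_integrable_on G U" "locally_integrable_on H U"
    using 1 2 by (auto simp: has_weak_gradient_def)
  then have l': "locally_integrable_on (\<lambda>x. G x $ i) U" "locally_integrable_on (\<lambda>x. H x $ i) U" for i
    by (auto simp: locally_integrable_vec_iff)
  show ?thesis
    unfolding has_weak_gradient_def
  proof (intro conjI ballI allI locally_integrable_on_add l)
    fix \<eta> i assume \<eta>: "\<eta> \<in> test_functions U"
    note \<eta>' = test_function_partial_deriv[OF \<eta>, of i]
    show "(LINT x|lebesgue_on U. (\<phi> x + \<psi> x) * partial_deriv i \<eta> x) =
        - (LINT x|lebesgue_on U. ((G x + H x) $ i) * \<eta> x)"
      using 1 2 \<eta> integrable_times_test[OF U l(1) \<eta>'] integrable_times_test[OF U l(2) \<eta>']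
        integrable_times_test[OF U l'(1) \<eta>] integrable_times_test[OF U l'(2) \<eta>]
      by (simp add: distrib_right has_weak_gradient_def)
  qed
qed

text \<open>With m smooth, m \<eta> is again a test function, and \<phi> m \<partial>\<eta> = \<phi>
  \<partial>(m \<eta>) - \<phi> (\<partial>m) \<eta> reduces the claim to the weak gradient of
  \<phi> tested with m \<eta>.\<close>

lemma has_weak_gradient_mult:
  assumes U: "open U" and 1: "has_weak_gradient U \<phi> G" and m: "\<And>k. C_k k m"
  shows "has_weak_gradient U (\<lambda>x. m x * \<phi> x)
    (\<lambda>x. \<chi> i. m x * (G x $ i) + partial_deriv i m x * \<phi> x)"
proof -
  have l: "locally_integrable_on \<phi> U" "locally_integrable_on G U"
    using 1 by (auto simp: has_weak_gradient_def)
  then have l': "locally_integrable_on (\<lambda>x. G x $ i) U" for i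
    by (auto simp: locally_integrable_vec_iff)
  have mc: "continuous_on UNIV m" using m[of 0] by simp
  have m': "C_k k (partial_deriv i m)" for k i using m[of "Suc k"] by simp
  have mc': "continuous_on UNIV (partial_deriv i m)" for i by (rule C_k_continuous[OF m'])
  have lm: "locally_integrable_on (\<lambda>x. m x * (G x $ i)) U"
    "locally_integrable_on (\<lambda>x. partial_deriv i m x * \<phi> x) U" for i
    by (intro locally_integrable_on_times_continuous l l' mc mc')+
  show ?thesis
    unfolding has_weak_gradient_def
  proof (intro conjI ballI allI)
    show "locally_integrable_on (\<lambda>x. m x * \<phi> x) U"
      by (intro locally_integrable_on_times_continuous l mc)
    show "locally_integrable_on (\<lambda>x. \<chi> i. m x * (G x $ i) + partial_deriv i m x * \<phi> x) U"
      unfolding locally_integrable_vec_iff using locally_integrable_on_add[OF lm] by simp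
    fix \<eta> i assume \<eta>: "\<eta> \<in> test_functions U"
    note \<eta>' = test_function_partial_deriv[OF \<eta>, of i]
    note m\<eta> = test_function_mult[OF \<eta> m]
    note m'\<eta> = test_function_mult[OF \<eta> m'[where i=i]]
    have d: "partial_deriv i (\<lambda>x. m x * \<eta> x) x = m x * partial_deriv i \<eta> x + partial_deriv i m x * \<eta> x" for x
      using m[of 1] test_functions_C_k[OF \<eta>, of 1] by (intro partial_deriv_mult) auto
    have i1: "integrable (lebesgue_on U) (\<lambda>x. \<phi> x * (partial_deriv i (\<lambda>x. m x * \<eta> x) x))"
      by (rule integrable_times_test[OF U l(1) test_function_partial_deriv[OF m\<eta>]])
    have i2: "integrable (lebesgue_on U) (\<lambda>x. \<phi> x * (partial_deriv i m x * \<eta> x))"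
      by (rule integrable_times_test[OF U l(1) m'\<eta>])
    have i3: "integrable (lebesgue_on U) (\<lambda>x. (G x $ i) * (m x * \<eta> x))"
      by (rule integrable_times_test[OF U l'(1) m\<eta>])
    have "(LINT x|lebesgue_on U. m x * \<phi> x * partial_deriv i \<eta> x) =
      (LINT x|lebesgue_on U. \<phi> x * partial_deriv i (\<lambda>x. m x * \<eta> x) x - \<phi> x * (partial_deriv i m x * \<eta> x))"
      unfolding d by (intro Bochner_Integration.integral_cong) (auto simp: algebra_simps)
    also have "\<dots> = (LINT x|lebesgue_on U. \<phi> x * partial_deriv i (\<lambda>x. m x * \<eta> x) x)
       - (LINT x|lebesgue_on U. \<phi> x * (partial_deriv i m x * \<eta> x))"
      by (rule Bochner_Integration.integral_diff[OF i1 i2])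
    also have "(LINT x|lebesgue_on U. \<phi> x * partial_deriv i (\<lambda>x. m x * \<eta> x) x) =
        - (LINT x|lebesgue_on U. (G x $ i) * (m x * \<eta> x))"
      using 1 m\<eta> unfolding has_weak_gradient_def by blast
    also have "- (LINT x|lebesgue_on U. (G x $ i) * (m x * \<eta> x)) - (LINT x|lebesgue_on U. \<phi> x * (partial_deriv i m x * \<eta> x))
       = - (LINT x|lebesgue_on U. (G x $ i) * (m x * \<eta> x) + \<phi> x * (partial_deriv i m x * \<eta> x))"
      using Bochner_Integration.integral_add[OF i3 i2] by simp
    also have "(\<lambda>x. (G x $ i) * (m x * \<eta> x) + \<phi> x * (partial_deriv i m x * \<eta> x)) =
       (\<lambda>x. ((\<chi> i. m x * (G x $ i) + partial_deriv i m x * \<phi> x) $ i) * \<eta> x)"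
      by (auto simp: algebra_simps)
    finally show "(LINT x|lebesgue_on U. m x * \<phi> x * partial_deriv i \<eta> x) =
       - (LINT x|lebesgue_on U. ((\<chi> i. m x * (G x $ i) + partial_deriv i m x * \<phi> x) $ i) * \<eta> x)" .
  qed
qed

definition weakly_differentiable :: "(real^'n) set \<Rightarrow> (real^'n \<Rightarrow> complex) \<Rightarrow> bool" where
  "weakly_differentiable U \<phi> \<longleftrightarrow> (\<exists>G. has_weak_gradient U \<phi> G)"

lemma has_weak_gradient_weak_gradient:
  "weakly_differentiable U \<phi> \<Longrightarrow> has_weak_gradient U \<phi> (weak_gradient U \<phi>)"
  unfolding weakly_differentiable_def weak_gradient_def by (rule someI_ex[of "has_weak_gradient U \<phi>"])

lemma AE_weak_gradient:
  "open U \<Longrightarrow> has_weak_gradient U \<phi> G \<Longrightarrow> AE x in lebesgue_on U. weak_gradient U \<phi> x = G x"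
  by (rule weak_gradient_unique[OF _ has_weak_gradient_weak_gradient])
    (auto simp: weakly_differentiable_def)

lemma with_gradient_simps [simp]:
  "with_gradient U \<phi> x $ None = \<phi> x"
  "with_gradient U \<phi> x $ Some i = weak_gradient U \<phi> x $ i"
  by (auto simp: with_gradient_def)

lemma with_gradient_locally_integrable:
  assumes "weakly_differentiable U \<phi>"
  shows "locally_integrable_on (\<lambda>x. with_gradient U \<phi> x $ k) U"
  using has_weak_gradient_weak_gradient[OF assms]
  by (cases k) (auto simp: has_weak_gradient_def locally_integrable_vec_iff)

lemma with_gradient_measurable:
  assumes "open U" "weakly_differentiable U \<phi>"
  shows "(\<lambda>x. with_gradient U \<phi> x $ k) \<in> borel_measurable (lebesgue_on U)"
  using locally_integrable_measurable[OF assms(1) with_gradient_locally_integrable[OF assms(2)]] .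

lemma with_gradient_add:
  assumes U: "open U" and "weakly_differentiable U \<phi>" "weakly_differentiable U \<psi>"
  shows "weakly_differentiable U (\<lambda>x. \<phi> x + \<psi> x)"
    "AE x in lebesgue_on U. \<forall>k. with_gradient U (\<lambda>x. \<phi> x + \<psi> x) x $ k =
       with_gradient U \<phi> x $ k + with_gradient U \<psi> x $ k"
proof -
  note h = has_weak_gradient_add[OF U assms(2,3)[THEN has_weak_gradient_weak_gradient]]
  show "weakly_differentiable U (\<lambda>x. \<phi> x + \<psi> x)" using h unfolding weakly_differentiable_def by blast
  show "AE x in lebesgue_on U. \<forall>k. with_gradient U (\<lambda>x. \<phi> x + \<psi> x) x $ k =
       with_gradient U \<phi> x $ k + with_gradient U \<psi> x $ k"
    using AE_weak_gradient[OF U h]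
  proof eventually_elim
    case (elim x)
    show ?case by (rule allI, case_tac k) (auto simp: elim)
  qed
qed

lemma with_gradient_mult:
  assumes U: "open U" and "weakly_differentiable U \<phi>" and m: "\<And>k. C_k k m"
  shows "weakly_differentiable U (\<lambda>x. m x * \<phi> x)"
    "AE x in lebesgue_on U. \<forall>k. with_gradient U (\<lambda>x. m x * \<phi> x) x $ k =
       m x * (with_gradient U \<phi> x $ k) + (case k of None \<Rightarrow> 0 | Some i \<Rightarrow> partial_deriv i m x * \<phi> x)"
proof -
  note h = has_weak_gradient_mult[OF U assms(2)[THEN has_weak_gradient_weak_gradient] m]
  show "weakly_differentiable U (\<lambda>x. m x * \<phi> x)" using h unfolding weakly_differentiable_def by blast
  show "AE x in lebesgue_on U. \<forall>k. with_gradient U (\<lambda>x. m x * \<phi> x) x $ k =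
       m x * (with_gradient U \<phi> x $ k) + (case k of None \<Rightarrow> 0 | Some i \<Rightarrow> partial_deriv i m x * \<phi> x)"
    using AE_weak_gradient[OF U h]
  proof eventually_elim
    case (elim x)
    show ?case by (rule allI, case_tac k) (auto simp: elim)
  qed
qed

lemma with_gradient_cmult:
  assumes U: "open U" and "weakly_differentiable U \<phi>"
  shows "weakly_differentiable U (\<lambda>x. c * \<phi> x)"
    "AE x in lebesgue_on U. \<forall>k. with_gradient U (\<lambda>x. c * \<phi> x) x $ k = c * (with_gradient U \<phi> x $ k)"
proof -
  have p: "partial_deriv i (\<lambda>x::real^'a. c) x = 0" for i x
    by (subst partial_deriv_eqI[of _ "\<lambda>_. 0"]) auto
  note w = with_gradient_mult[OF assms C_k_const]
  show "weakly_differentiable U (\<lambda>x. c * \<phi> x)" by (rule w)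
  show "AE x in lebesgue_on U. \<forall>k. with_gradient U (\<lambda>x. c * \<phi> x) x $ k = c * (with_gradient U \<phi> x $ k)"
    using w(2)[of c] by eventually_elim (auto simp: p split: option.splits)
qed

section \<open>Weighted Sobolev spaces\<close>

text \<open>For p \<ge> 1 and a positive weight this is the p-th power of the \<open>W1\<close>
  norm. Dominations and limits are established for it, and the root is taken afterwards.\<close>

definition energy :: "real \<Rightarrow> (real^'n) set \<Rightarrow> (real^'n \<Rightarrow> real) \<Rightarrow> (real^'n \<Rightarrow> complex) \<Rightarrow> real" where
  "energy p U \<omega> \<phi> = (\<Sum>k\<in>UNIV. LINT x|lebesgue_on U. cmod (with_gradient U \<phi> x $ k) powr p * \<omega> x)"

lemma W1_norm: "fnorm (W1 p U \<omega>) \<phi> = energy p U \<omega> \<phi> powr (1 / p)"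
  by (simp add: W1_def energy_def Lp_norm_def)

lemma W1_carrier_iff:
  assumes U: "open U"
  shows "\<phi> \<in> fcarrier (W1 p U \<omega>) \<longleftrightarrow> weakly_differentiable U \<phi> \<and>
    (\<forall>k. integrable (lebesgue_on U) (\<lambda>x. cmod (with_gradient U \<phi> x $ k) powr p * \<omega> x))"
proof -
  have "with_gradient U \<phi> \<in> borel_measurable (lebesgue_on U)" if "weakly_differentiable U \<phi>"
  proof (rule borel_measurable_euclidean_space[THEN iffD2], rule ballI)
    fix b :: "complex^('a option)" assume "b \<in> Basis"
    then obtain k u where b: "b = axis k u" by (auto simp: Basis_vec_def)
    have "(\<lambda>x. with_gradient U \<phi> x $ k \<bullet> u) \<in> borel_measurable (lebesgue_on U)"
      using with_gradient_measurable[OF U that] by (intro borel_measurable_inner) auto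
    then show "(\<lambda>x. with_gradient U \<phi> x \<bullet> b) \<in> borel_measurable (lebesgue_on U)"
      by (simp add: b inner_axis)
  qed
  then show ?thesis by (auto simp: W1_def Lp_def weakly_differentiable_def)
qed

lemma W1_cong:
  assumes "\<And>x. x \<in> U \<Longrightarrow> \<omega> x = \<omega>' x"
  shows "W1 p U \<omega> = W1 p U \<omega>'"
proof -
  have "integrable (lebesgue_on U) (\<lambda>x. f x * \<omega> x) \<longleftrightarrow> integrable (lebesgue_on U) (\<lambda>x. f x * \<omega>' x)"
    and "(LINT x|lebesgue_on U. f x * \<omega> x) = (LINT x|lebesgue_on U. f x * \<omega>' x)" for f
    using assms by (auto intro!: Bochner_Integration.integrable_cong Bochner_Integration.integral_cong)
  then show ?thesis by (simp add: W1_def Lp_def Lp_norm_def)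
qed

lemma energy_nonneg:
  assumes "\<And>x. x \<in> U \<Longrightarrow> 0 < \<omega> x"
  shows "0 \<le> energy p U \<omega> \<phi>"
  unfolding energy_def using assms
  by (intro sum_nonneg integral_nonneg_AE AE_I2 mult_nonneg_nonneg) (auto intro: less_imp_le)

lemma W1_norm_powr:
  assumes "\<And>x. x \<in> U \<Longrightarrow> 0 < \<omega> x" "1 \<le> p"
  shows "fnorm (W1 p U \<omega>) \<phi> powr p = energy p U \<omega> \<phi>"
  using energy_nonneg[of U \<omega> p \<phi>] assms by (simp add: W1_norm powr_powr)

lemma powr_add_le:
  fixes a b p :: real
  assumes "0 \<le> a" "0 \<le> b" "1 \<le> p"
  shows "(a + b) powr p \<le> 2 powr p * (a powr p + b powr p)"
proof -
  have "(a + b) powr p \<le> (2 * max a b) powr p"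
    using assms by (intro powr_mono2) auto
  also have "\<dots> = 2 powr p * max a b powr p" using assms by (simp add: powr_mult)
  also have "\<dots> \<le> 2 powr p * (a powr p + b powr p)"
    by (intro mult_left_mono) (auto simp: max_def)
  finally show ?thesis .
qed

lemma cmod_powr_measurable:
  assumes "f \<in> borel_measurable M" "w \<in> borel_measurable M"
  shows "(\<lambda>x. cmod (f x) powr p * w x) \<in> borel_measurable M"
  using assms by measurable

text \<open>The sum over all components on the right is needed because the product rule mixes a
  function with its gradient. The factor \<open>CARD('n option)\<close> arises from bounding each
  component of \<psi> by the full energy of \<phi>.\<close>

lemma W1_dominated:
  fixes U :: "(real^'n) set"
  assumes U: "open U" and \<psi>: "weakly_differentiable U \<psi>" and \<phi>: "\<phi> \<in> fcarrier (W1 p U \<omega>)"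
    and m: "\<omega>' \<in> borel_measurable (lebesgue_on U)" and pos: "\<And>x. x \<in> U \<Longrightarrow> 0 < \<omega>' x"
    and dom: "AE x in lebesgue_on U. \<forall>k. cmod (with_gradient U \<psi> x $ k) powr p * \<omega>' x
      \<le> C * (\<Sum>l\<in>UNIV. cmod (with_gradient U \<phi> x $ l) powr p * \<omega> x)"
  shows "\<psi> \<in> fcarrier (W1 p U \<omega>')"
    "energy p U \<omega>' \<psi> \<le> C * real CARD('n option) * energy p U \<omega> \<phi>"
proof -
  have i: "integrable (lebesgue_on U) (\<lambda>x. cmod (with_gradient U \<phi> x $ l) powr p * \<omega> x)" for l
    using \<phi> W1_carrier_iff[OF U] by blast
  then have i': "integrable (lebesgue_on U) (\<lambda>x. C * (\<Sum>l\<in>UNIV. cmod (with_gradient U \<phi> x $ l) powr p * \<omega> x))"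
    by (intro integrable_mult_right Bochner_Integration.integrable_sum) auto
  have j: "integrable (lebesgue_on U) (\<lambda>x. cmod (with_gradient U \<psi> x $ k) powr p * \<omega>' x)" for k
  proof (rule Bochner_Integration.integrable_bound[OF i'])
    show "(\<lambda>x. cmod (with_gradient U \<psi> x $ k) powr p * \<omega>' x) \<in> borel_measurable (lebesgue_on U)"
      by (intro cmod_powr_measurable with_gradient_measurable U \<psi> m)
    have "AE x in lebesgue_on U. 0 < \<omega>' x" using pos by (intro AE_I2) simp
    with dom show "AE x in lebesgue_on U. norm (cmod (with_gradient U \<psi> x $ k) powr p * \<omega>' x)
        \<le> norm (C * (\<Sum>l\<in>UNIV. cmod (with_gradient U \<phi> x $ l) powr p * \<omega> x))"
    proof eventually_elim
      case (elim x)
      have "norm (cmod (with_gradient U \<psi> x $ k) powr p * \<omega>' x) = cmod (with_gradient U \<psi> x $ k) powr p * \<omega>' x"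
        using elim by (simp add: abs_mult)
      also have "\<dots> \<le> C * (\<Sum>l\<in>UNIV. cmod (with_gradient U \<phi> x $ l) powr p * \<omega> x)" using elim by blast
      also have "\<dots> \<le> norm (C * (\<Sum>l\<in>UNIV. cmod (with_gradient U \<phi> x $ l) powr p * \<omega> x))"
        unfolding real_norm_def by (rule abs_ge_self)
      finally show ?case .
    qed
  qed
  then show "\<psi> \<in> fcarrier (W1 p U \<omega>')" using \<psi> W1_carrier_iff[OF U] by blast
  have "(LINT x|lebesgue_on U. cmod (with_gradient U \<psi> x $ k) powr p * \<omega>' x) \<le> C * energy p U \<omega> \<phi>" for k
  proof -
    have "(LINT x|lebesgue_on U. cmod (with_gradient U \<psi> x $ k) powr p * \<omega>' x) \<le>
      (LINT x|lebesgue_on U. C * (\<Sum>l\<in>UNIV. cmod (with_gradient U \<phi> x $ l) powr p * \<omega> x))"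
      using dom by (intro integral_mono_AE j i') (auto elim: eventually_mono)
    also have "\<dots> = C * energy p U \<omega> \<phi>"
      unfolding energy_def using i by (subst integral_mult_right_zero, subst Bochner_Integration.integral_sum) auto
    finally show ?thesis .
  qed
  then have "energy p U \<omega>' \<psi> \<le> (\<Sum>k\<in>(UNIV::'n option set). C * energy p U \<omega> \<phi>)"
    unfolding energy_def[of p U \<omega>'] by (intro sum_mono)
  then show "energy p U \<omega>' \<psi> \<le> C * real CARD('n option) * energy p U \<omega> \<phi>" by (simp add: mult_ac)
qed

lemma W1_weakly_differentiable:
  "open U \<Longrightarrow> \<phi> \<in> fcarrier (W1 p U \<omega>) \<Longrightarrow> weakly_differentiable U \<phi>"
  by (simp add: W1_carrier_iff)

lemma W1_integrable:
  "open U \<Longrightarrow> \<phi> \<in> fcarrier (W1 p U \<omega>) \<Longrightarrow>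
    integrable (lebesgue_on U) (\<lambda>x. cmod (with_gradient U \<phi> x $ k) powr p * \<omega> x)"
  by (simp add: W1_carrier_iff)

text \<open>A quasi-triangle inequality. The constant is 2 * 2: one factor from
  \<open>powr_add_le\<close>, the other from a^p + b^p \<le> 2 (a + b)^p and 2 \<le> 2^p. It only
  enters the final constants and the closure arguments.\<close>

lemma W1_add:
  assumes U: "open U" and p: "1 \<le> p" and \<omega>: "\<omega> \<in> borel_measurable (lebesgue_on U)" "\<And>x. x \<in> U \<Longrightarrow> 0 < \<omega> x"
    and \<phi>: "\<phi> \<in> fcarrier (W1 p U \<omega>)" and \<psi>: "\<psi> \<in> fcarrier (W1 p U \<omega>)"
  shows "(\<lambda>x. \<phi> x + \<psi> x) \<in> fcarrier (W1 p U \<omega>)"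
    "fnorm (W1 p U \<omega>) (\<lambda>x. \<phi> x + \<psi> x) \<le> 4 * (fnorm (W1 p U \<omega>) \<phi> + fnorm (W1 p U \<omega>) \<psi>)"
proof -
  note wd = W1_weakly_differentiable[OF U \<phi>] W1_weakly_differentiable[OF U \<psi>]
  note wa = with_gradient_add[OF U wd]
  let ?f = "\<lambda>\<phi> k x. cmod (with_gradient U \<phi> x $ k) powr p * \<omega> x"
  have i: "integrable (lebesgue_on U) (\<lambda>x. 2 powr p * (?f \<phi> k x + ?f \<psi> k x))" for k
    using W1_integrable[OF U \<phi>] W1_integrable[OF U \<psi>] by auto
  have ae: "AE x in lebesgue_on U. ?f (\<lambda>x. \<phi> x + \<psi> x) k x \<le> 2 powr p * (?f \<phi> k x + ?f \<psi> k x)" for k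
  proof -
    have "AE x in lebesgue_on U. x \<in> U" by (rule AE_I2) simp
    with wa(2) show ?thesis
    proof eventually_elim
      case (elim x)
      have "cmod (with_gradient U (\<lambda>x. \<phi> x + \<psi> x) x $ k) powr p \<le>
         (cmod (with_gradient U \<phi> x $ k) + cmod (with_gradient U \<psi> x $ k)) powr p"
        using p elim by (intro powr_mono2) (auto simp: norm_triangle_ineq)
      also have "\<dots> \<le> 2 powr p * (cmod (with_gradient U \<phi> x $ k) powr p + cmod (with_gradient U \<psi> x $ k) powr p)"
        using p by (intro powr_add_le) auto
      finally have "?f (\<lambda>x. \<phi> x + \<psi> x) k x \<le>
          2 powr p * (cmod (with_gradient U \<phi> x $ k) powr p + cmod (with_gradient U \<psi> x $ k) powr p) * \<omega> x"
        using \<omega>(2)[of x] elim by (intro mult_right_mono) auto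
      then show ?case by (simp add: algebra_simps)
    qed
  qed
  have j: "integrable (lebesgue_on U) (?f (\<lambda>x. \<phi> x + \<psi> x) k)" for k
  proof (rule Bochner_Integration.integrable_bound[OF i[of k]])
    show "?f (\<lambda>x. \<phi> x + \<psi> x) k \<in> borel_measurable (lebesgue_on U)"
      by (intro cmod_powr_measurable with_gradient_measurable U wa \<omega>)
    have "AE x in lebesgue_on U. 0 < \<omega> x" using \<omega>(2) by (intro AE_I2) simp
    with ae show "AE x in lebesgue_on U. norm (?f (\<lambda>x. \<phi> x + \<psi> x) k x) \<le> norm (2 powr p * (?f \<phi> k x + ?f \<psi> k x))"
      by eventually_elim (auto simp: abs_mult intro: order_trans[OF _ abs_ge_self])
  qed
  then show c: "(\<lambda>x. \<phi> x + \<psi> x) \<in> fcarrier (W1 p U \<omega>)" using wa(1) W1_carrier_iff[OF U] by blast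
  have "(LINT x|lebesgue_on U. ?f (\<lambda>x. \<phi> x + \<psi> x) k x) \<le>
     2 powr p * ((LINT x|lebesgue_on U. ?f \<phi> k x) + (LINT x|lebesgue_on U. ?f \<psi> k x))" for k
  proof -
    have "(LINT x|lebesgue_on U. ?f (\<lambda>x. \<phi> x + \<psi> x) k x) \<le> (LINT x|lebesgue_on U. 2 powr p * (?f \<phi> k x + ?f \<psi> k x))"
      by (rule integral_mono_AE[OF j i ae])
    then show ?thesis using W1_integrable[OF U \<phi>] W1_integrable[OF U \<psi>] by simp
  qed
  then have "energy p U \<omega> (\<lambda>x. \<phi> x + \<psi> x) \<le> (\<Sum>k\<in>UNIV. 2 powr p * ((LINT x|lebesgue_on U. ?f \<phi> k x) + (LINT x|lebesgue_on U. ?f \<psi> k x)))"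
    unfolding energy_def by (intro sum_mono)
  also have "\<dots> = 2 powr p * (energy p U \<omega> \<phi> + energy p U \<omega> \<psi>)"
    unfolding energy_def by (simp add: sum_distrib_left[symmetric] sum.distrib)
  finally have e: "energy p U \<omega> (\<lambda>x. \<phi> x + \<psi> x) \<le> 2 powr p * (energy p U \<omega> \<phi> + energy p U \<omega> \<psi>)" .
  let ?n = "\<lambda>\<phi>. fnorm (W1 p U \<omega>) \<phi>"
  have n0: "0 \<le> ?n \<phi>" for \<phi> by (simp add: W1_norm)
  have "?n (\<lambda>x. \<phi> x + \<psi> x) powr p \<le> 2 powr p * (?n \<phi> powr p + ?n \<psi> powr p)"
    using e by (simp add: W1_norm_powr \<omega> p)
  also have "\<dots> \<le> 2 powr p * (2 * (?n \<phi> + ?n \<psi>) powr p)"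
  proof -
    have "?n \<phi> powr p \<le> (?n \<phi> + ?n \<psi>) powr p" "?n \<psi> powr p \<le> (?n \<phi> + ?n \<psi>) powr p"
      using p n0 by (auto intro!: powr_mono2)
    then show ?thesis by simp
  qed
  also have "\<dots> \<le> 2 powr p * (2 powr p * (?n \<phi> + ?n \<psi>) powr p)"
    using p powr_mono[of 1 p 2] by (intro mult_left_mono mult_right_mono) auto
  also have "\<dots> = (4 * (?n \<phi> + ?n \<psi>)) powr p"
    using n0[of \<phi>] n0[of \<psi>] by (simp add: powr_mult[symmetric])
  finally have "?n (\<lambda>x. \<phi> x + \<psi> x) powr p \<le> (4 * (?n \<phi> + ?n \<psi>)) powr p" .
  moreover have "0 \<le> 4 * (?n \<phi> + ?n \<psi>)" using n0[of \<phi>] n0[of \<psi>] by simp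
  ultimately show "?n (\<lambda>x. \<phi> x + \<psi> x) \<le> 4 * (?n \<phi> + ?n \<psi>)"
    using p powr_less_mono2[of p "4 * (?n \<phi> + ?n \<psi>)" "?n (\<lambda>x. \<phi> x + \<psi> x)"] by linarith
qed

lemma W1_cmult:
  assumes U: "open U" and p: "1 \<le> p" and \<omega>: "\<omega> \<in> borel_measurable (lebesgue_on U)" "\<And>x. x \<in> U \<Longrightarrow> 0 < \<omega> x"
    and \<phi>: "\<phi> \<in> fcarrier (W1 p U \<omega>)"
  shows "(\<lambda>x. c * \<phi> x) \<in> fcarrier (W1 p U \<omega>)"
    "fnorm (W1 p U \<omega>) (\<lambda>x. c * \<phi> x) = cmod c * fnorm (W1 p U \<omega>) \<phi>"
proof -
  note wd = W1_weakly_differentiable[OF U \<phi>]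
  note wc = with_gradient_cmult[OF U wd, of c]
  let ?f = "\<lambda>\<phi> k x. cmod (with_gradient U \<phi> x $ k) powr p * \<omega> x"
  have ae: "AE x in lebesgue_on U. cmod c powr p * ?f \<phi> k x = ?f (\<lambda>x. c * \<phi> x) k x" for k
    using wc(2) by eventually_elim (simp add: norm_mult powr_mult)
  have m: "?f (\<lambda>x. c * \<phi> x) k \<in> borel_measurable (lebesgue_on U)" for k
    by (intro cmod_powr_measurable with_gradient_measurable U wc \<omega>)
  have i: "integrable (lebesgue_on U) (\<lambda>x. cmod c powr p * ?f \<phi> k x)" for k
    using W1_integrable[OF U \<phi>] by auto
  have j: "integrable (lebesgue_on U) (?f (\<lambda>x. c * \<phi> x) k)" for k
    by (rule integrable_cong_AE_imp[OF i m ae])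
  then show "(\<lambda>x. c * \<phi> x) \<in> fcarrier (W1 p U \<omega>)" using wc(1) W1_carrier_iff[OF U] by blast
  have "(LINT x|lebesgue_on U. ?f (\<lambda>x. c * \<phi> x) k x) = cmod c powr p * (LINT x|lebesgue_on U. ?f \<phi> k x)" for k
    using integral_cong_AE[OF borel_measurable_integrable[OF i] m ae] by (simp add: mult.assoc)
  then have "energy p U \<omega> (\<lambda>x. c * \<phi> x) = cmod c powr p * energy p U \<omega> \<phi>"
    by (simp add: energy_def sum_distrib_left)
  then show "fnorm (W1 p U \<omega>) (\<lambda>x. c * \<phi> x) = cmod c * fnorm (W1 p U \<omega>) \<phi>"
    using p energy_nonneg[of U \<omega> p \<phi>, OF \<omega>(2)] by (simp add: W1_norm powr_mult powr_powr)
qed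

section \<open>Multiplication by functions of a smooth Lipschitz function\<close>

lemma smooth_lineD:
  assumes "smooth_line h" 
  obtains h' where "smooth_line h'" "\<And>t. (h has_vector_derivative h' t) (at t)"
proof -
  obtain hd where hd: "hd 0 = h" "\<And>j t. (hd j has_vector_derivative hd (Suc j) t) (at t)"
    using assms unfolding smooth_line_def by metis
  have "smooth_line (hd 1)" unfolding smooth_line_def
    using hd(2) by (intro exI[of _ "\<lambda>j. hd (Suc j)"]) auto
  moreover have "(h has_vector_derivative hd 1 t) (at t)" for t using hd(2)[of 0 t] hd(1) by simp
  ultimately show ?thesis using that by blast
qed

lemma smooth_line_continuous: "smooth_line h \<Longrightarrow> continuous_on A h"
  by (metis smooth_lineD has_vector_derivative_continuous continuous_at_imp_continuous_on)

lemma partial_deriv_lipschitz_bound: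
  fixes \<gamma> :: "real^'n \<Rightarrow> real"
  assumes lip: "L-lipschitz_on UNIV \<gamma>" and d: "(\<lambda>x. complex_of_real (\<gamma> x)) differentiable (at x)"
  shows "cmod (partial_deriv i (\<lambda>x. complex_of_real (\<gamma> x)) x) \<le> L"
proof -
  obtain \<gamma>' where g: "(\<gamma> has_derivative \<gamma>') (at x)" using has_derivative_Re_of_real[OF d] by blast
  have lin: "linear \<gamma>'" using g has_derivative_linear by blast
  have "((\<lambda>t::real. x + t *\<^sub>R axis i 1) has_derivative (\<lambda>t. t *\<^sub>R axis i 1)) (at 0)"
    by (auto intro!: derivative_eq_intros)
  from has_derivative_compose[OF this, of \<gamma> \<gamma>'] g
  have "((\<lambda>t::real. \<gamma> (x + t *\<^sub>R axis i 1)) has_derivative (\<lambda>t. t * \<gamma>' (axis i 1))) (at 0)"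
    by (simp add: linear_cmul[OF lin])
  then have "((\<lambda>t::real. \<gamma> (x + t *\<^sub>R axis i 1)) has_real_derivative \<gamma>' (axis i 1)) (at 0)"
    by (simp add: has_field_derivative_def mult_commute_abs)
  then have "((\<lambda>t. \<bar>(\<gamma> (x + t *\<^sub>R axis i 1) - \<gamma> x) / t\<bar>) \<longlongrightarrow> \<bar>\<gamma>' (axis i 1)\<bar>) (at 0)"
    by (intro tendsto_rabs) (simp add: has_field_derivative_iff)
  moreover have "\<bar>(\<gamma> (x + t *\<^sub>R axis i 1) - \<gamma> x) / t\<bar> \<le> L" if "t \<noteq> 0" for t
    using lipschitz_onD[OF lip, of "x + t *\<^sub>R axis i 1" x] that
    by (simp add: dist_real_def dist_norm field_simps)
  then have "\<forall>\<^sub>F t in at 0. \<bar>(\<gamma> (x + t *\<^sub>R axis i 1) - \<gamma> x) / t\<bar> \<le> L"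
    by (simp add: eventually_at_filter)
  ultimately have "\<bar>\<gamma>' (axis i 1)\<bar> \<le> L" by (intro tendsto_upperbound) auto
  then show ?thesis by (simp add: partial_deriv_of_real_eq[OF g])
qed

text \<open>The assumption \<open>\<omega>_ratio\<close> says that \<omega> s * exp (s * \<gamma>)
  varies with s in [0,1] at most by the factor \<open>K\<close>; exchanging s and s' gives the
  reverse comparison. So all weights are, up to constants, exponentials of \<gamma> times one fixed
  weight.\<close>

locale weight_scale =
  fixes U :: "(real^'n) set" and \<gamma> :: "real^'n \<Rightarrow> real" and \<omega> :: "real \<Rightarrow> real^'n \<Rightarrow> real"
    and L K p :: real
  assumes U: "open U"
    and \<gamma>_C_k: "\<And>k. C_k k (\<lambda>x. complex_of_real (\<gamma> x))"
    and \<gamma>_lipschitz: "L-lipschitz_on UNIV \<gamma>"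
    and \<omega>_measurable: "\<And>s. \<omega> s \<in> borel_measurable (lebesgue_on U)"
    and \<omega>_pos: "\<And>s x. x \<in> U \<Longrightarrow> 0 < \<omega> s x"
    and K_pos: "0 < K"
    and \<omega>_ratio: "\<And>s s' x. s \<in> {0..1} \<Longrightarrow> s' \<in> {0..1} \<Longrightarrow> x \<in> U \<Longrightarrow>
      \<omega> s' x * exp ((s' - s) * \<gamma> x) \<le> K * \<omega> s x"
    and p: "1 \<le> p"
begin

abbreviation W :: "real \<Rightarrow> (real^'n) fun_space" where
  "W s \<equiv> W1 p U (\<omega> s)"

lemma W_add:
  assumes "\<phi> \<in> fcarrier (W s)" "\<psi> \<in> fcarrier (W s)"
  shows "(\<lambda>x. \<phi> x + \<psi> x) \<in> fcarrier (W s)"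
    "fnorm (W s) (\<lambda>x. \<phi> x + \<psi> x) \<le> 4 * (fnorm (W s) \<phi> + fnorm (W s) \<psi>)"
  by (rule W1_add[OF U p \<omega>_measurable \<omega>_pos assms]; assumption)+

lemma W_cmult:
  assumes "\<phi> \<in> fcarrier (W s)"
  shows "(\<lambda>x. c * \<phi> x) \<in> fcarrier (W s)"
    "fnorm (W s) (\<lambda>x. c * \<phi> x) = cmod c * fnorm (W s) \<phi>"
  by (rule W1_cmult[OF U p \<omega>_measurable \<omega>_pos assms]; assumption)+
lemmas W_integrable = W1_integrable[OF U]
lemmas W_weakly_differentiable = W1_weakly_differentiable[OF U]

lemma L_nonneg: "0 \<le> L"
  using \<gamma>_lipschitz lipschitz_on_nonneg by blast

lemma \<gamma>_differentiable: "(\<lambda>x. complex_of_real (\<gamma> x)) differentiable (at x)"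
  using \<gamma>_C_k[of 1] by simp

lemma W_energy_nonneg: "0 \<le> energy p U (\<omega> s) \<phi>"
  by (rule energy_nonneg) (rule \<omega>_pos)

lemma W_norm_nonneg: "0 \<le> fnorm (W s) \<phi>"
  by (simp add: W1_norm)

definition product_gradient ::
  "(real \<Rightarrow> complex) \<Rightarrow> (real \<Rightarrow> complex) \<Rightarrow> (real^'n \<Rightarrow> complex) \<Rightarrow> 'n option \<Rightarrow> real^'n \<Rightarrow> complex" where
  "product_gradient h h' \<phi> k x = h (\<gamma> x) * (with_gradient U \<phi> x $ k) +
     (case k of None \<Rightarrow> 0 | Some i \<Rightarrow> h' (\<gamma> x) * partial_deriv i (\<lambda>x. of_real (\<gamma> x)) x * \<phi> x)"

lemma with_gradient_product:
  assumes h: "smooth_line h" "\<And>t. (h has_vector_derivative h' t) (at t)" and \<phi>: "weakly_differentiable U \<phi>"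
  shows "weakly_differentiable U (\<lambda>x. h (\<gamma> x) * \<phi> x)"
    "AE x in lebesgue_on U. \<forall>k. with_gradient U (\<lambda>x. h (\<gamma> x) * \<phi> x) x $ k = product_gradient h h' \<phi> k x"
proof -
  note w = with_gradient_mult[OF U \<phi> C_k_line[OF h(1) \<gamma>_C_k]]
  show "weakly_differentiable U (\<lambda>x. h (\<gamma> x) * \<phi> x)" by (rule w)
  show "AE x in lebesgue_on U. \<forall>k. with_gradient U (\<lambda>x. h (\<gamma> x) * \<phi> x) x $ k = product_gradient h h' \<phi> k x"
    using w(2) by eventually_elim
      (simp add: product_gradient_def partial_deriv_line(2)[OF \<gamma>_differentiable h(2)] split: option.split)
qed

text \<open>The factor 2 comes from estimating two components by the full sum,
  \<open>2 powr p\<close> from \<open>powr_add_le\<close>, \<open>(1 + L) powr p\<close> from the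
  bound \<open>L\<close> on the partial derivatives of \<gamma>, and \<open>K\<close> from the
  comparison of weights.\<close>

definition product_const :: real where
  "product_const = 2 * 2 powr p * (1 + L) powr p * K"

lemma product_const_pos: "0 < product_const"
  unfolding product_const_def using K_pos L_nonneg by auto

lemma product_gradient_bound:
  assumes s: "s \<in> {0..1}" "s' \<in> {0..1}" and x: "x \<in> U" and B: "0 \<le> B"
    and h: "cmod (h (\<gamma> x)) \<le> B * exp ((s' - s) * \<gamma> x / p)"
    and h': "cmod (h' (\<gamma> x)) \<le> B * exp ((s' - s) * \<gamma> x / p)"
  shows "cmod (product_gradient h h' \<phi> k x) powr p * \<omega> s' x \<le>
    product_const * B powr p * (\<Sum>l\<in>UNIV. cmod (with_gradient U \<phi> x $ l) powr p * \<omega> s x)"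
proof -
  let ?D = "\<lambda>l. cmod (with_gradient U \<phi> x $ l)" and ?E = "B * exp ((s' - s) * \<gamma> x / p)"
  have E0: "0 \<le> ?E" using B by simp
  have "cmod (product_gradient h h' \<phi> k x) \<le> ?E * ?D k + ?E * L * ?D None"
    unfolding product_gradient_def
  proof (rule norm_triangle_le, rule add_mono)
    show "cmod (h (\<gamma> x) * (with_gradient U \<phi> x $ k)) \<le> ?E * ?D k"
      using h by (auto simp: norm_mult intro: mult_right_mono)
    have "cmod (h' (\<gamma> x)) * cmod (partial_deriv i (\<lambda>x. of_real (\<gamma> x)) x) * cmod (\<phi> x) \<le> ?E * L * cmod (\<phi> x)" for i
      by (intro mult_right_mono mult_mono h' partial_deriv_lipschitz_bound \<gamma>_lipschitz \<gamma>_differentiable E0) auto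
    moreover have "0 \<le> ?E * L * cmod (\<phi> x)" using E0 L_nonneg by simp
    ultimately show "cmod (case k of None \<Rightarrow> 0 | Some i \<Rightarrow> h' (\<gamma> x) * partial_deriv i (\<lambda>x. of_real (\<gamma> x)) x * \<phi> x) \<le> ?E * L * ?D None"
      by (auto simp: norm_mult split: option.split)
  qed
  also have "\<dots> \<le> ?E * (1 + L) * (?D k + ?D None)"
  proof -
    have "0 \<le> ?E * L * ?D k" "0 \<le> ?E * ?D None"
      by (rule mult_nonneg_nonneg[OF mult_nonneg_nonneg[OF E0 L_nonneg] norm_ge_zero],
          rule mult_nonneg_nonneg[OF E0 norm_ge_zero])
    then show ?thesis by (simp add: distrib_left distrib_right)
  qed
  finally have "cmod (product_gradient h h' \<phi> k x) powr p \<le> (?E * (1 + L) * (?D k + ?D None)) powr p"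
    using p by (intro powr_mono2) auto
  also have "\<dots> = ?E powr p * (1 + L) powr p * (?D k + ?D None) powr p"
    using E0 L_nonneg by (simp add: powr_mult)
  also have "?E powr p = B powr p * exp ((s' - s) * \<gamma> x)"
    using B p by (simp add: powr_mult powr_def[of "exp _"])
  also have "(?D k + ?D None) powr p \<le> 2 powr p * (2 * (\<Sum>l\<in>UNIV. ?D l powr p))"
  proof -
    have "?D l powr p \<le> (\<Sum>l\<in>UNIV. ?D l powr p)" for l by (rule member_le_sum) auto
    from add_mono[OF this[of k] this[of None]] have "?D k powr p + ?D None powr p \<le> 2 * (\<Sum>l\<in>UNIV. ?D l powr p)" by simp
    then have "2 powr p * (?D k powr p + ?D None powr p) \<le> 2 powr p * (2 * (\<Sum>l\<in>UNIV. ?D l powr p))"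
      by (intro mult_left_mono) auto
    with powr_add_le[of "?D k" "?D None" p, OF norm_ge_zero norm_ge_zero p] show ?thesis by (rule order_trans)
  qed
  finally have "cmod (product_gradient h h' \<phi> k x) powr p \<le>
     B powr p * exp ((s' - s) * \<gamma> x) * (1 + L) powr p * (2 powr p * (2 * (\<Sum>l\<in>UNIV. ?D l powr p)))"
    by (simp add: mult_left_mono)
  then have "cmod (product_gradient h h' \<phi> k x) powr p * \<omega> s' x \<le>
     B powr p * exp ((s' - s) * \<gamma> x) * (1 + L) powr p * (2 powr p * (2 * (\<Sum>l\<in>UNIV. ?D l powr p))) * \<omega> s' x"
    using \<omega>_pos[OF x, of s'] by (intro mult_right_mono) auto
  also have "\<dots> = 2 * 2 powr p * (1 + L) powr p * B powr p * (\<Sum>l\<in>UNIV. ?D l powr p) * (\<omega> s' x * exp ((s' - s) * \<gamma> x))"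
    by (simp add: mult_ac)
  also have "\<dots> \<le> 2 * 2 powr p * (1 + L) powr p * B powr p * (\<Sum>l\<in>UNIV. ?D l powr p) * (K * \<omega> s x)"
    using s x by (intro mult_left_mono \<omega>_ratio mult_nonneg_nonneg sum_nonneg) auto
  also have "\<dots> = product_const * B powr p * (\<Sum>l\<in>UNIV. ?D l powr p * \<omega> s x)"
    by (simp add: product_const_def sum_distrib_left sum_distrib_right mult_ac)
  finally show ?thesis .
qed

definition multiplier_const :: real where
  "multiplier_const = (product_const * real CARD('n option)) powr (1 / p)"

lemma multiplier_const_pos: "0 < multiplier_const"
  unfolding multiplier_const_def using product_const_pos by simp

text \<open>The operator norm depends on \<open>h\<close> only through \<open>B\<close>, so bounds
  are uniform over families of multipliers such as those along a vertical line of the strip.\<close>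

lemma multiplier:
  assumes s: "s \<in> {0..1}" "s' \<in> {0..1}" and B: "0 \<le> B"
    and h: "smooth_line h" "\<And>t. (h has_vector_derivative h' t) (at t)"
    and hB: "\<And>t. cmod (h t) \<le> B * exp ((s' - s) * t / p)" "\<And>t. cmod (h' t) \<le> B * exp ((s' - s) * t / p)"
    and \<phi>: "\<phi> \<in> fcarrier (W s)"
  shows "(\<lambda>x. h (\<gamma> x) * \<phi> x) \<in> fcarrier (W s')"
    "fnorm (W s') (\<lambda>x. h (\<gamma> x) * \<phi> x) \<le> multiplier_const * B * fnorm (W s) \<phi>"
proof -
  note w = with_gradient_product[OF h W_weakly_differentiable[OF \<phi>]]
  have "AE x in lebesgue_on U. x \<in> U" by (rule AE_I2) simp
  with w(2) have ae: "AE x in lebesgue_on U. \<forall>k. cmod (with_gradient U (\<lambda>x. h (\<gamma> x) * \<phi> x) x $ k) powr p * \<omega> s' x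
      \<le> (product_const * B powr p) * (\<Sum>l\<in>UNIV. cmod (with_gradient U \<phi> x $ l) powr p * \<omega> s x)"
    by eventually_elim (use product_gradient_bound[of s s' _ B h h' \<phi>, OF s _ B hB] in auto)
  note d = W1_dominated[OF U w(1) \<phi> \<omega>_measurable \<omega>_pos ae]
  show "(\<lambda>x. h (\<gamma> x) * \<phi> x) \<in> fcarrier (W s')" by (rule d)
  have "fnorm (W s') (\<lambda>x. h (\<gamma> x) * \<phi> x) \<le> (product_const * B powr p * real CARD('n option) * energy p U (\<omega> s) \<phi>) powr (1 / p)"
    unfolding W1_norm using p d(2) W_energy_nonneg by (intro powr_mono2) auto
  also have "\<dots> = multiplier_const * B * fnorm (W s) \<phi>"
    using p B product_const_pos W_energy_nonneg[of s \<phi>]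
    by (simp add: W1_norm multiplier_const_def powr_mult powr_powr)
  finally show "fnorm (W s') (\<lambda>x. h (\<gamma> x) * \<phi> x) \<le> multiplier_const * B * fnorm (W s) \<phi>" .
qed

text \<open>Dominated convergence in x: a common growth bound and pointwise convergence of
  \<open>h n\<close> and \<open>h' n\<close> suffice, even when the differences are not uniformly
  small relative to the exponential.\<close>

lemma multiplier_tendsto:
  fixes h h' :: "nat \<Rightarrow> real \<Rightarrow> complex"
  assumes s: "s \<in> {0..1}" "s' \<in> {0..1}" and B: "0 \<le> B"
    and h: "\<And>n. smooth_line (h n)" "\<And>n t. (h n has_vector_derivative h' n t) (at t)"
    and hB: "\<And>n t. cmod (h n t) \<le> B * exp ((s' - s) * t / p)" "\<And>n t. cmod (h' n t) \<le> B * exp ((s' - s) * t / p)"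
    and lim: "\<And>t. (\<lambda>n. h n t) \<longlonglongrightarrow> 0" "\<And>t. (\<lambda>n. h' n t) \<longlonglongrightarrow> 0"
    and \<phi>: "\<phi> \<in> fcarrier (W s)"
  shows "(\<lambda>n. fnorm (W s') (\<lambda>x. h n (\<gamma> x) * \<phi> x)) \<longlonglongrightarrow> 0"
proof -
  note w = with_gradient_product[OF h W_weakly_differentiable[OF \<phi>]]
  have i: "integrable (lebesgue_on U) (\<lambda>x. product_const * B powr p *
      (\<Sum>l\<in>UNIV. cmod (with_gradient U \<phi> x $ l) powr p * \<omega> s x))"
    using W_integrable[OF \<phi>] by (intro integrable_mult_right Bochner_Integration.integrable_sum) auto
  have aeU: "AE x in lebesgue_on U. x \<in> U" by (rule AE_I2) simp
  have "(\<lambda>n. LINT x|lebesgue_on U. cmod (with_gradient U (\<lambda>x. h n (\<gamma> x) * \<phi> x) x $ k) powr p * \<omega> s' x)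
      \<longlonglongrightarrow> (LINT x|lebesgue_on U. 0)" for k
  proof (rule integral_dominated_convergence[OF _ _ i])
    show "(\<lambda>x. cmod (with_gradient U (\<lambda>x. h n (\<gamma> x) * \<phi> x) x $ k) powr p * \<omega> s' x) \<in> borel_measurable (lebesgue_on U)" for n
      by (intro cmod_powr_measurable with_gradient_measurable U w \<omega>_measurable)
    show "AE x in lebesgue_on U. norm (cmod (with_gradient U (\<lambda>x. h n (\<gamma> x) * \<phi> x) x $ k) powr p * \<omega> s' x)
       \<le> product_const * B powr p * (\<Sum>l\<in>UNIV. cmod (with_gradient U \<phi> x $ l) powr p * \<omega> s x)" for n
      using w(2)[of n] aeU
    proof eventually_elim
      case (elim x)
      then show ?case
        using product_gradient_bound[of s s' x B "h n" "h' n" \<phi> k, OF s _ B hB] \<omega>_pos[of x s'] by (simp add: abs_mult)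
    qed
    have "AE x in lebesgue_on U. \<forall>n k. with_gradient U (\<lambda>x. h n (\<gamma> x) * \<phi> x) x $ k = product_gradient (h n) (h' n) \<phi> k x"
      using w(2) by (subst AE_all_countable) blast
    then show "AE x in lebesgue_on U. (\<lambda>n. cmod (with_gradient U (\<lambda>x. h n (\<gamma> x) * \<phi> x) x $ k) powr p * \<omega> s' x) \<longlonglongrightarrow> 0"
    proof eventually_elim
      case (elim x)
      have "(\<lambda>n. product_gradient (h n) (h' n) \<phi> k x) \<longlonglongrightarrow> 0 * (with_gradient U \<phi> x $ k) +
         (case k of None \<Rightarrow> 0 | Some i \<Rightarrow> 0 * partial_deriv i (\<lambda>x. of_real (\<gamma> x)) x * \<phi> x)"
        unfolding product_gradient_def
        by (cases k) (auto intro!: tendsto_eq_intros lim)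
      then have "(\<lambda>n. cmod (product_gradient (h n) (h' n) \<phi> k x)) \<longlonglongrightarrow> 0"
        by (intro tendsto_norm_zero) (cases k, auto)
      then have "(\<lambda>n. cmod (product_gradient (h n) (h' n) \<phi> k x) powr p) \<longlonglongrightarrow> 0 powr p"
        using p by (intro tendsto_powr2 tendsto_const) auto
      then have "(\<lambda>n. cmod (product_gradient (h n) (h' n) \<phi> k x) powr p * \<omega> s' x) \<longlonglongrightarrow> 0 powr p * \<omega> s' x"
        by (intro tendsto_mult tendsto_const)
      then show ?case using p elim by simp
    qed
  qed auto
  then have "(\<lambda>n. energy p U (\<omega> s') (\<lambda>x. h n (\<gamma> x) * \<phi> x)) \<longlonglongrightarrow> (\<Sum>k\<in>(UNIV::'n option set). 0)"
    unfolding energy_def by (intro tendsto_sum) simp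
  then have "(\<lambda>n. energy p U (\<omega> s') (\<lambda>x. h n (\<gamma> x) * \<phi> x) powr (1 / p)) \<longlonglongrightarrow> 0 powr (1 / p)"
    using p W_energy_nonneg by (intro tendsto_powr2 tendsto_const) auto
  then show ?thesis using p by (simp add: W1_norm)
qed

end

section \<open>Compactly supported Lipschitz functions and their closure\<close>

text \<open>Any compact subset of U that carries the function may replace the relative support; such
  sets are easy to unite.\<close>

lemma Lip_c_iff:
  "\<phi> \<in> Lip_c U \<longleftrightarrow> (\<exists>M. M-lipschitz_on U \<phi>) \<and> (\<exists>K. compact K \<and> K \<subseteq> U \<and> (\<forall>x\<in>U - K. \<phi> x = 0))"
proof
  assume "\<phi> \<in> Lip_c U"
  then show "(\<exists>M. M-lipschitz_on U \<phi>) \<and> (\<exists>K. compact K \<and> K \<subseteq> U \<and> (\<forall>x\<in>U - K. \<phi> x = 0))"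
    unfolding Lip_c_def using closure_subset[of "{x \<in> U. \<phi> x \<noteq> 0}"]
    by (auto intro!: exI[of _ "U \<inter> closure {x \<in> U. \<phi> x \<noteq> 0}"])
next
  assume *: "(\<exists>M. M-lipschitz_on U \<phi>) \<and> (\<exists>K. compact K \<and> K \<subseteq> U \<and> (\<forall>x\<in>U - K. \<phi> x = 0))"
  then obtain K where K: "compact K" "K \<subseteq> U" "\<forall>x\<in>U - K. \<phi> x = 0" by blast
  have "closure {x \<in> U. \<phi> x \<noteq> 0} \<subseteq> K"
    using K by (intro closure_minimal) (auto simp: compact_imp_closed)
  then have "U \<inter> closure {x \<in> U. \<phi> x \<noteq> 0} = K \<inter> closure {x \<in> U. \<phi> x \<noteq> 0}" using K by auto
  then show "\<phi> \<in> Lip_c U" unfolding Lip_c_def using * K(1) by (auto intro: compact_Int_closed)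
qed

lemma Lip_c_add:
  assumes "\<phi> \<in> Lip_c U" "\<psi> \<in> Lip_c U"
  shows "(\<lambda>x. \<phi> x + \<psi> x) \<in> Lip_c U"
proof -
  obtain M K where 1: "M-lipschitz_on U \<phi>" "compact K" "K \<subseteq> U" "\<forall>x\<in>U - K. \<phi> x = 0"
    using assms(1) unfolding Lip_c_iff by blast
  obtain M' K' where 2: "M'-lipschitz_on U \<psi>" "compact K'" "K' \<subseteq> U" "\<forall>x\<in>U - K'. \<psi> x = 0"
    using assms(2) unfolding Lip_c_iff by blast
  show ?thesis unfolding Lip_c_iff
    using lipschitz_on_add[OF 1(1) 2(1)] compact_Un[OF 1(2) 2(2)] 1(3,4) 2(3,4)
    by (intro conjI exI[of _ "M + M'"] exI[of _ "K \<union> K'"]) auto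
qed

lemma Lip_c_cmult:
  assumes "\<phi> \<in> Lip_c U"
  shows "(\<lambda>x. c * \<phi> x) \<in> Lip_c U"
proof -
  obtain M K where 1: "M-lipschitz_on U \<phi>" "compact K" "K \<subseteq> U" "\<forall>x\<in>U - K. \<phi> x = 0"
    using assms(1) unfolding Lip_c_iff by blast
  have "(cmod c * M)-lipschitz_on U (\<lambda>x. c * \<phi> x)"
  proof (rule lipschitz_onI)
    fix x y assume "x \<in> U" "y \<in> U"
    then show "dist (c * \<phi> x) (c * \<phi> y) \<le> cmod c * M * dist x y"
      using lipschitz_onD[OF 1(1), of x y]
      by (simp add: dist_norm right_diff_distrib[symmetric] norm_mult mult.assoc mult_left_mono)
  qed (use lipschitz_on_nonneg[OF 1(1)] in auto)
  then show ?thesis unfolding Lip_c_iff using 1 by auto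
qed

lemma smooth_line_lipschitz:
  assumes "smooth_line h"
  obtains M where "0 \<le> M" "\<And>s t. \<bar>s\<bar> \<le> R \<Longrightarrow> \<bar>t\<bar> \<le> R \<Longrightarrow> cmod (h s - h t) \<le> M * \<bar>s - t\<bar>"
    "\<And>t. \<bar>t\<bar> \<le> R \<Longrightarrow> cmod (h t) \<le> M"
proof -
  obtain h' where h': "smooth_line h'" "\<And>t. (h has_vector_derivative h' t) (at t)"
    using smooth_lineD[OF assms] by metis
  have bdd: "\<exists>M. \<forall>t\<in>{-R..R}. cmod (f t) \<le> M" if "smooth_line f" for f
    using compact_imp_bounded[OF compact_continuous_image[OF smooth_line_continuous[OF that], of "{-R..R}"]]
    by (auto simp: bounded_iff)
  obtain M1 where M1: "\<And>t. t \<in> {-R..R} \<Longrightarrow> cmod (h' t) \<le> M1" using bdd[OF h'(1)] by blast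
  obtain M2 where M2: "\<And>t. t \<in> {-R..R} \<Longrightarrow> cmod (h t) \<le> M2" using bdd[OF assms] by blast
  define M where "M = max 0 (max M1 M2)"
  show ?thesis
  proof (rule that[of M])
    show "0 \<le> M" by (simp add: M_def)
    show "cmod (h t) \<le> M" if "\<bar>t\<bar> \<le> R" for t
    proof -
      have "t \<in> {-R..R}" using that by auto
      from M2[OF this] show ?thesis by (simp add: M_def)
    qed
    fix s t assume st: "\<bar>s\<bar> \<le> R" "\<bar>t\<bar> \<le> R"
    have "norm (h s - h t) \<le> M * norm (s - t)"
    proof (rule differentiable_bound[where S="{-R..R}" and f'="\<lambda>x v. v *\<^sub>R h' x"])
      fix x assume x: "x \<in> {-R..R}"
      show "(h has_derivative (\<lambda>v. v *\<^sub>R h' x)) (at x within {-R..R})"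
        using h'(2)[of x] unfolding has_vector_derivative_def by (rule has_derivative_at_withinI)
      show "onorm (\<lambda>v. v *\<^sub>R h' x) \<le> M"
      proof (rule onorm_le)
        fix v :: real
        have "cmod (h' x) \<le> M" using M1[OF x] by (auto simp: M_def)
        then have "\<bar>v\<bar> * cmod (h' x) \<le> \<bar>v\<bar> * M" by (rule mult_left_mono) auto
        then show "norm (v *\<^sub>R h' x) \<le> M * norm v" by (simp add: mult.commute)
      qed
    qed (use st in auto)
    then show "cmod (h s - h t) \<le> M * \<bar>s - t\<bar>" by simp
  qed
qed

text \<open>The factor h \<circ> \<gamma> may be neither bounded nor Lipschitz on U, but differences
  of the product vanish unless one of the points lies in the compact carrier of \<phi>, where
  \<gamma> and \<phi> are bounded.\<close>

lemma Lip_c_compose_mult: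
  fixes \<gamma> :: "real^'n \<Rightarrow> real"
  assumes \<gamma>: "L-lipschitz_on UNIV \<gamma>" and h: "smooth_line h" and \<phi>: "\<phi> \<in> Lip_c U"
  shows "(\<lambda>x. h (\<gamma> x) * \<phi> x) \<in> Lip_c U"
proof -
  obtain M K where 1: "M-lipschitz_on U \<phi>" "compact K" "K \<subseteq> U" "\<forall>x\<in>U - K. \<phi> x = 0"
    using \<phi> unfolding Lip_c_iff by blast
  have "compact (\<gamma> ` K)" "compact (\<phi> ` K)"
    using 1 \<gamma> by (auto intro!: compact_continuous_image lipschitz_on_continuous_on intro: lipschitz_on_subset)
  then obtain R P where R: "\<And>x. x \<in> K \<Longrightarrow> \<bar>\<gamma> x\<bar> \<le> R" and P: "\<And>x. x \<in> K \<Longrightarrow> cmod (\<phi> x) \<le> P"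
    by (metis bounded_iff compact_imp_bounded imageI real_norm_def)
  obtain B where B: "0 \<le> B" "\<And>s t. \<bar>s\<bar> \<le> R \<Longrightarrow> \<bar>t\<bar> \<le> R \<Longrightarrow> cmod (h s - h t) \<le> B * \<bar>s - t\<bar>"
    "\<And>t. \<bar>t\<bar> \<le> R \<Longrightarrow> cmod (h t) \<le> B"
    using smooth_line_lipschitz[OF h] by metis
  have M0: "0 \<le> M" and L0: "0 \<le> L" using 1(1) \<gamma> lipschitz_on_nonneg by blast+
  let ?Q = "B * M + B * L * \<bar>P\<bar>"
  have Q0: "0 \<le> ?Q" using B(1) M0 L0 by simp
  \<comment> \<open>Only x is required to lie in K. If y does not, then \<phi> y = 0 and the term
    with h (\<gamma> x) - h (\<gamma> y) disappears, so h (\<gamma> y) is never estimated off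
    K.\<close>
  have in_out: "cmod (h (\<gamma> x) * \<phi> x - h (\<gamma> y) * \<phi> y) \<le> ?Q * dist x y"
    if "x \<in> K" "y \<in> U" for x y
  proof -
    have xU: "x \<in> U" using that 1 by auto
    have a: "cmod (h (\<gamma> x)) * cmod (\<phi> x - \<phi> y) \<le> B * (M * dist x y)"
      using lipschitz_onD[OF 1(1) xU that(2)] B(3)[OF R[OF that(1)]] B(1)
      by (intro mult_mono) (auto simp: dist_norm)
    have b: "cmod (h (\<gamma> x) - h (\<gamma> y)) * cmod (\<phi> y) \<le> B * L * \<bar>P\<bar> * dist x y"
    proof (cases "y \<in> K")
      case True
      have "cmod (h (\<gamma> x) - h (\<gamma> y)) \<le> B * \<bar>\<gamma> x - \<gamma> y\<bar>" by (intro B R that True)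
      also have "\<dots> \<le> B * (L * dist x y)"
        using lipschitz_onD[OF \<gamma>, of x y] B(1) by (intro mult_left_mono) (auto simp: dist_real_def)
      finally have "cmod (h (\<gamma> x) - h (\<gamma> y)) * cmod (\<phi> y) \<le> B * (L * dist x y) * \<bar>P\<bar>"
        using P[OF True] B(1) L0 by (intro mult_mono) auto
      then show ?thesis by (simp add: mult_ac)
    next
      case False
      then show ?thesis using 1(4) that(2) B(1) L0 by simp
    qed
    have "h (\<gamma> x) * \<phi> x - h (\<gamma> y) * \<phi> y = h (\<gamma> x) * (\<phi> x - \<phi> y) + (h (\<gamma> x) - h (\<gamma> y)) * \<phi> y"
      by (simp add: algebra_simps)
    then have "cmod (h (\<gamma> x) * \<phi> x - h (\<gamma> y) * \<phi> y) \<le>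
       cmod (h (\<gamma> x)) * cmod (\<phi> x - \<phi> y) + cmod (h (\<gamma> x) - h (\<gamma> y)) * cmod (\<phi> y)"
      by (metis norm_mult norm_triangle_ineq)
    also have "\<dots> \<le> ?Q * dist x y" using a b by (simp add: distrib_right mult.assoc)
    finally show ?thesis .
  qed
  have "?Q-lipschitz_on U (\<lambda>x. h (\<gamma> x) * \<phi> x)"
  proof (rule lipschitz_onI[OF _ Q0])
    fix x y assume xy: "x \<in> U" "y \<in> U"
    consider "x \<in> K" | "y \<in> K" | "x \<notin> K" "y \<notin> K" by blast
    then show "dist (h (\<gamma> x) * \<phi> x) (h (\<gamma> y) * \<phi> y) \<le> ?Q * dist x y"
    proof cases
      case 1 then show ?thesis using in_out xy by (simp add: dist_norm)
    next
      case 2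
      then show ?thesis using in_out[of y x] xy by (simp add: dist_commute dist_norm norm_minus_commute)
    next
      case 3 then show ?thesis using 1(4) xy Q0 by simp
    qed
  qed
  then show ?thesis unfolding Lip_c_iff using 1 by auto
qed

lemma W1_0_carrier_iff:
  "\<phi> \<in> fcarrier (W1_0 p U \<omega>) \<longleftrightarrow> \<phi> \<in> fcarrier (W1 p U \<omega>) \<and>
    (\<forall>e>0. \<exists>\<psi> \<in> Lip_c U \<inter> fcarrier (W1 p U \<omega>). fnorm (W1 p U \<omega>) (\<lambda>x. \<phi> x - \<psi> x) < e)"
  by (simp add: W1_0_def fclosure_def)

lemma W1_0_norm: "fnorm (W1_0 p U \<omega>) = fnorm (W1 p U \<omega>)"
  by (simp add: W1_0_def)

lemma W1_0_cong:
  assumes "\<And>x. x \<in> U \<Longrightarrow> \<omega> x = \<omega>' x"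
  shows "W1_0 p U \<omega> = W1_0 p U \<omega>'"
  unfolding W1_0_def using W1_cong[of U \<omega> \<omega>' p] assms by simp

section \<open>Stability of the closure \<open>W0\<close> under sums, multipliers and limits\<close>

context weight_scale
begin

lemma W_diff:
  assumes "\<phi> \<in> fcarrier (W s)" "\<psi> \<in> fcarrier (W s)"
  shows "(\<lambda>x. \<phi> x - \<psi> x) \<in> fcarrier (W s)"
    "fnorm (W s) (\<lambda>x. \<phi> x - \<psi> x) \<le> 4 * (fnorm (W s) \<phi> + fnorm (W s) \<psi>)"
  using W_add[OF assms(1) W_cmult(1)[OF assms(2), of "-1"]] W_cmult(2)[OF assms(2), of "-1"] by auto

abbreviation W0 :: "real \<Rightarrow> (real^'n) fun_space" where
  "W0 s \<equiv> W1_0 p U (\<omega> s)"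

lemma W0_add:
  assumes 1: "\<phi> \<in> fcarrier (W0 s)" and 2: "\<psi> \<in> fcarrier (W0 s)"
  shows "(\<lambda>x. \<phi> x + \<psi> x) \<in> fcarrier (W0 s)"
  unfolding W1_0_carrier_iff
proof (intro conjI allI impI)
  have W: "\<phi> \<in> fcarrier (W s)" "\<psi> \<in> fcarrier (W s)" using 1 2 by (auto simp: W1_0_carrier_iff)
  then show "(\<lambda>x. \<phi> x + \<psi> x) \<in> fcarrier (W s)" by (rule W_add)
  fix e :: real assume "e > 0"
  \<comment> \<open>The 8 is 4 * 2: the constant of \<open>W_add\<close> times the number of error
    terms.\<close>
  then have "e / 8 > 0" by simp
  then obtain \<phi>' \<psi>' where \<phi>': "\<phi>' \<in> Lip_c U" "\<phi>' \<in> fcarrier (W s)" "fnorm (W s) (\<lambda>x. \<phi> x - \<phi>' x) < e / 8"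
    and \<psi>': "\<psi>' \<in> Lip_c U" "\<psi>' \<in> fcarrier (W s)" "fnorm (W s) (\<lambda>x. \<psi> x - \<psi>' x) < e / 8"
    using 1 2 unfolding W1_0_carrier_iff by blast
  have "fnorm (W s) (\<lambda>x. (\<phi> x - \<phi>' x) + (\<psi> x - \<psi>' x)) \<le>
      4 * (fnorm (W s) (\<lambda>x. \<phi> x - \<phi>' x) + fnorm (W s) (\<lambda>x. \<psi> x - \<psi>' x))"
    by (rule W_add(2)[OF W_diff(1)[OF W(1) \<phi>'(2)] W_diff(1)[OF W(2) \<psi>'(2)]])
  also have "\<dots> < e" using \<phi>'(3) \<psi>'(3) by simp
  finally have "fnorm (W s) (\<lambda>x. (\<phi> x - \<phi>' x) + (\<psi> x - \<psi>' x)) < e" .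
  then show "\<exists>\<zeta>\<in>Lip_c U \<inter> fcarrier (W s). fnorm (W s) (\<lambda>x. \<phi> x + \<psi> x - \<zeta> x) < e"
    using \<phi>' \<psi>' by (intro bexI[of _ "\<lambda>x. \<phi>' x + \<psi>' x"]) (auto intro: Lip_c_add W_add simp: algebra_simps)
qed

lemma W0_cmult:
  assumes 1: "\<phi> \<in> fcarrier (W0 s)"
  shows "(\<lambda>x. c * \<phi> x) \<in> fcarrier (W0 s)"
  unfolding W1_0_carrier_iff
proof (intro conjI allI impI)
  have W: "\<phi> \<in> fcarrier (W s)" using 1 by (auto simp: W1_0_carrier_iff)
  then show "(\<lambda>x. c * \<phi> x) \<in> fcarrier (W s)" by (rule W_cmult)
  fix e :: real assume e: "e > 0"
  then have "e / (cmod c + 1) > 0" by (intro divide_pos_pos) (auto intro: add_nonneg_pos)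
  then obtain \<phi>' where \<phi>': "\<phi>' \<in> Lip_c U" "\<phi>' \<in> fcarrier (W s)" "fnorm (W s) (\<lambda>x. \<phi> x - \<phi>' x) < e / (cmod c + 1)"
    using 1 unfolding W1_0_carrier_iff by blast
  have "fnorm (W s) (\<lambda>x. c * (\<phi> x - \<phi>' x)) = cmod c * fnorm (W s) (\<lambda>x. \<phi> x - \<phi>' x)"
    by (rule W_cmult(2)[OF W_diff(1)[OF W(1) \<phi>'(2)]])
  also have "\<dots> \<le> cmod c * (e / (cmod c + 1))"
    using \<phi>'(3) by (intro mult_left_mono) auto
  also have "\<dots> < e" using e add_nonneg_pos[OF norm_ge_zero[of c] zero_less_one] by (simp add: field_simps)
  finally have "fnorm (W s) (\<lambda>x. c * (\<phi> x - \<phi>' x)) < e" .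
  then show "\<exists>\<zeta>\<in>Lip_c U \<inter> fcarrier (W s). fnorm (W s) (\<lambda>x. c * \<phi> x - \<zeta> x) < e"
    using \<phi>' by (intro bexI[of _ "\<lambda>x. c * \<phi>' x"]) (auto intro: Lip_c_cmult W_cmult simp: right_diff_distrib)
qed

text \<open>Multiplication by h \<circ> \<gamma> is bounded from \<open>W s\<close> to
  \<open>W s'\<close> and preserves \<open>Lip_c U\<close>, hence it carries the closure into the
  closure.\<close>

lemma W0_multiplier:
  assumes s: "s \<in> {0..1}" "s' \<in> {0..1}" and B: "0 \<le> B"
    and h: "smooth_line h" "\<And>t. (h has_vector_derivative h' t) (at t)"
    and hB: "\<And>t. cmod (h t) \<le> B * exp ((s' - s) * t / p)" "\<And>t. cmod (h' t) \<le> B * exp ((s' - s) * t / p)"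
    and 1: "\<phi> \<in> fcarrier (W0 s)"
  shows "(\<lambda>x. h (\<gamma> x) * \<phi> x) \<in> fcarrier (W0 s')"
  unfolding W1_0_carrier_iff
proof (intro conjI allI impI)
  note m = multiplier[OF s B h hB]
  have W: "\<phi> \<in> fcarrier (W s)" using 1 by (auto simp: W1_0_carrier_iff)
  then show "(\<lambda>x. h (\<gamma> x) * \<phi> x) \<in> fcarrier (W s')" by (rule m)
  fix e :: real assume e: "e > 0"
  have c0: "0 \<le> multiplier_const * B" using multiplier_const_pos B by simp
  then have "e / (multiplier_const * B + 1) > 0" using e by simp
  then obtain \<phi>' where \<phi>': "\<phi>' \<in> Lip_c U" "\<phi>' \<in> fcarrier (W s)"
    "fnorm (W s) (\<lambda>x. \<phi> x - \<phi>' x) < e / (multiplier_const * B + 1)"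
    using 1 unfolding W1_0_carrier_iff by blast
  have "fnorm (W s') (\<lambda>x. h (\<gamma> x) * (\<phi> x - \<phi>' x)) \<le> multiplier_const * B * fnorm (W s) (\<lambda>x. \<phi> x - \<phi>' x)"
    by (rule m(2)[OF W_diff(1)[OF W(1) \<phi>'(2)]])
  also have "\<dots> \<le> multiplier_const * B * (e / (multiplier_const * B + 1))"
    using \<phi>'(3) c0 by (intro mult_left_mono) auto
  also have "\<dots> < e" using e c0 by (simp add: field_simps add_nonneg_pos)
  finally have "fnorm (W s') (\<lambda>x. h (\<gamma> x) * (\<phi> x - \<phi>' x)) < e" .
  then show "\<exists>\<zeta>\<in>Lip_c U \<inter> fcarrier (W s'). fnorm (W s') (\<lambda>x. h (\<gamma> x) * \<phi> x - \<zeta> x) < e"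
    using \<phi>' by (intro bexI[of _ "\<lambda>x. h (\<gamma> x) * \<phi>' x"])
      (auto intro: Lip_c_compose_mult[OF \<gamma>_lipschitz h(1)] m(1) simp: right_diff_distrib)
qed

lemma W0_closed:
  assumes W: "\<phi> \<in> fcarrier (W s)" and lim: "\<And>e. e > 0 \<Longrightarrow> \<exists>\<psi>\<in>fcarrier (W0 s). fnorm (W s) (\<lambda>x. \<phi> x - \<psi> x) < e"
  shows "\<phi> \<in> fcarrier (W0 s)"
  unfolding W1_0_carrier_iff
proof (intro conjI allI impI W)
  fix e :: real assume "e > 0"
  then have e: "e / 8 > 0" by simp
  obtain \<psi> where \<psi>: "\<psi> \<in> fcarrier (W0 s)" "fnorm (W s) (\<lambda>x. \<phi> x - \<psi> x) < e / 8" using lim[OF e] by blast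
  then have \<psi>W: "\<psi> \<in> fcarrier (W s)" by (auto simp: W1_0_carrier_iff)
  obtain \<zeta> where \<zeta>: "\<zeta> \<in> Lip_c U" "\<zeta> \<in> fcarrier (W s)" "fnorm (W s) (\<lambda>x. \<psi> x - \<zeta> x) < e / 8"
    using \<psi>(1) e unfolding W1_0_carrier_iff by blast
  have "fnorm (W s) (\<lambda>x. (\<phi> x - \<psi> x) + (\<psi> x - \<zeta> x)) \<le>
      4 * (fnorm (W s) (\<lambda>x. \<phi> x - \<psi> x) + fnorm (W s) (\<lambda>x. \<psi> x - \<zeta> x))"
    by (rule W_add(2)[OF W_diff(1)[OF W \<psi>W] W_diff(1)[OF \<psi>W \<zeta>(2)]])
  also have "\<dots> < e" using \<psi>(2) \<zeta>(3) by simp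
  finally have "fnorm (W s) (\<lambda>x. (\<phi> x - \<psi> x) + (\<psi> x - \<zeta> x)) < e" .
  then show "\<exists>\<zeta>\<in>Lip_c U \<inter> fcarrier (W s). fnorm (W s) (\<lambda>x. \<phi> x - \<zeta> x) < e"
    using \<zeta> by (intro bexI[of _ \<zeta>]) auto
qed

end

section \<open>Elements of the interpolation space\<close>

text \<open>Around a point of the half disc, the circle of radius r/2 stays in the disc where F is
  bounded by \<open>B\<close>; Cauchy's inequality there bounds F'' by 2 B / (r/2)^2 = 8 B / r^2,
  and Taylor's formula gives the remainder.\<close>

lemma cauchy_remainder:
  assumes F: "F holomorphic_on UNIV" and r: "0 < r" and B: "\<And>\<zeta>. \<zeta> \<in> cball z r \<Longrightarrow> cmod (F \<zeta>) \<le> B"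
  shows "cmod (deriv F z) \<le> B / r"
    "w \<in> ball z (r / 2) \<Longrightarrow> w \<noteq> z \<Longrightarrow> cmod ((F w - F z) / (w - z) - deriv F z) \<le> 8 * B / r\<^sup>2 * cmod (w - z)"
proof -
  have hol: "F holomorphic_on S" for S using F holomorphic_on_subset by blast
  have cont: "continuous_on S F" for S using hol holomorphic_on_imp_continuous_on by blast
  show "cmod (deriv F z) \<le> B / r"
    using Cauchy_inequality[OF hol cont r, of z B 1] B r by (auto simp: dist_norm)
  assume w: "w \<in> ball z (r / 2)" "w \<noteq> z"
  have "cmod ((deriv ^^ 0) F w - (\<Sum>i\<le>1. (deriv ^^ i) F z * (w - z) ^ i / fact i)) \<le> (8 * B / r\<^sup>2) * cmod (w - z) ^ Suc 1 / fact 1"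
  proof (rule complex_Taylor[where S="cball z (r / 2)"])
    fix i x assume "x \<in> cball z (r / 2)"
    have "(deriv ^^ i) F holomorphic_on UNIV" using F by (intro holomorphic_higher_deriv) auto
    then show "((deriv ^^ i) F has_field_derivative (deriv ^^ Suc i) F x) (at x within cball z (r / 2))"
      using holomorphic_derivI[of "(deriv ^^ i) F" UNIV x "cball z (r/2)"] by simp
  next
    fix x assume x: "x \<in> cball z (r / 2)"
    have "cmod ((deriv ^^ 2) F x) \<le> fact 2 * B / (r / 2)\<^sup>2"
    proof (rule Cauchy_inequality[OF hol cont])
      fix y assume "cmod (x - y) = r / 2"
      then have "dist z y \<le> r" using dist_triangle[of z y x] x by (simp add: dist_norm)
      then show "cmod (F y) \<le> B" using B by simp
    qed (use r in auto)
    then show "cmod ((deriv ^^ Suc 1) F x) \<le> 8 * B / r\<^sup>2" by (simp add: numeral_2_eq_2 power2_eq_square)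
  qed (use w r in auto)
  then have *: "cmod (F w - F z - deriv F z * (w - z)) \<le> 8 * B / r\<^sup>2 * cmod (w - z) * cmod (w - z)"
    by (simp add: power2_eq_square algebra_simps)
  have "(F w - F z) / (w - z) - deriv F z = (F w - F z - deriv F z * (w - z)) / (w - z)"
    using w by (simp add: field_simps)
  then show "cmod ((F w - F z) / (w - z) - deriv F z) \<le> 8 * B / r\<^sup>2 * cmod (w - z)"
    using * w by (simp add: norm_divide divide_le_eq)
qed

text \<open>For j = 0 and j = 1 a partition of unity on the line. Evaluated at \<gamma>, the piece
  of index j is concentrated where the endpoint weight j is, up to \<open>K\<close>, the smaller
  one: \<gamma> < 0 for j = 0 and \<gamma> > 0 for j = 1. The logistic form is analytic near the
  real axis and dominates its own derivative.\<close>

definition sigmoid :: "real \<Rightarrow> real \<Rightarrow> real" where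
  "sigmoid j t = 1 / (1 + exp ((1 - 2 * j) * t))"

lemma sigmoid_pos: "0 < sigmoid j t"
  by (simp add: sigmoid_def add_pos_pos)

lemma sigmoid_sum: "sigmoid 0 t + sigmoid 1 t = 1"
proof -
  have "0 < exp t" by simp
  then have "1 / (1 + exp t) + exp t / (1 + exp t) = 1" "1 / (1 + 1 / exp t) = exp t / (1 + exp t)"
    by (simp_all add: add_divide_distrib[symmetric] add_nonneg_eq_0_iff divide_simps)
  then show ?thesis by (simp add: sigmoid_def exp_minus inverse_eq_divide)
qed

definition sigmoid_deriv :: "real \<Rightarrow> real \<Rightarrow> real" where
  "sigmoid_deriv j t = - ((1 - 2 * j) * exp ((1 - 2 * j) * t)) / (1 + exp ((1 - 2 * j) * t))\<^sup>2"

lemma sigmoid_deriv_bound: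
  assumes "j \<in> {0, 1}"
  shows "\<bar>sigmoid_deriv j t\<bar> \<le> sigmoid j t"
proof -
  let ?e = "exp ((1 - 2 * j) * t)"
  have "\<bar>1 - 2 * j\<bar> = 1" using assms by auto
  then have "\<bar>sigmoid_deriv j t\<bar> = ?e / (1 + ?e)\<^sup>2" by (simp add: sigmoid_deriv_def abs_mult)
  also have "\<dots> \<le> (1 + ?e) / (1 + ?e)\<^sup>2" by (intro divide_right_mono) auto
  also have "\<dots> = sigmoid j t" by (simp add: sigmoid_def power2_eq_square)
  finally show ?thesis .
qed

lemma sigmoid_mult:
  assumes E: "\<And>\<zeta>. (E has_field_derivative E' \<zeta>) (at \<zeta>)"
  shows "smooth_line (\<lambda>t. of_real (sigmoid j t) * E (of_real t))"
    "((\<lambda>t. of_real (sigmoid j t) * E (of_real t)) has_vector_derivative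
       of_real (sigmoid_deriv j t) * E (of_real t) + of_real (sigmoid j t) * E' (of_real t)) (at t)"
proof -
  define H where "H \<zeta> = 1 / (1 + exp ((1 - 2 * of_real j) * \<zeta>)) * E \<zeta>" for \<zeta>
  \<comment> \<open>The complement of the poles of the logistic function. The denominator is
    positive on the real axis, so \<open>A\<close> is an open set containing it.\<close>
  define A where "A = {\<zeta>. 1 + exp ((1 - 2 * of_real j) * \<zeta>) \<noteq> (0::complex)}"
  have E_hol: "E holomorphic_on A" using E by (auto simp: holomorphic_on_def field_differentiable_def intro: has_field_derivative_at_within)
  have "H holomorphic_on A" unfolding H_def
    by (intro holomorphic_intros E_hol) (auto simp: A_def)
  moreover have "open A" unfolding A_def by (intro open_Collect_neq continuous_intros)
  moreover have "of_real t \<in> A" for t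
  proof -
    have "1 + exp ((1 - 2 * of_real j) * complex_of_real t) = of_real (1 + exp ((1 - 2 * j) * t))"
      by (simp add: exp_of_real[symmetric])
    moreover have "1 + exp ((1 - 2 * j) * t) \<noteq> 0" by (metis add_pos_pos exp_gt_zero less_irrefl zero_less_one)
    ultimately show ?thesis unfolding A_def mem_Collect_eq by (metis of_real_eq_0_iff)
  qed
  ultimately have "smooth_line (\<lambda>t. H (of_real t))" by (rule smooth_line_holomorphic)
  moreover have "H (of_real t) = of_real (sigmoid j t) * E (of_real t)" for t
    by (simp add: H_def sigmoid_def exp_of_real[symmetric])
  ultimately show "smooth_line (\<lambda>t. of_real (sigmoid j t) * E (of_real t))" by simp
  have nz: "1 + exp ((1 - 2 * j) * t) \<noteq> 0" by (metis add_pos_pos exp_gt_zero less_irrefl zero_less_one)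
  have "(sigmoid j has_real_derivative sigmoid_deriv j t) (at t)"
    unfolding sigmoid_def[abs_def] sigmoid_deriv_def
    by (rule derivative_eq_intros refl nz)+ (simp add: power2_eq_square)
  from has_vector_derivative_mult[OF has_vector_derivative_of_real[OF this] has_vector_derivative_real_field[OF E]]
  show "((\<lambda>t. of_real (sigmoid j t) * E (of_real t)) has_vector_derivative
       of_real (sigmoid_deriv j t) * E (of_real t) + of_real (sigmoid j t) * E' (of_real t)) (at t)"
    by (simp add: add.commute)
qed

lemma entire_line:
  assumes E: "\<And>\<zeta>. (E has_field_derivative E' \<zeta>) (at \<zeta>)"
  shows "smooth_line (\<lambda>t. E (of_real t))"
    "((\<lambda>t. E (of_real t)) has_vector_derivative E' (of_real t)) (at t)"
proof -
  have "E holomorphic_on UNIV"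
    using E by (auto simp: holomorphic_on_def field_differentiable_def)
  then show "smooth_line (\<lambda>t. E (of_real t))" by (rule smooth_line_holomorphic) auto
  show "((\<lambda>t. E (of_real t)) has_vector_derivative E' (of_real t)) (at t)"
    by (rule has_vector_derivative_real_field[OF E])
qed

lemma exp_convex_bound: "0 \<le> a \<Longrightarrow> a \<le> 1 \<Longrightarrow> exp (a * t) \<le> 1 + exp (t::real)"
proof (cases "t \<ge> 0")
  case True
  assume "a \<le> 1" then have "exp (a * t) \<le> exp t" using True mult_right_mono[of a 1 t] by simp
  then show ?thesis by linarith
next
  case False
  assume "0 \<le> a" then have "exp (a * t) \<le> 1" using False by (simp add: mult_nonneg_nonpos)
  then show ?thesis by (simp add: add_increasing2)
qed

text \<open>\<open>A\<close> stands for the full spaces \<open>W\<close> or for the closures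
  \<open>W0\<close>, so both are interpolated by one argument. \<open>A_sum\<close> is the point at
  which closures need care: a function in the sum of the endpoints that has finite middle norm must
  belong to the middle space.\<close>

locale interpolation_scale = weight_scale U \<gamma> \<omega> L K p
  for U :: "(real^'n) set" and \<gamma> \<omega> L K p +
  fixes A :: "real \<Rightarrow> (real^'n) fun_space" and \<theta> :: real
  assumes \<theta>: "0 < \<theta>" "\<theta> < 1"
    and A_sub: "\<And>s \<phi>. \<phi> \<in> fcarrier (A s) \<Longrightarrow> \<phi> \<in> fcarrier (W s)"
    and A_norm: "\<And>s. fnorm (A s) = fnorm (W s)"
    and A_add: "\<And>s \<phi> \<psi>. \<phi> \<in> fcarrier (A s) \<Longrightarrow> \<psi> \<in> fcarrier (A s) \<Longrightarrow> (\<lambda>x. \<phi> x + \<psi> x) \<in> fcarrier (A s)"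
    and A_cmult: "\<And>s \<phi> c. \<phi> \<in> fcarrier (A s) \<Longrightarrow> (\<lambda>x. c * \<phi> x) \<in> fcarrier (A s)"
    and A_multiplier: "\<And>s s' B h h' \<phi>. s \<in> {0..1} \<Longrightarrow> s' \<in> {0..1} \<Longrightarrow> 0 \<le> B \<Longrightarrow> smooth_line h \<Longrightarrow>
      (\<And>t. (h has_vector_derivative h' t) (at t)) \<Longrightarrow>
      (\<And>t. cmod (h t) \<le> B * exp ((s' - s) * t / p)) \<Longrightarrow> (\<And>t. cmod (h' t) \<le> B * exp ((s' - s) * t / p)) \<Longrightarrow>
      \<phi> \<in> fcarrier (A s) \<Longrightarrow> (\<lambda>x. h (\<gamma> x) * \<phi> x) \<in> fcarrier (A s')"
    and A_sum: "\<And>\<phi> a0 a1. \<phi> \<in> fcarrier (W \<theta>) \<Longrightarrow> a0 \<in> fcarrier (A 0) \<Longrightarrow> a1 \<in> fcarrier (A 1) \<Longrightarrow>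
      \<phi> = (\<lambda>x. a0 x + a1 x) \<Longrightarrow> \<phi> \<in> fcarrier (A \<theta>)"
begin

abbreviation Sum :: "(real^'n) fun_space" where "Sum \<equiv> fsum (A 0) (A 1)"

lemma A_norm_nonneg: "0 \<le> fnorm (A s) \<phi>"
  by (simp add: A_norm W_norm_nonneg)

lemma SumI:
  assumes "a0 \<in> fcarrier (A 0)" "a1 \<in> fcarrier (A 1)" "\<phi> = (\<lambda>x. a0 x + a1 x)"
  shows "\<phi> \<in> fcarrier Sum" "fnorm Sum \<phi> \<le> fnorm (A 0) a0 + fnorm (A 1) a1"
proof -
  show "\<phi> \<in> fcarrier Sum" using assms by (auto simp: fsum_def)
  show "fnorm Sum \<phi> \<le> fnorm (A 0) a0 + fnorm (A 1) a1"
    unfolding fsum_def fun_space.simps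
  proof (rule cInf_lower)
    show "bdd_below {fnorm (A 0) a0 + fnorm (A 1) a1 |a0 a1. a0 \<in> fcarrier (A 0) \<and> a1 \<in> fcarrier (A 1) \<and> \<phi> = (\<lambda>x. a0 x + a1 x)}"
      by (rule bdd_belowI[of _ 0]) (auto intro: add_nonneg_nonneg A_norm_nonneg)
  qed (use assms in auto)
qed

lemma SumE:
  assumes "\<phi> \<in> fcarrier Sum"
  obtains a0 a1 where "a0 \<in> fcarrier (A 0)" "a1 \<in> fcarrier (A 1)" "\<phi> = (\<lambda>x. a0 x + a1 x)"
  using assms by (auto simp: fsum_def)

lemma Sum_norm_greatest:
  assumes "\<phi> \<in> fcarrier Sum"
    and "\<And>a0 a1. a0 \<in> fcarrier (A 0) \<Longrightarrow> a1 \<in> fcarrier (A 1) \<Longrightarrow> \<phi> = (\<lambda>x. a0 x + a1 x) \<Longrightarrow>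
      c \<le> fnorm (A 0) a0 + fnorm (A 1) a1"
  shows "c \<le> fnorm Sum \<phi>"
proof -
  obtain a0 a1 where "a0 \<in> fcarrier (A 0)" "a1 \<in> fcarrier (A 1)" "\<phi> = (\<lambda>x. a0 x + a1 x)"
    using SumE[OF assms(1)] by metis
  then show ?thesis
    unfolding fsum_def fun_space.simps using assms(2) by (intro cInf_greatest) auto
qed

lemma Sum_norm_nonneg: "\<phi> \<in> fcarrier Sum \<Longrightarrow> 0 \<le> fnorm Sum \<phi>"
  by (rule Sum_norm_greatest) (auto intro: add_nonneg_nonneg A_norm_nonneg)

lemma Sum_add:
  assumes "\<phi> \<in> fcarrier Sum" "\<psi> \<in> fcarrier Sum"
  shows "(\<lambda>x. \<phi> x + \<psi> x) \<in> fcarrier Sum"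
proof -
  obtain a0 a1 where a: "a0 \<in> fcarrier (A 0)" "a1 \<in> fcarrier (A 1)" "\<phi> = (\<lambda>x. a0 x + a1 x)"
    using SumE[OF assms(1)] by metis
  obtain b0 b1 where b: "b0 \<in> fcarrier (A 0)" "b1 \<in> fcarrier (A 1)" "\<psi> = (\<lambda>x. b0 x + b1 x)"
    using SumE[OF assms(2)] by metis
  show ?thesis
    by (rule SumI(1)[OF A_add[OF a(1) b(1)] A_add[OF a(2) b(2)]]) (simp add: a(3) b(3) algebra_simps)
qed

lemma Sum_cmult:
  assumes "\<phi> \<in> fcarrier Sum"
  shows "(\<lambda>x. c * \<phi> x) \<in> fcarrier Sum"
proof -
  obtain a0 a1 where a: "a0 \<in> fcarrier (A 0)" "a1 \<in> fcarrier (A 1)" "\<phi> = (\<lambda>x. a0 x + a1 x)"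
    using SumE[OF assms(1)] by metis
  show ?thesis
    by (rule SumI(1)[OF A_cmult[OF a(1), of c] A_cmult[OF a(2), of c]]) (simp add: a(3) distrib_left)
qed

lemma Sum_diff: "\<phi> \<in> fcarrier Sum \<Longrightarrow> \<psi> \<in> fcarrier Sum \<Longrightarrow> (\<lambda>x. \<phi> x - \<psi> x) \<in> fcarrier Sum"
  using Sum_add[of \<phi> "\<lambda>x. (-1) * \<psi> x"] Sum_cmult[of \<psi> "-1"] by simp

text \<open>This is, for each of the two pieces of the partition, the growth that
  \<open>A_multiplier\<close> asks for in passing from \<theta> to the endpoint j. Imposed on E and
  E', it makes multiplication by E \<circ> \<gamma> bounded from \<open>A \<theta>\<close> to the
  sum space.\<close>

definition sigmoid_dominated :: "(complex \<Rightarrow> complex) \<Rightarrow> real \<Rightarrow> bool" where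
  "sigmoid_dominated E B \<longleftrightarrow>
     (\<forall>j\<in>{0,1}. \<forall>t. sigmoid j t * cmod (E (of_real t)) \<le> B * exp ((j - \<theta>) * t / p))"

text \<open>The factor 2 covers the two terms of the product rule, in which the derivative of the
  logistic factor is bounded by that factor.\<close>

lemma sigmoid_piece:
  assumes j: "j \<in> {0, 1}" and E: "\<And>\<zeta>. (E has_field_derivative E' \<zeta>) (at \<zeta>)"
    and dom: "sigmoid_dominated E B" "sigmoid_dominated E' B"
  shows "cmod (of_real (sigmoid j t) * E (of_real t)) \<le> 2 * B * exp ((j - \<theta>) * t / p)"
    "cmod (of_real (sigmoid_deriv j t) * E (of_real t) + of_real (sigmoid j t) * E' (of_real t))
      \<le> 2 * B * exp ((j - \<theta>) * t / p)"
proof -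
  let ?b = "B * exp ((j - \<theta>) * t / p)"
  have 1: "sigmoid j t * cmod (E (of_real t)) \<le> ?b" "sigmoid j t * cmod (E' (of_real t)) \<le> ?b"
    using dom j unfolding sigmoid_dominated_def by blast+
  have "0 \<le> sigmoid j t * cmod (E (of_real t))" using sigmoid_pos[of j t] by simp
  moreover have "cmod (of_real (sigmoid j t) * E (of_real t)) = sigmoid j t * cmod (E (of_real t))"
    using sigmoid_pos[of j t] by (simp add: norm_mult)
  ultimately show "cmod (of_real (sigmoid j t) * E (of_real t)) \<le> 2 * B * exp ((j - \<theta>) * t / p)"
    using 1(1) by linarith
  have "cmod (of_real (sigmoid_deriv j t) * E (of_real t) + of_real (sigmoid j t) * E' (of_real t))
     \<le> \<bar>sigmoid_deriv j t\<bar> * cmod (E (of_real t)) + sigmoid j t * cmod (E' (of_real t))"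
    using norm_triangle_ineq[of "of_real (sigmoid_deriv j t) * E (of_real t)" "of_real (sigmoid j t) * E' (of_real t)"]
      sigmoid_pos[of j t] by (simp add: norm_mult)
  also have "\<dots> \<le> sigmoid j t * cmod (E (of_real t)) + sigmoid j t * cmod (E' (of_real t))"
    using sigmoid_deriv_bound[OF j] by (intro add_right_mono mult_right_mono) auto
  also have "\<dots> \<le> 2 * B * exp ((j - \<theta>) * t / p)" using 1 by simp
  finally show "cmod (of_real (sigmoid_deriv j t) * E (of_real t) + of_real (sigmoid j t) * E' (of_real t))
      \<le> 2 * B * exp ((j - \<theta>) * t / p)" .
qed

text \<open>The partition of unity supplies an explicit decomposition. The constant 4 counts two
  pieces, each with the factor 2 of \<open>sigmoid_piece\<close>.\<close>

lemma entire_product_in_Sum: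
  assumes E: "\<And>\<zeta>. (E has_field_derivative E' \<zeta>) (at \<zeta>)" and B: "0 \<le> B"
    and dom: "sigmoid_dominated E B" "sigmoid_dominated E' B" and \<phi>: "\<phi> \<in> fcarrier (A \<theta>)"
  shows "(\<lambda>x. E (of_real (\<gamma> x)) * \<phi> x) \<in> fcarrier Sum"
    "fnorm Sum (\<lambda>x. E (of_real (\<gamma> x)) * \<phi> x) \<le> 4 * multiplier_const * B * fnorm (A \<theta>) \<phi>"
proof -
  let ?h = "\<lambda>j t. of_real (sigmoid j t) * E (of_real t)"
  have s: "\<theta> \<in> {0..1}" using \<theta> by auto
  have B2: "0 \<le> 2 * B" using B by simp
  have in_A: "(\<lambda>x. ?h j (\<gamma> x) * \<phi> x) \<in> fcarrier (A j)" and
    nrm: "fnorm (A j) (\<lambda>x. ?h j (\<gamma> x) * \<phi> x) \<le> multiplier_const * (2 * B) * fnorm (A \<theta>) \<phi>"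
    if j: "j \<in> {0, 1}" for j
  proof -
    have j': "j \<in> {0..1}" using j by auto
    show "(\<lambda>x. ?h j (\<gamma> x) * \<phi> x) \<in> fcarrier (A j)"
      by (rule A_multiplier[OF s j' B2 sigmoid_mult[OF E] sigmoid_piece[OF j E dom] \<phi>])
    show "fnorm (A j) (\<lambda>x. ?h j (\<gamma> x) * \<phi> x) \<le> multiplier_const * (2 * B) * fnorm (A \<theta>) \<phi>"
      unfolding A_norm
      by (rule multiplier(2)[OF s j' B2 sigmoid_mult[OF E] sigmoid_piece[OF j E dom] A_sub[OF \<phi>]])
  qed
  have eq: "(\<lambda>x. E (of_real (\<gamma> x)) * \<phi> x) = (\<lambda>x. ?h 0 (\<gamma> x) * \<phi> x + ?h 1 (\<gamma> x) * \<phi> x)"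
    using sigmoid_sum by (simp add: distrib_right[symmetric] of_real_add[symmetric] del: of_real_add)
  note S = SumI[OF in_A in_A eq]
  show "(\<lambda>x. E (of_real (\<gamma> x)) * \<phi> x) \<in> fcarrier Sum" by (rule S) auto
  have "fnorm Sum (\<lambda>x. E (of_real (\<gamma> x)) * \<phi> x) \<le>
      fnorm (A 0) (\<lambda>x. ?h 0 (\<gamma> x) * \<phi> x) + fnorm (A 1) (\<lambda>x. ?h 1 (\<gamma> x) * \<phi> x)"
    by (rule S) auto
  then show "fnorm Sum (\<lambda>x. E (of_real (\<gamma> x)) * \<phi> x) \<le> 4 * multiplier_const * B * fnorm (A \<theta>) \<phi>"
    using nrm[of 0] nrm[of 1] by simp
qed

text \<open>Both pieces of the decomposition tend to 0 by dominated convergence, and their norms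
  bound the infimum defining the norm of the sum.\<close>

lemma entire_product_tendsto:
  fixes E E' :: "nat \<Rightarrow> complex \<Rightarrow> complex"
  assumes E: "\<And>n \<zeta>. (E n has_field_derivative E' n \<zeta>) (at \<zeta>)" and B: "0 \<le> B"
    and dom: "\<And>n. sigmoid_dominated (E n) B" "\<And>n. sigmoid_dominated (E' n) B" and \<phi>: "\<phi> \<in> fcarrier (A \<theta>)"
    and lim: "\<And>t. (\<lambda>n. E n (of_real t)) \<longlonglongrightarrow> 0" "\<And>t. (\<lambda>n. E' n (of_real t)) \<longlonglongrightarrow> 0"
  shows "(\<lambda>n. fnorm Sum (\<lambda>x. E n (of_real (\<gamma> x)) * \<phi> x)) \<longlonglongrightarrow> 0"
proof -
  let ?h = "\<lambda>n j t. of_real (sigmoid j t) * E n (of_real t)"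
  have s: "\<theta> \<in> {0..1}" using \<theta> by auto
  have B2: "0 \<le> 2 * B" using B by simp
  have in_A: "(\<lambda>x. ?h n j (\<gamma> x) * \<phi> x) \<in> fcarrier (A j)" if j: "j \<in> {0, 1}" for n j
    using j by (intro A_multiplier[OF s _ B2 sigmoid_mult[OF E] sigmoid_piece[OF j E dom] \<phi>]) auto
  have t: "(\<lambda>n. fnorm (A j) (\<lambda>x. ?h n j (\<gamma> x) * \<phi> x)) \<longlonglongrightarrow> 0" if j: "j \<in> {0, 1}" for j
    unfolding A_norm
  proof (rule multiplier_tendsto[OF s _ B2 sigmoid_mult[OF E] sigmoid_piece[OF j E dom] _ _ A_sub[OF \<phi>]])
    show "j \<in> {0..1}" using j by auto
    show "(\<lambda>n. ?h n j t) \<longlonglongrightarrow> 0" for t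
      using tendsto_mult[OF tendsto_const lim(1)] by simp
    show "(\<lambda>n. of_real (sigmoid_deriv j t) * E n (of_real t) + of_real (sigmoid j t) * E' n (of_real t)) \<longlonglongrightarrow> 0" for t
      using tendsto_add[OF tendsto_mult[OF tendsto_const lim(1)] tendsto_mult[OF tendsto_const lim(2)]] by simp
  qed
  have eq: "(\<lambda>x. E n (of_real (\<gamma> x)) * \<phi> x) = (\<lambda>x. ?h n 0 (\<gamma> x) * \<phi> x + ?h n 1 (\<gamma> x) * \<phi> x)" for n
    using sigmoid_sum by (simp add: distrib_right[symmetric] of_real_add[symmetric] del: of_real_add)
  note S = SumI[OF in_A in_A eq]
  have "(\<lambda>n. fnorm (A 0) (\<lambda>x. ?h n 0 (\<gamma> x) * \<phi> x) + fnorm (A 1) (\<lambda>x. ?h n 1 (\<gamma> x) * \<phi> x)) \<longlonglongrightarrow> 0 + 0"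
    by (intro tendsto_add t) auto
  then have "(\<lambda>n. fnorm (A 0) (\<lambda>x. ?h n 0 (\<gamma> x) * \<phi> x) + fnorm (A 1) (\<lambda>x. ?h n 1 (\<gamma> x) * \<phi> x)) \<longlonglongrightarrow> 0" by simp
  then show ?thesis
  proof (rule tendsto_sandwich[OF _ _ tendsto_const, rotated 2])
    show "\<forall>\<^sub>F n in sequentially. 0 \<le> fnorm Sum (\<lambda>x. E n (of_real (\<gamma> x)) * \<phi> x)"
      by (intro always_eventually allI Sum_norm_nonneg S) auto
    show "\<forall>\<^sub>F n in sequentially. fnorm Sum (\<lambda>x. E n (of_real (\<gamma> x)) * \<phi> x) \<le>
       fnorm (A 0) (\<lambda>x. ?h n 0 (\<gamma> x) * \<phi> x) + fnorm (A 1) (\<lambda>x. ?h n 1 (\<gamma> x) * \<phi> x)"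
      by (intro always_eventually allI S) auto
  qed
qed

end

section \<open>The Gaussian family of multipliers as an element of Calderon's space\<close>

context interpolation_scale
begin

text \<open>The multiplier as a function of the strip variable w and of a complexified value \<zeta>
  of \<gamma>; it is 1 at w = \<theta>. In the names that follow, a prime denotes the derivative in
  \<zeta> and the prefix d the derivative in w, so \<open>dext'\<close> is the mixed one.\<close>

definition ext :: "complex \<Rightarrow> complex \<Rightarrow> complex" where
  "ext w \<zeta> = exp (w\<^sup>2 - of_real (\<theta>\<^sup>2) + (w - of_real \<theta>) * \<zeta> / of_real p)"

definition ext' :: "complex \<Rightarrow> complex \<Rightarrow> complex" where
  "ext' w \<zeta> = (w - of_real \<theta>) / of_real p * ext w \<zeta>"

definition dext :: "complex \<Rightarrow> complex \<Rightarrow> complex" where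
  "dext w \<zeta> = (2 * w + \<zeta> / of_real p) * ext w \<zeta>"

definition dext' :: "complex \<Rightarrow> complex \<Rightarrow> complex" where
  "dext' w \<zeta> = 1 / of_real p * ext w \<zeta> + (w - of_real \<theta>) / of_real p * dext w \<zeta>"

lemma p_nonzero: "complex_of_real p \<noteq> 0"
  using p by simp

lemma ext_deriv: "(ext w has_field_derivative ext' w \<zeta>) (at \<zeta>)"
  unfolding ext_def[abs_def] ext'_def using p_nonzero
  by (auto intro!: derivative_eq_intros)

lemma dext_deriv: "(dext w has_field_derivative dext' w \<zeta>) (at \<zeta>)"
  unfolding dext_def[abs_def] dext'_def using p_nonzero
  by (auto intro!: derivative_eq_intros ext_deriv simp: dext_def ext'_def divide_inverse algebra_simps)

lemma ext_param_deriv: "((\<lambda>w. ext w \<zeta>) has_field_derivative dext w \<zeta>) (at w)"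
  unfolding ext_def[abs_def] dext_def using p_nonzero
  by (auto intro!: derivative_eq_intros simp: field_simps)

lemma ext'_param_deriv: "((\<lambda>w. ext' w \<zeta>) has_field_derivative dext' w \<zeta>) (at w)"
  unfolding ext'_def[abs_def] dext'_def using p_nonzero
  by (auto intro!: derivative_eq_intros ext_param_deriv simp: divide_inverse algebra_simps)

text \<open>On the strip exp ((Re w)^2 - \<theta>^2) is at most e, and (1 + |y|) exp (-y^2) is at
  most 2.\<close>

definition ext_const :: real where "ext_const = 2 * exp 1"

lemma ext_const_pos: "0 < ext_const"
  by (simp add: ext_const_def)

lemma ext_bound:
  assumes "w \<in> strip"
  shows "cmod (ext w (of_real t)) \<le> ext_const * exp ((Re w - \<theta>) * t / p)"
    "cmod (ext' w (of_real t)) \<le> ext_const * exp ((Re w - \<theta>) * t / p)"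
proof -
  let ?x = "Re w" and ?y = "Im w"
  have x: "0 \<le> ?x" "?x \<le> 1" using assms by (auto simp: strip_def)
  have e: "cmod (ext w (of_real t)) = exp (?x\<^sup>2 - ?y\<^sup>2 - \<theta>\<^sup>2) * exp ((?x - \<theta>) * t / p)"
    unfolding ext_def norm_exp_eq_Re by (simp add: exp_add[symmetric] power2_eq_square)
  have x2: "?x\<^sup>2 \<le> 1" using x by (simp add: power_le_one)
  have "1 + ?y\<^sup>2 \<le> exp (?y\<^sup>2)" by (rule exp_ge_add_one_self)
  \<comment> \<open>The factor 1 + |Im w| anticipates the bound of (w - \<theta>) / p in
    \<open>ext'\<close>; this is the linear growth that the Gaussian has to absorb.\<close>
  have y: "(1 + \<bar>?y\<bar>) * exp (- (?y\<^sup>2)) \<le> 2"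
  proof -
    have "2 * \<bar>?y\<bar> \<le> 1 + ?y\<^sup>2" using zero_le_power2[of "1 - \<bar>?y\<bar>"] by (simp add: power2_eq_square algebra_simps)
    then have "1 + \<bar>?y\<bar> \<le> 2 * (1 + ?y\<^sup>2)" using zero_le_power2[of ?y] by (smt (verit))
    also have "\<dots> \<le> 2 * exp (?y\<^sup>2)" using \<open>1 + ?y\<^sup>2 \<le> exp (?y\<^sup>2)\<close> by (rule mult_left_mono) simp
    finally show ?thesis by (simp add: exp_minus divide_simps mult.commute)
  qed
  have "exp (?x\<^sup>2 - ?y\<^sup>2 - \<theta>\<^sup>2) \<le> exp (1 + - (?y\<^sup>2))"
    unfolding exp_le_cancel_iff using x2 zero_le_power2[of \<theta>] by linarith
  also have "\<dots> = exp 1 * exp (- (?y\<^sup>2))" by (rule exp_add)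
  finally have E: "exp (?x\<^sup>2 - ?y\<^sup>2 - \<theta>\<^sup>2) \<le> exp 1 * exp (- (?y\<^sup>2))" .
  have b: "(1 + \<bar>?y\<bar>) * exp (?x\<^sup>2 - ?y\<^sup>2 - \<theta>\<^sup>2) \<le> ext_const"
  proof -
    have "(1 + \<bar>?y\<bar>) * exp (?x\<^sup>2 - ?y\<^sup>2 - \<theta>\<^sup>2) \<le> (1 + \<bar>?y\<bar>) * (exp 1 * exp (- (?y\<^sup>2)))"
      using E by (intro mult_left_mono) auto
    also have "\<dots> = exp 1 * ((1 + \<bar>?y\<bar>) * exp (- (?y\<^sup>2)))" by simp
    also have "\<dots> \<le> exp 1 * 2" using y by (intro mult_left_mono) auto
    finally show ?thesis by (simp add: ext_const_def)
  qed
  have e0: "0 \<le> exp (?x\<^sup>2 - ?y\<^sup>2 - \<theta>\<^sup>2)" by simp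
  then have "1 * exp (?x\<^sup>2 - ?y\<^sup>2 - \<theta>\<^sup>2) \<le> (1 + \<bar>?y\<bar>) * exp (?x\<^sup>2 - ?y\<^sup>2 - \<theta>\<^sup>2)"
    by (intro mult_right_mono) auto
  with b have "exp (?x\<^sup>2 - ?y\<^sup>2 - \<theta>\<^sup>2) \<le> ext_const" by linarith
  then show "cmod (ext w (of_real t)) \<le> ext_const * exp ((Re w - \<theta>) * t / p)"
    unfolding e by (intro mult_right_mono) auto
  have "cmod ((w - of_real \<theta>) / of_real p) \<le> 1 + \<bar>?y\<bar>"
  proof -
    have "cmod ((w - of_real \<theta>) / of_real p) \<le> cmod (w - of_real \<theta>)"
      using p by (simp add: norm_divide divide_le_eq mult_left_mono[of 1 p, simplified])
    also have "\<dots> \<le> \<bar>?x - \<theta>\<bar> + \<bar>?y\<bar>" using cmod_le[of "w - of_real \<theta>"] by simp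
    also have "\<dots> \<le> 1 + \<bar>?y\<bar>" using x \<theta> by auto
    finally show ?thesis .
  qed
  then have "cmod (ext' w (of_real t)) \<le> (1 + \<bar>?y\<bar>) * (exp (?x\<^sup>2 - ?y\<^sup>2 - \<theta>\<^sup>2) * exp ((?x - \<theta>) * t / p))"
    unfolding ext'_def norm_mult e by (rule mult_right_mono) simp
  also have "\<dots> \<le> ext_const * exp ((?x - \<theta>) * t / p)"
    unfolding mult.assoc[symmetric] using b by (intro mult_right_mono) auto
  finally show "cmod (ext' w (of_real t)) \<le> ext_const * exp ((Re w - \<theta>) * t / p)" .
qed

text \<open>Dividing by the right-hand side removes \<theta> and leaves exp ((x - j) t / p) \<le> 1
  + exp ((1 - 2 j) t). This is \<open>exp_convex_bound\<close> with the exponent |x - j| / p in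
  [0,1], applied to t or to -t.\<close>

lemma sigmoid_exp:
  assumes x: "0 \<le> x" "x \<le> 1" and j: "j \<in> {0, 1}"
  shows "sigmoid j t * exp ((x - \<theta>) * t / p) \<le> exp ((j - \<theta>) * t / p)"
proof -
  have "exp ((x - j) * t / p) \<le> 1 + exp ((1 - 2 * j) * t)"
  proof (cases "j = 0")
    case True
    have "x / p \<le> 1" using x p by (simp add: divide_le_eq)
    then show ?thesis using exp_convex_bound[of "x / p" t] x p True by simp
  next
    case False
    then have j: "j = 1" using j by auto
    have "(1 - x) / p \<le> 1" using x p by (simp add: divide_le_eq)
    have "exp ((1 - x) / p * (- t)) \<le> 1 + exp (- t)"
      using \<open>(1 - x) / p \<le> 1\<close> x p by (intro exp_convex_bound) auto
    moreover have "(1 - x) / p * (- t) = (x - j) * t / p" using j p by (simp add: field_simps)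
    ultimately show ?thesis using j by simp
  qed
  moreover have "0 < 1 + exp ((1 - 2 * j) * t)" by (simp add: add_pos_pos)
  ultimately have "sigmoid j t * exp ((x - j) * t / p) \<le> 1" by (simp add: sigmoid_def)
  then have "sigmoid j t * exp ((x - j) * t / p) * exp ((j - \<theta>) * t / p) \<le> exp ((j - \<theta>) * t / p)"
    by (intro mult_left_le_one_le) (use sigmoid_pos[of j t] in auto)
  then show ?thesis by (simp add: mult.assoc exp_add[symmetric] add_divide_distrib[symmetric] algebra_simps)
qed

lemma sigmoid_dominatedI:
  assumes "0 \<le> x" "x \<le> 1" "0 \<le> B" "\<And>t. cmod (E (of_real t)) \<le> B * exp ((x - \<theta>) * t / p)"
  shows "sigmoid_dominated E B"
  unfolding sigmoid_dominated_def
proof (intro ballI allI)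
  fix j :: real and t assume j: "j \<in> {0, 1}"
  have "sigmoid j t * cmod (E (of_real t)) \<le> sigmoid j t * (B * exp ((x - \<theta>) * t / p))"
    using assms(4) sigmoid_pos[of j t] by (intro mult_left_mono) auto
  also have "\<dots> = B * (sigmoid j t * exp ((x - \<theta>) * t / p))" by simp
  also have "\<dots> \<le> B * exp ((j - \<theta>) * t / p)"
    using sigmoid_exp[OF assms(1,2) j] assms(3) by (rule mult_left_mono)
  finally show "sigmoid j t * cmod (E (of_real t)) \<le> B * exp ((j - \<theta>) * t / p)" .
qed

lemma ext_dominated:
  assumes "w \<in> strip"
  shows "sigmoid_dominated (ext w) ext_const" "sigmoid_dominated (ext' w) ext_const"
  using assms ext_const_pos ext_bound[OF assms]
  by (auto intro!: sigmoid_dominatedI[of "Re w"] simp: strip_def)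

lemma sigmoid_dominated_diff:
  assumes "sigmoid_dominated E B" "sigmoid_dominated F C"
  shows "sigmoid_dominated (\<lambda>\<zeta>. E \<zeta> - F \<zeta>) (B + C)"
  unfolding sigmoid_dominated_def
proof (intro ballI allI)
  fix j :: real and t assume j: "j \<in> {0, 1}"
  have "sigmoid j t * cmod (E (of_real t) - F (of_real t)) \<le> sigmoid j t * (cmod (E (of_real t)) + cmod (F (of_real t)))"
    using norm_triangle_ineq4 sigmoid_pos[of j t] by (intro mult_left_mono) auto
  also have "\<dots> = sigmoid j t * cmod (E (of_real t)) + sigmoid j t * cmod (F (of_real t))" by (rule distrib_left)
  also have "\<dots> \<le> B * exp ((j - \<theta>) * t / p) + C * exp ((j - \<theta>) * t / p)"
    using assms j unfolding sigmoid_dominated_def by (intro add_mono) blast+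
  finally show "sigmoid j t * cmod (E (of_real t) - F (of_real t)) \<le> (B + C) * exp ((j - \<theta>) * t / p)"
    by (simp add: distrib_right)
qed

text \<open>Cauchy's estimates, applied for each fixed argument to the holomorphic dependence on the parameter.\<close>

lemma param_remainder_dominated:
  assumes hol: "\<And>\<zeta> w. ((\<lambda>w. E w \<zeta>) has_field_derivative D w \<zeta>) (at w)"
    and dom: "\<And>w. w \<in> strip \<Longrightarrow> sigmoid_dominated (E w) C"
    and r: "0 < r" "cball z r \<subseteq> strip"
  shows "sigmoid_dominated (D z) (C / r)"
    "w \<in> ball z (r / 2) \<Longrightarrow> w \<noteq> z \<Longrightarrow>
      sigmoid_dominated (\<lambda>\<zeta>. (E w \<zeta> - E z \<zeta>) / (w - z) - D z \<zeta>) (8 * C / r\<^sup>2 * cmod (w - z))"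
proof -
  have h: "(\<lambda>w. E w \<zeta>) holomorphic_on UNIV" and d: "deriv (\<lambda>w. E w \<zeta>) z = D z \<zeta>" for \<zeta>
    using hol by (auto simp: holomorphic_on_def field_differentiable_def intro: DERIV_imp_deriv)
  have b: "cmod (E \<zeta> (of_real t)) \<le> C * exp ((j - \<theta>) * t / p) / sigmoid j t"
    if "j \<in> {0, 1}" "\<zeta> \<in> cball z r" for j t \<zeta>
  proof -
    have "sigmoid j t * cmod (E \<zeta> (of_real t)) \<le> C * exp ((j - \<theta>) * t / p)"
      using dom[of \<zeta>] r(2) that unfolding sigmoid_dominated_def by blast
    then show ?thesis by (simp add: pos_le_divide_eq[OF sigmoid_pos] mult.commute)
  qed
  note c = cauchy_remainder[where z=z and r=r, OF h r(1) b, unfolded d]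
  show "sigmoid_dominated (D z) (C / r)"
    unfolding sigmoid_dominated_def
  proof (intro ballI allI)
    fix j :: real and t assume j: "j \<in> {0, 1}"
    have "sigmoid j t * cmod (D z (of_real t)) \<le> sigmoid j t * (C * exp ((j - \<theta>) * t / p) / sigmoid j t / r)"
      using c(1)[OF j] sigmoid_pos[of j t] by (intro mult_left_mono) auto
    also have "\<dots> = C / r * exp ((j - \<theta>) * t / p)" using sigmoid_pos[of j t] by simp
    finally show "sigmoid j t * cmod (D z (of_real t)) \<le> C / r * exp ((j - \<theta>) * t / p)" .
  qed
  assume w: "w \<in> ball z (r / 2)" "w \<noteq> z"
  show "sigmoid_dominated (\<lambda>\<zeta>. (E w \<zeta> - E z \<zeta>) / (w - z) - D z \<zeta>) (8 * C / r\<^sup>2 * cmod (w - z))"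
    unfolding sigmoid_dominated_def
  proof (intro ballI allI)
    fix j :: real and t assume j: "j \<in> {0, 1}"
    have "sigmoid j t * cmod ((E w (of_real t) - E z (of_real t)) / (w - z) - D z (of_real t)) \<le>
       sigmoid j t * (8 * (C * exp ((j - \<theta>) * t / p) / sigmoid j t) / r\<^sup>2 * cmod (w - z))"
      using c(2)[OF j _ w] sigmoid_pos[of j t] by (intro mult_left_mono) auto
    also have "\<dots> = 8 * C / r\<^sup>2 * cmod (w - z) * exp ((j - \<theta>) * t / p)" using sigmoid_pos[of j t] by simp
    finally show "sigmoid j t * cmod ((E w (of_real t) - E z (of_real t)) / (w - z) - D z (of_real t)) \<le>
       8 * C / r\<^sup>2 * cmod (w - z) * exp ((j - \<theta>) * t / p)" .
  qed
qed

lemma extension_in_calderon_F: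
  assumes \<phi>: "\<phi> \<in> fcarrier (A \<theta>)"
  defines "f \<equiv> (\<lambda>w x. ext w (of_real (\<gamma> x)) * \<phi> x)"
  shows "f \<in> calderon_F (A 0) (A 1)" "f (of_real \<theta>) = \<phi>"
    "calderon_norm (A 0) (A 1) f \<le> multiplier_const * ext_const * fnorm (A \<theta>) \<phi>"
proof -
  have s: "\<theta> \<in> {0..1}" using \<theta> by auto
  have C0: "0 \<le> ext_const" using ext_const_pos by simp
  note in_Sum = entire_product_in_Sum[OF ext_deriv C0 ext_dominated \<phi>]
  have 1: "bounded_continuous_into Sum strip f"
    unfolding bounded_continuous_into_def
  proof (intro conjI ballI)
    show "f w \<in> fcarrier Sum" if "w \<in> strip" for w using in_Sum(1)[OF that that] by (simp add: f_def)
    show "\<exists>B. \<forall>s\<in>strip. fnorm Sum (f s) \<le> B"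
      unfolding f_def using in_Sum(2) by blast
    fix w assume w: "w \<in> strip"
    \<comment> \<open>The point w may lie on the boundary of the strip, where no disc is available
      for Cauchy's estimates. Continuity is therefore derived along sequences by dominated
      convergence.\<close>
    show "((\<lambda>w'. fnorm Sum (\<lambda>x. f w' x - f w x)) \<longlongrightarrow> 0) (at w within strip)"
      unfolding tendsto_at_iff_sequentially
    proof (intro allI impI)
      fix X :: "nat \<Rightarrow> complex" assume X: "\<forall>i. X i \<in> strip - {w}" "X \<longlonglongrightarrow> w"
      have d: "sigmoid_dominated (\<lambda>\<zeta>. ext (X n) \<zeta> - ext w \<zeta>) (ext_const + ext_const)"
        "sigmoid_dominated (\<lambda>\<zeta>. ext' (X n) \<zeta> - ext' w \<zeta>) (ext_const + ext_const)" for n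
        using X(1) w by (intro sigmoid_dominated_diff ext_dominated; blast)+
      have "(\<lambda>n. fnorm Sum (\<lambda>x. (ext (X n) (of_real (\<gamma> x)) - ext w (of_real (\<gamma> x))) * \<phi> x)) \<longlonglongrightarrow> 0"
      proof (rule entire_product_tendsto[OF _ _ d \<phi>])
        show "((\<lambda>\<zeta>. ext (X n) \<zeta> - ext w \<zeta>) has_field_derivative ext' (X n) \<zeta> - ext' w \<zeta>) (at \<zeta>)" for n \<zeta>
          by (intro derivative_intros ext_deriv)
        show "(\<lambda>n. ext (X n) (of_real t) - ext w (of_real t)) \<longlonglongrightarrow> 0" for t
          using isCont_tendsto_compose[OF DERIV_isCont[OF ext_param_deriv] X(2)] by (simp add: LIM_zero)
        show "(\<lambda>n. ext' (X n) (of_real t) - ext' w (of_real t)) \<longlonglongrightarrow> 0" for t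
          using isCont_tendsto_compose[OF DERIV_isCont[OF ext'_param_deriv] X(2)] by (simp add: LIM_zero)
      qed (use C0 in auto)
      then show "((\<lambda>w'. fnorm Sum (\<lambda>x. f w' x - f w x)) \<circ> X) \<longlonglongrightarrow> 0"
        by (simp add: f_def o_def left_diff_distrib)
    qed
  qed
  \<comment> \<open>In the interior a disc of radius r fits into the strip, and the remainder of the
    difference quotient is O(|w - z|) in the norm of the sum; the derivative is the product with
    \<open>dext z\<close>.\<close>
  have 2: "analytic_into Sum (interior strip) f"
    unfolding analytic_into_def
  proof
    fix z assume z: "z \<in> interior strip"
    then obtain r where r: "0 < r" "cball z r \<subseteq> interior strip"
      using open_contains_cball[of "interior strip"] by auto
    then have rs: "cball z r \<subseteq> strip" using interior_subset by blast
    note R = param_remainder_dominated[OF ext_param_deriv ext_dominated(1) r(1) rs]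
    note R' = param_remainder_dominated[OF ext'_param_deriv ext_dominated(2) r(1) rs]
    define D where "D x = dext z (of_real (\<gamma> x)) * \<phi> x" for x
    have D: "D \<in> fcarrier Sum"
      unfolding D_def[abs_def]
      by (rule entire_product_in_Sum(1)[OF dext_deriv _ R(1) R'(1) \<phi>]) (use C0 r in auto)
    have "((\<lambda>w. fnorm Sum (\<lambda>x. (f w x - f z x) / (w - z) - D x)) \<longlongrightarrow> 0) (at z)"
    proof (rule Lim_null_comparison)
      let ?Q = "4 * multiplier_const * (8 * ext_const / r\<^sup>2) * fnorm (A \<theta>) \<phi>"
      have "((\<lambda>w. ?Q * cmod (w - z)) \<longlongrightarrow> ?Q * cmod (z - z)) (at z)" by (intro tendsto_intros)
      then show "((\<lambda>w. ?Q * cmod (w - z)) \<longlongrightarrow> 0) (at z)" by simp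
      have "\<forall>\<^sub>F w in at z. w \<in> ball z (r / 2) \<and> w \<noteq> z"
        using r(1) by (auto simp: eventually_at_filter intro!: eventually_nhds_in_open[THEN eventually_mono, of "ball z (r/2)"])
      then show "\<forall>\<^sub>F w in at z. norm (fnorm Sum (\<lambda>x. (f w x - f z x) / (w - z) - D x)) \<le> ?Q * cmod (w - z)"
      proof eventually_elim
        case (elim w)
        have eq: "(\<lambda>x. (f w x - f z x) / (w - z) - D x) =
          (\<lambda>x. ((ext w (of_real (\<gamma> x)) - ext z (of_real (\<gamma> x))) / (w - z) - dext z (of_real (\<gamma> x))) * \<phi> x)"
          by (auto simp: f_def D_def algebra_simps diff_divide_distrib)
        have dd: "((\<lambda>\<zeta>. (ext w \<zeta> - ext z \<zeta>) / (w - z) - dext z \<zeta>) has_field_derivative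
           (ext' w \<zeta> - ext' z \<zeta>) / (w - z) - dext' z \<zeta>) (at \<zeta>)" for \<zeta>
          by (intro derivative_intros ext_deriv dext_deriv DERIV_cdivide)
        have B0: "0 \<le> 8 * ext_const / r\<^sup>2 * cmod (w - z)" using C0 by simp
        have w: "w \<in> ball z (r / 2)" "w \<noteq> z" using elim by auto
        note S = entire_product_in_Sum[OF dd B0 R(2)[OF _ w] R'(2)[OF _ w] \<phi>]
        have "fnorm Sum (\<lambda>x. (f w x - f z x) / (w - z) - D x) \<le> 4 * multiplier_const * (8 * ext_const / r\<^sup>2 * cmod (w - z)) * fnorm (A \<theta>) \<phi>"
          unfolding eq by (rule S(2))
        moreover have "0 \<le> fnorm Sum (\<lambda>x. (f w x - f z x) / (w - z) - D x)"
          unfolding eq by (rule Sum_norm_nonneg[OF S(1)])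
        ultimately show ?case by (simp add: mult_ac)
      qed
    qed
    then show "\<exists>D\<in>fcarrier Sum. ((\<lambda>w. fnorm Sum (\<lambda>x. (f w x - f z x) / (w - z) - D x)) \<longlongrightarrow> 0) (at z)"
      using D by blast
  qed
  have strip_j: "Complex j t \<in> strip" if "j \<in> {0, 1}" for j t using that by (auto simp: strip_def)
  have edge: "f (Complex j t) \<in> fcarrier (A j)" "fnorm (A j) (f (Complex j t)) \<le> multiplier_const * ext_const * fnorm (A \<theta>) \<phi>"
    if j: "j \<in> {0, 1}" for j t
  proof -
    have j': "j \<in> {0..1}" using j by auto
    note b = ext_bound[OF strip_j[OF j, of t], unfolded complex.sel]
    show "f (Complex j t) \<in> fcarrier (A j)" unfolding f_def
      by (rule A_multiplier[OF s j' C0 entire_line[OF ext_deriv] b \<phi>])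
    show "fnorm (A j) (f (Complex j t)) \<le> multiplier_const * ext_const * fnorm (A \<theta>) \<phi>"
      unfolding f_def A_norm by (rule multiplier(2)[OF s j' C0 entire_line[OF ext_deriv] b A_sub[OF \<phi>]])
  qed
  have 3: "bounded_continuous_into (A j) UNIV (\<lambda>t::real. f (Complex j t))" if j: "j \<in> {0, 1}" for j
    unfolding bounded_continuous_into_def
  proof (intro conjI ballI)
    show "f (Complex j t) \<in> fcarrier (A j)" for t by (rule edge[OF j])
    show "\<exists>B. \<forall>t\<in>UNIV. fnorm (A j) (f (Complex j t)) \<le> B" using edge(2)[OF j] by blast
    fix t :: real
    show "((\<lambda>t'. fnorm (A j) (\<lambda>x. f (Complex j t') x - f (Complex j t) x)) \<longlongrightarrow> 0) (at t within UNIV)"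
      unfolding tendsto_at_iff_sequentially
    proof (intro allI impI)
      fix X :: "nat \<Rightarrow> real" assume X: "\<forall>i. X i \<in> UNIV - {t}" "X \<longlonglongrightarrow> t"
      then have X': "(\<lambda>n. Complex j (X n)) \<longlonglongrightarrow> Complex j t" by (intro tendsto_Complex tendsto_const)
      have j': "j \<in> {0..1}" using j by auto
      note b = ext_bound[OF strip_j[OF j], unfolded complex.sel]
      let ?E = "\<lambda>n \<zeta>. ext (Complex j (X n)) \<zeta> - ext (Complex j t) \<zeta>"
      let ?E' = "\<lambda>n \<zeta>. ext' (Complex j (X n)) \<zeta> - ext' (Complex j t) \<zeta>"
      have dd: "(?E n has_field_derivative ?E' n \<zeta>) (at \<zeta>)" for n \<zeta>
        by (intro derivative_intros ext_deriv)
      have tri: "cmod (a - b) \<le> 2 * ext_const * e" if "cmod a \<le> ext_const * e" "cmod b \<le> ext_const * e" for a b e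
        using norm_triangle_ineq4[of a b] that by linarith
      have "(\<lambda>n. fnorm (W j) (\<lambda>x. ?E n (of_real (\<gamma> x)) * \<phi> x)) \<longlonglongrightarrow> 0"
      proof (rule multiplier_tendsto[OF s j' _ entire_line[OF dd] _ _ _ _ A_sub[OF \<phi>], of "2 * ext_const"])
        show "cmod (?E n (of_real u)) \<le> 2 * ext_const * exp ((j - \<theta>) * u / p)" for n u
          by (intro tri b)
        show "cmod (?E' n (of_real u)) \<le> 2 * ext_const * exp ((j - \<theta>) * u / p)" for n u
          by (intro tri b)
        show "(\<lambda>n. ?E n (of_real u)) \<longlonglongrightarrow> 0" for u
          using isCont_tendsto_compose[OF DERIV_isCont[OF ext_param_deriv] X'] by (simp add: LIM_zero)
        show "(\<lambda>n. ?E' n (of_real u)) \<longlonglongrightarrow> 0" for u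
          using isCont_tendsto_compose[OF DERIV_isCont[OF ext'_param_deriv] X'] by (simp add: LIM_zero)
      qed (use C0 in auto)
      then show "((\<lambda>t'. fnorm (A j) (\<lambda>x. f (Complex j t') x - f (Complex j t) x)) \<circ> X) \<longlonglongrightarrow> 0"
        by (simp add: f_def o_def left_diff_distrib A_norm)
    qed
  qed
  show "f \<in> calderon_F (A 0) (A 1)" using 1 2 3 by (simp add: calderon_F_def)
  show "f (of_real \<theta>) = \<phi>" by (simp add: f_def ext_def)
  show "calderon_norm (A 0) (A 1) f \<le> multiplier_const * ext_const * fnorm (A \<theta>) \<phi>"
    unfolding calderon_norm_def using edge(2) by (auto intro!: cSUP_least)
qed

end

section \<open>Bounds for elements of the interpolation space\<close>

text \<open>Both edges share one bound, so this is the maximum principle for the strip. The factor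
  exp (e (w^2 - 1)) has modulus at most 1 there and decays as |Im w| grows, which reduces to a
  rectangle; afterwards e tends to 0.\<close>

lemma three_lines:
  assumes hol: "F holomorphic_on interior strip" and cont: "continuous_on strip F"
    and bdd: "\<And>z. z \<in> strip \<Longrightarrow> cmod (F z) \<le> M"
    and edge: "\<And>j t. j \<in> {0, 1} \<Longrightarrow> cmod (F (Complex j t)) \<le> B"
    and B: "0 < B" and z: "z \<in> strip"
  shows "cmod (F z) \<le> B"
proof -
  define G where "G e w = F w * exp (of_real e * (w\<^sup>2 - 1))" for e :: real and w
  have ex: "cmod (exp (of_real e * (w\<^sup>2 - 1))) \<le> exp (- e * (Im w)\<^sup>2)" if "w \<in> strip" "0 < e" for e w
  proof -
    have "(Re w)\<^sup>2 \<le> 1" using that by (auto simp: strip_def power_le_one)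
    then have "(Re w)\<^sup>2 - (Im w)\<^sup>2 - 1 \<le> - ((Im w)\<^sup>2)" by simp
    then have "e * ((Re w)\<^sup>2 - (Im w)\<^sup>2 - 1) \<le> e * (- ((Im w)\<^sup>2))" using that by (intro mult_left_mono) auto
    then show ?thesis by (simp add: norm_exp_eq_Re power2_eq_square)
  qed
  have G_le: "cmod (G e z) \<le> B" if e: "0 < e" for e
  proof -
    \<comment> \<open>Raised to at least 1 so that the logarithm of M' / B is taken of a positive
      number.\<close>
    define M' where "M' = max M 1"
    have M': "M' > 0" "\<And>z. z \<in> strip \<Longrightarrow> cmod (F z) \<le> M'" using bdd by (auto simp: M'_def intro: max.coboundedI1)
    \<comment> \<open>The height both includes z and is large enough for the Gaussian to push the
      global bound \<open>M'\<close> below \<open>B\<close> on the horizontal sides.\<close>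
    define T where "T = max (\<bar>Im z\<bar>) (sqrt (\<bar>ln (M' / B)\<bar> / e))"
    have T: "\<bar>Im z\<bar> \<le> T" "T \<ge> 0" by (auto simp: T_def)
    have T2: "M' * exp (- e * T\<^sup>2) \<le> B"
    proof -
      have "(sqrt (\<bar>ln (M' / B)\<bar> / e))\<^sup>2 \<le> T\<^sup>2" unfolding T_def using e by (intro power_mono) auto
      then have "\<bar>ln (M' / B)\<bar> / e \<le> T\<^sup>2" using e by simp
      then have "ln (M' / B) \<le> e * T\<^sup>2" using e by (simp add: field_simps)
      then have "M' / B \<le> exp (e * T\<^sup>2)" using M'(1) B by (metis divide_pos_pos ln_ge_iff exp_ln exp_le_cancel_iff)
      then show ?thesis using B by (simp add: exp_minus field_simps)
    qed
    let ?S = "cbox (Complex 0 (-T)) (Complex 1 T)"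
    have S: "?S \<subseteq> strip" by (auto simp: strip_def in_cbox_complex_iff)
    have int: "interior ?S \<subseteq> interior strip" using S by (rule interior_mono)
    show ?thesis
    proof (rule maximum_modulus_frontier[where f="G e" and S="?S" and \<xi>=z])
      show "G e holomorphic_on interior ?S"
      proof -
        have "(\<lambda>w. F w * exp (of_real e * (w\<^sup>2 - 1))) holomorphic_on interior ?S"
          by (rule holomorphic_on_mult[OF holomorphic_on_subset[OF hol int]]) (intro holomorphic_intros)
        then show ?thesis by (simp add: G_def[abs_def])
      qed
      show "continuous_on (closure ?S) (G e)"
        unfolding G_def[abs_def] using S by (intro continuous_intros continuous_on_subset[OF cont]) auto
      show "z \<in> ?S" using z T(1) by (auto simp: strip_def in_cbox_complex_iff)
      fix w assume "w \<in> frontier ?S"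
      then have w: "w \<in> ?S" "w \<notin> box (Complex 0 (-T)) (Complex 1 T)" by (auto simp: frontier_cbox)
      then have ws: "w \<in> strip" using S by blast
      have "Re w = 0 \<or> Re w = 1 \<or> \<bar>Im w\<bar> = T"
        using w by (auto simp: in_cbox_complex_iff in_box_complex_iff)
      then consider "Re w = 0 \<or> Re w = 1" | "\<bar>Im w\<bar> = T" by blast
      then show "cmod (G e w) \<le> B"
      proof cases
        case 1
        then have "cmod (F w) \<le> B" using edge[of "Re w" "Im w"] by auto
        moreover have "cmod (exp (of_real e * (w\<^sup>2 - 1))) \<le> 1"
          by (rule order_trans[OF ex[OF ws e]]) (use e in simp)
        ultimately have "cmod (F w) * cmod (exp (of_real e * (w\<^sup>2 - 1))) \<le> B * 1"
          using B by (intro mult_mono) auto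
        then show ?thesis by (simp add: G_def norm_mult)
      next
        case 2
        then have "(Im w)\<^sup>2 = T\<^sup>2" by (metis power2_abs)
        then have "cmod (F w) * cmod (exp (of_real e * (w\<^sup>2 - 1))) \<le> M' * exp (- e * T\<^sup>2)"
          using ex[OF ws e] M'(2)[OF ws] M'(1) by (intro mult_mono) auto
        then show ?thesis using T2 by (simp add: G_def norm_mult)
      qed
    qed auto
  qed
  have "((\<lambda>e. cmod (G e z)) \<longlongrightarrow> cmod (G 0 z)) (at_right 0)"
    unfolding G_def by (intro tendsto_intros)
  then have "cmod (G 0 z) \<le> B"
    by (rule tendsto_upperbound) (auto simp: eventually_at_filter G_le)
  then show ?thesis by (simp add: G_def)
qed

text \<open>Where v exceeds \<tau>, v^(1-p) is at most \<tau>^(1-p) because 1 - p \<le> 0.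
  Integrated over a set of finite measure with \<tau> near the L^p norm of v, the right-hand side
  becomes linear in that norm.\<close>

lemma powr_split_bound:
  fixes v \<tau> :: real
  assumes "0 \<le> v" "0 < \<tau>" "1 \<le> p"
  shows "v \<le> \<tau> + \<tau> powr (1 - p) * v powr p"
proof (cases "v \<le> \<tau>")
  case True
  then show ?thesis by (simp add: add_increasing2)
next
  case False
  then have v: "\<tau> < v" "0 < v" using assms by auto
  have "v = v powr (1 - p) * v powr p" using v by (simp add: powr_add[symmetric])
  also have "\<dots> \<le> \<tau> powr (1 - p) * v powr p"
    using v assms by (intro mult_right_mono powr_mono2') auto
  finally show ?thesis using assms(2) by linarith
qed

text \<open>Replaces Hoelder's inequality in the duality argument, where constants do not matter.\<close>

lemma powr_product_bound:
  fixes a v :: real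
  assumes "0 \<le> a" "0 \<le> v" "1 \<le> p"
  shows "a * v powr (p - 1) \<le> v powr p / 2 + 2 powr (p - 1) * a powr p"
proof (cases "v = 0")
  case True then show ?thesis by simp
next
  case False
  then have v: "0 < v" using assms by simp
  show ?thesis
  proof (cases "2 * a \<le> v")
    case True
    then have "a * v powr (p - 1) \<le> v / 2 * v powr (p - 1)" by (intro mult_right_mono) auto
    also have "\<dots> = v powr p / 2" using v by (simp add: powr_diff)
    finally show ?thesis by (rule order_trans) simp
  next
    case False
    then have a: "0 < a" using v by simp
    have "a * v powr (p - 1) \<le> a * (2 * a) powr (p - 1)"
      using False v a assms by (intro mult_left_mono powr_mono2) auto
    also have "\<dots> = 2 powr (p - 1) * a powr p" using a by (simp add: powr_mult powr_diff)
    finally show ?thesis by (rule order_trans) simp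
  qed
qed

section \<open>Bounded functionals on the sum space\<close>

context interpolation_scale
begin

abbreviation MU :: "(real^'n) measure" where "MU \<equiv> lebesgue_on U"

text \<open>No conjugate is taken, so that the pairing is complex linear in \<phi> and analyticity
  passes through it.\<close>

definition pairing :: "'n option \<Rightarrow> (real^'n \<Rightarrow> complex) \<Rightarrow> (real^'n \<Rightarrow> complex) \<Rightarrow> complex" where
  "pairing k b \<phi> = (LINT x|MU. with_gradient U \<phi> x $ k * b x)"

text \<open>On a set of finite measure where both endpoint weights are bounded below, weighted L^p
  functions are integrable with control by the norm. Bounded functions supported there thus give
  functionals continuous on both endpoint spaces, for every p \<ge> 1.\<close>

definition admissible :: "(real^'n \<Rightarrow> complex) \<Rightarrow> bool" where
  "admissible b \<longleftrightarrow> b \<in> borel_measurable MU \<and> (\<exists>E c \<delta>. E \<in> sets MU \<and> emeasure MU E < \<infinity> \<and> 0 \<le> c \<and> 0 < \<delta> \<and>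
     (\<forall>x. cmod (b x) \<le> c) \<and> (\<forall>x\<in>U. x \<notin> E \<longrightarrow> b x = 0) \<and> (\<forall>x\<in>E. \<delta> \<le> \<omega> 0 x \<and> \<delta> \<le> \<omega> 1 x))"

lemma pairing_bound_W:
  assumes b: "admissible b"
  shows "\<exists>C. 0 \<le> C \<and> (\<forall>j\<in>{0, 1}. \<forall>\<phi>\<in>fcarrier (W j).
    integrable MU (\<lambda>x. with_gradient U \<phi> x $ k * b x) \<and> cmod (pairing k b \<phi>) \<le> C * fnorm (W j) \<phi>)"
proof -
  obtain E c \<delta> where E: "E \<in> sets MU" "emeasure MU E < \<infinity>" and c: "0 \<le> c" "\<And>x. cmod (b x) \<le> c"
    and \<delta>: "0 < \<delta>" and b0: "\<And>x. x \<in> U \<Longrightarrow> x \<notin> E \<Longrightarrow> b x = 0"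
    and \<omega>E: "\<And>x. x \<in> E \<Longrightarrow> \<delta> \<le> \<omega> 0 x \<and> \<delta> \<le> \<omega> 1 x" and bm: "b \<in> borel_measurable MU"
    using b unfolding admissible_def by blast
  \<comment> \<open>The two summands are the integrals of the two terms of
    \<open>powr_split_bound\<close>, after \<tau>^(1-p) \<tau>^p has been simplified to
    \<tau>.\<close>
  define C where "C = c * (measure MU E + 1 / \<delta>)"
  have C0: "0 \<le> C" using c(1) \<delta> by (simp add: C_def)
  show ?thesis
  proof (intro exI[of _ C] conjI[OF C0] ballI)
    fix j :: real and \<phi> assume j: "j \<in> {0, 1}" and \<phi>: "\<phi> \<in> fcarrier (W j)"
    let ?v = "\<lambda>x. with_gradient U \<phi> x $ k" and ?n = "fnorm (W j) \<phi>"
    have vm: "?v \<in> borel_measurable MU" by (intro with_gradient_measurable U W_weakly_differentiable[OF \<phi>])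
    have i1: "integrable MU (indicator E :: _ \<Rightarrow> real)" using E by (intro integrable_real_indicator) auto
    have i2: "integrable MU (\<lambda>x. cmod (?v x) powr p * \<omega> j x)" by (rule W_integrable[OF \<phi>])
    have i3: "integrable MU (\<lambda>x. c * (\<tau> * indicator E x + \<tau> powr (1 - p) / \<delta> * (cmod (?v x) powr p * \<omega> j x)))" for \<tau>
      using i1 i2 by auto
    have dom: "cmod (?v x * b x) \<le> c * (\<tau> * indicator E x + \<tau> powr (1 - p) / \<delta> * (cmod (?v x) powr p * \<omega> j x))"
      if \<tau>: "0 < \<tau>" and x: "x \<in> U" for \<tau> x
    proof (cases "x \<in> E")
      case True
      have "\<delta> \<le> \<omega> j x" using \<omega>E[OF True] j by auto
      then have "1 \<le> \<omega> j x / \<delta>" using \<delta> by simp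
      then have "cmod (?v x) powr p * 1 \<le> cmod (?v x) powr p * (\<omega> j x / \<delta>)" by (intro mult_left_mono) auto
      then have "\<tau> powr (1 - p) * cmod (?v x) powr p \<le> \<tau> powr (1 - p) * (cmod (?v x) powr p * (\<omega> j x / \<delta>))"
        by (intro mult_left_mono) auto
      with powr_split_bound[of "cmod (?v x)" \<tau> p] \<tau> p
      have "cmod (?v x) \<le> \<tau> + \<tau> powr (1 - p) * (cmod (?v x) powr p * (\<omega> j x / \<delta>))" by simp
      then have "cmod (?v x) * cmod (b x) \<le> (\<tau> + \<tau> powr (1 - p) * (cmod (?v x) powr p * (\<omega> j x / \<delta>))) * c"
        using c by (intro mult_mono) (auto intro: order_trans[OF norm_ge_zero])
      then show ?thesis using True by (simp add: norm_mult mult_ac)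
    next
      case False
      then have "b x = 0" using b0 x by blast
      then show ?thesis using \<omega>_pos[OF x, of j] c(1) \<delta> \<tau> by (auto intro!: mult_nonneg_nonneg add_nonneg_nonneg)
    qed
    have i: "integrable MU (\<lambda>x. ?v x * b x)"
    proof (rule Bochner_Integration.integrable_bound[OF i3[of 1]])
      show "(\<lambda>x. ?v x * b x) \<in> borel_measurable MU" using vm bm by (rule borel_measurable_times)
      show "AE x in MU. norm (?v x * b x) \<le> norm (c * (1 * indicator E x + 1 powr (1 - p) / \<delta> * (cmod (?v x) powr p * \<omega> j x)))"
        by (rule AE_I2, unfold real_norm_def, rule order_trans[OF dom abs_ge_self]) auto
    qed
    \<comment> \<open>The parameter \<tau> must be positive whereas the norm may vanish; the bound
      is proved for all \<tau> above the norm, and then \<tau> decreases to it.\<close>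
    have le: "cmod (pairing k b \<phi>) \<le> C * \<tau>" if \<tau>: "?n < \<tau>" for \<tau>
    proof -
      have \<tau>0: "0 < \<tau>" using \<tau> W_norm_nonneg[of j \<phi>] by linarith
      have "cmod (pairing k b \<phi>) \<le> (LINT x|MU. cmod (?v x * b x))" unfolding pairing_def by (rule integral_norm_bound)
      also have "\<dots> \<le> (LINT x|MU. c * (\<tau> * indicator E x + \<tau> powr (1 - p) / \<delta> * (cmod (?v x) powr p * \<omega> j x)))"
        using dom[OF \<tau>0] by (intro integral_mono_AE integrable_norm i i3 AE_I2) auto
      also have "\<dots> = c * (\<tau> * measure MU E + \<tau> powr (1 - p) / \<delta> * (LINT x|MU. cmod (?v x) powr p * \<omega> j x))"
        using i1 i2 E sets.sets_into_space[OF E(1)] by (simp add: Int_absorb2)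
      also have "\<dots> \<le> c * (\<tau> * measure MU E + \<tau> / \<delta>)"
      proof -
        have "(LINT x|MU. cmod (?v x) powr p * \<omega> j x) \<le> energy p U (\<omega> j) \<phi>"
          unfolding energy_def
          by (rule member_le_sum[of k UNIV "\<lambda>k. LINT x|MU. cmod (with_gradient U \<phi> x $ k) powr p * \<omega> j x"])
            (auto intro!: integral_nonneg_AE AE_I2 mult_nonneg_nonneg less_imp_le[OF \<omega>_pos])
        also have "\<dots> = ?n powr p" using W1_norm_powr[of U "\<omega> j" p \<phi>] \<omega>_pos p by simp
        also have "\<dots> \<le> \<tau> powr p" using \<tau> p W_norm_nonneg by (intro powr_mono2) auto
        finally have "\<tau> powr (1 - p) * (LINT x|MU. cmod (?v x) powr p * \<omega> j x) \<le> \<tau> powr (1 - p) * \<tau> powr p"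
          by (intro mult_left_mono) auto
        also have "\<dots> = \<tau>" using \<tau>0 by (simp add: powr_add[symmetric])
        finally have "\<tau> powr (1 - p) * (LINT x|MU. cmod (?v x) powr p * \<omega> j x) / \<delta> \<le> \<tau> / \<delta>"
          using \<delta> by (intro divide_right_mono) auto
        then show ?thesis using c(1) by (intro mult_left_mono add_left_mono) auto
      qed
      also have "\<dots> = C * \<tau>" by (simp add: C_def algebra_simps)
      finally show ?thesis .
    qed
    have "cmod (pairing k b \<phi>) \<le> C * ?n"
    proof (rule tendsto_lowerbound)
      show "((\<lambda>\<tau>. C * \<tau>) \<longlongrightarrow> C * ?n) (at_right ?n)" by (intro tendsto_intros)
      show "\<forall>\<^sub>F \<tau> in at_right ?n. cmod (pairing k b \<phi>) \<le> C * \<tau>"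
        by (auto simp: eventually_at_filter le)
    qed auto
    with i show "integrable MU (\<lambda>x. ?v x * b x) \<and> cmod (pairing k b \<phi>) \<le> C * ?n" by blast
  qed
qed

lemma Sum_weakly_differentiable: "\<phi> \<in> fcarrier Sum \<Longrightarrow> weakly_differentiable U \<phi>"
proof (erule SumE)
  fix a0 a1 assume "a0 \<in> fcarrier (A 0)" "a1 \<in> fcarrier (A 1)" and \<phi>: "\<phi> = (\<lambda>x. a0 x + a1 x)"
  then have "weakly_differentiable U a0" "weakly_differentiable U a1"
    using W_weakly_differentiable A_sub by blast+
  then show "weakly_differentiable U \<phi>" unfolding \<phi> by (rule with_gradient_add(1)[OF U])
qed

lemma pairing_add_integrable:
  assumes b: "admissible b" and wd: "weakly_differentiable U \<phi>" "weakly_differentiable U \<psi>"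
    and i: "integrable MU (\<lambda>x. with_gradient U \<phi> x $ k * b x)" "integrable MU (\<lambda>x. with_gradient U \<psi> x $ k * b x)"
  shows "integrable MU (\<lambda>x. with_gradient U (\<lambda>x. \<phi> x + \<psi> x) x $ k * b x)"
    "pairing k b (\<lambda>x. \<phi> x + \<psi> x) = pairing k b \<phi> + pairing k b \<psi>"
proof -
  note wa = with_gradient_add[OF U wd]
  have m: "(\<lambda>x. with_gradient U (\<lambda>x. \<phi> x + \<psi> x) x $ k * b x) \<in> borel_measurable MU"
    using b by (intro borel_measurable_times with_gradient_measurable U wa) (auto simp: admissible_def)
  have j: "integrable MU (\<lambda>x. with_gradient U \<phi> x $ k * b x + with_gradient U \<psi> x $ k * b x)" using i by simp
  have ae: "AE x in MU. with_gradient U \<phi> x $ k * b x + with_gradient U \<psi> x $ k * b x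
      = with_gradient U (\<lambda>x. \<phi> x + \<psi> x) x $ k * b x"
    using wa(2) by eventually_elim (simp add: distrib_right)
  show "integrable MU (\<lambda>x. with_gradient U (\<lambda>x. \<phi> x + \<psi> x) x $ k * b x)"
    by (rule integrable_cong_AE_imp[OF j m ae])
  show "pairing k b (\<lambda>x. \<phi> x + \<psi> x) = pairing k b \<phi> + pairing k b \<psi>"
    unfolding pairing_def using integral_cong_AE[OF borel_measurable_integrable[OF j] m ae] i by simp
qed

lemma pairing_Sum:
  assumes b: "admissible b"
  shows "\<exists>C. 0 \<le> C \<and> (\<forall>\<phi>\<in>fcarrier Sum.
    integrable MU (\<lambda>x. with_gradient U \<phi> x $ k * b x) \<and> cmod (pairing k b \<phi>) \<le> C * fnorm Sum \<phi>)"
proof -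
  obtain C where C: "0 \<le> C" "\<And>j \<phi>. j \<in> {0, 1} \<Longrightarrow> \<phi> \<in> fcarrier (W j) \<Longrightarrow>
    integrable MU (\<lambda>x. with_gradient U \<phi> x $ k * b x) \<and> cmod (pairing k b \<phi>) \<le> C * fnorm (W j) \<phi>"
    using pairing_bound_W[OF b, of k] by (elim exE conjE) (blast intro: that)
  have *: "integrable MU (\<lambda>x. with_gradient U \<phi> x $ k * b x) \<and> cmod (pairing k b \<phi>) \<le> C * (fnorm (A 0) a0 + fnorm (A 1) a1)"
    if a: "a0 \<in> fcarrier (A 0)" "a1 \<in> fcarrier (A 1)" "\<phi> = (\<lambda>x. a0 x + a1 x)" for \<phi> a0 a1
  proof -
    have w: "a0 \<in> fcarrier (W 0)" "a1 \<in> fcarrier (W 1)" using a A_sub by auto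
    have c: "integrable MU (\<lambda>x. with_gradient U a0 x $ k * b x)" "cmod (pairing k b a0) \<le> C * fnorm (W 0) a0"
      "integrable MU (\<lambda>x. with_gradient U a1 x $ k * b x)" "cmod (pairing k b a1) \<le> C * fnorm (W 1) a1"
      using C(2)[of 0 a0] C(2)[of 1 a1] w by auto
    note s = pairing_add_integrable[OF b W_weakly_differentiable[OF w(1)] W_weakly_differentiable[OF w(2)] c(1,3)]
    have "cmod (pairing k b \<phi>) \<le> cmod (pairing k b a0) + cmod (pairing k b a1)"
      unfolding a(3) s(2) by (rule norm_triangle_ineq)
    also have "\<dots> \<le> C * (fnorm (A 0) a0 + fnorm (A 1) a1)" using c by (simp add: A_norm distrib_left)
    finally show ?thesis using s(1) a(3) by simp
  qed
  \<comment> \<open>C may be 0. One can divide by C + 1, which lets the estimate pass to the infimum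
    over decompositions.\<close>
  show ?thesis
  proof (intro exI[of _ "C + 1"] conjI[OF _ ballI])
    show "0 \<le> C + 1" using C(1) by simp
    fix \<phi> assume \<phi>: "\<phi> \<in> fcarrier Sum"
    have "cmod (pairing k b \<phi>) / (C + 1) \<le> fnorm Sum \<phi>"
    proof (rule Sum_norm_greatest[OF \<phi>])
      fix a0 a1 assume a: "a0 \<in> fcarrier (A 0)" "a1 \<in> fcarrier (A 1)" "\<phi> = (\<lambda>x. a0 x + a1 x)"
      have "0 \<le> fnorm (A 0) a0 + fnorm (A 1) a1" by (intro add_nonneg_nonneg A_norm_nonneg)
      with *[OF a] have "cmod (pairing k b \<phi>) \<le> (C + 1) * (fnorm (A 0) a0 + fnorm (A 1) a1)" by (simp add: distrib_right)
      then show "cmod (pairing k b \<phi>) / (C + 1) \<le> fnorm (A 0) a0 + fnorm (A 1) a1"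
        using C(1) by (simp add: divide_le_eq mult.commute)
    qed
    then have le: "cmod (pairing k b \<phi>) \<le> (C + 1) * fnorm Sum \<phi>" using C(1) by (simp add: divide_le_eq mult.commute)
    obtain a0 a1 where a: "a0 \<in> fcarrier (A 0)" "a1 \<in> fcarrier (A 1)" "\<phi> = (\<lambda>x. a0 x + a1 x)"
      using SumE[OF \<phi>] by blast
    show "integrable MU (\<lambda>x. with_gradient U \<phi> x $ k * b x) \<and> cmod (pairing k b \<phi>) \<le> (C + 1) * fnorm Sum \<phi>"
      using *[OF a] le by blast
  qed
qed

lemma pairing_add:
  assumes "admissible b" "\<phi> \<in> fcarrier Sum" "\<psi> \<in> fcarrier Sum"
  shows "pairing k b (\<lambda>x. \<phi> x + \<psi> x) = pairing k b \<phi> + pairing k b \<psi>"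
proof -
  obtain C where C: "\<And>\<phi>. \<phi> \<in> fcarrier Sum \<Longrightarrow> integrable MU (\<lambda>x. with_gradient U \<phi> x $ k * b x)"
    using pairing_Sum[OF assms(1), of k] by blast
  show ?thesis
    by (rule pairing_add_integrable(2)[OF assms(1) Sum_weakly_differentiable Sum_weakly_differentiable C C])
      (rule assms)+
qed

lemma pairing_cmult:
  assumes b: "admissible b" and \<phi>: "\<phi> \<in> fcarrier Sum"
  shows "pairing k b (\<lambda>x. c * \<phi> x) = c * pairing k b \<phi>"
proof -
  note wc = with_gradient_cmult[OF U Sum_weakly_differentiable[OF \<phi>], of c]
  have ae: "AE x in MU. with_gradient U (\<lambda>x. c * \<phi> x) x $ k * b x = c * (with_gradient U \<phi> x $ k * b x)"
    using wc(2) by eventually_elim simp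
  have bm: "b \<in> borel_measurable MU" using b by (simp add: admissible_def)
  have "(LINT x|MU. with_gradient U (\<lambda>x. c * \<phi> x) x $ k * b x) = (LINT x|MU. c * (with_gradient U \<phi> x $ k * b x))"
    by (intro integral_cong_AE ae borel_measurable_times borel_measurable_const with_gradient_measurable U wc
        Sum_weakly_differentiable[OF \<phi>] bm)
  then show ?thesis by (simp add: pairing_def)
qed

lemma pairing_diff:
  assumes "admissible b" "\<phi> \<in> fcarrier Sum" "\<psi> \<in> fcarrier Sum"
  shows "pairing k b (\<lambda>x. \<phi> x - \<psi> x) = pairing k b \<phi> - pairing k b \<psi>"
  using pairing_add[OF assms(1,2) Sum_cmult[OF assms(3), of "-1"], of k] pairing_cmult[OF assms(1,3), of k "-1"] by simp

text \<open>A bounded linear functional on the sum space turns continuity, boundedness and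
  norm-differentiability of f into those of a scalar function.\<close>

lemma pairing_holomorphic:
  assumes b: "admissible b" and f: "f \<in> calderon_F (A 0) (A 1)"
  shows "(\<lambda>w. pairing k b (f w)) holomorphic_on interior strip"
    "continuous_on strip (\<lambda>w. pairing k b (f w))"
    "\<exists>B. \<forall>w\<in>strip. cmod (pairing k b (f w)) \<le> B"
proof -
  obtain C where C: "0 \<le> C" "\<And>\<phi>. \<phi> \<in> fcarrier Sum \<Longrightarrow> cmod (pairing k b \<phi>) \<le> C * fnorm Sum \<phi>"
    using pairing_Sum[OF b, of k] by blast
  have bc: "\<And>w. w \<in> strip \<Longrightarrow> f w \<in> fcarrier Sum" "\<exists>B. \<forall>w\<in>strip. fnorm Sum (f w) \<le> B"
    "\<And>w. w \<in> strip \<Longrightarrow> ((\<lambda>w'. fnorm Sum (\<lambda>x. f w' x - f w x)) \<longlongrightarrow> 0) (at w within strip)"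
    and an: "analytic_into Sum (interior strip) f"
    using f by (auto simp: calderon_F_def bounded_continuous_into_def)
  obtain B where B: "\<And>w. w \<in> strip \<Longrightarrow> fnorm Sum (f w) \<le> B" using bc(2) by blast
  have "cmod (pairing k b (f w)) \<le> C * B" if "w \<in> strip" for w
    using C(2)[OF bc(1)[OF that]] mult_left_mono[OF B[OF that] C(1)] by linarith
  then show "\<exists>B. \<forall>w\<in>strip. cmod (pairing k b (f w)) \<le> B" by blast
  show "continuous_on strip (\<lambda>w. pairing k b (f w))"
    unfolding continuous_on_def
  proof
    fix w assume w: "w \<in> strip"
    have "((\<lambda>w'. pairing k b (f w') - pairing k b (f w)) \<longlongrightarrow> 0) (at w within strip)"
    proof (rule Lim_null_comparison)
      have "((\<lambda>w'. C * fnorm Sum (\<lambda>x. f w' x - f w x)) \<longlongrightarrow> C * 0) (at w within strip)"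
        by (intro tendsto_intros bc(3) w)
      then show "((\<lambda>w'. C * fnorm Sum (\<lambda>x. f w' x - f w x)) \<longlongrightarrow> 0) (at w within strip)" by simp
      have "norm (pairing k b (f w') - pairing k b (f w)) \<le> C * fnorm Sum (\<lambda>x. f w' x - f w x)" if "w' \<in> strip" for w'
        using C(2)[OF Sum_diff[OF bc(1)[OF that] bc(1)[OF w]]] pairing_diff[OF b bc(1)[OF that] bc(1)[OF w]] by simp
      then show "\<forall>\<^sub>F w' in at w within strip. norm (pairing k b (f w') - pairing k b (f w)) \<le> C * fnorm Sum (\<lambda>x. f w' x - f w x)"
        by (auto simp: eventually_at_filter)
    qed
    then show "((\<lambda>w. pairing k b (f w)) \<longlongrightarrow> pairing k b (f w)) (at w within strip)" by (rule LIM_zero_cancel)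
  qed
  show "(\<lambda>w. pairing k b (f w)) holomorphic_on interior strip"
    unfolding holomorphic_on_open[OF open_interior]
  proof
    fix z assume z: "z \<in> interior strip"
    then have zs: "z \<in> strip" using interior_subset by blast
    obtain D where D: "D \<in> fcarrier Sum"
      "((\<lambda>w. fnorm Sum (\<lambda>x. (f w x - f z x) / (w - z) - D x)) \<longlongrightarrow> 0) (at z)"
      using an z unfolding analytic_into_def by blast
    have "((\<lambda>w. (pairing k b (f w) - pairing k b (f z)) / (w - z) - pairing k b D) \<longlongrightarrow> 0) (at z)"
    proof (rule Lim_null_comparison)
      have "((\<lambda>w. C * fnorm Sum (\<lambda>x. (f w x - f z x) / (w - z) - D x)) \<longlongrightarrow> C * 0) (at z)"
        by (intro tendsto_intros D)
      then show "((\<lambda>w. C * fnorm Sum (\<lambda>x. (f w x - f z x) / (w - z) - D x)) \<longlongrightarrow> 0) (at z)" by simp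
      have "\<forall>\<^sub>F w in at z. w \<in> interior strip"
        using z by (intro eventually_at_in_open') auto
      then show "\<forall>\<^sub>F w in at z. norm ((pairing k b (f w) - pairing k b (f z)) / (w - z) - pairing k b D) \<le>
         C * fnorm Sum (\<lambda>x. (f w x - f z x) / (w - z) - D x)"
      proof eventually_elim
        case (elim w)
        then have ws: "w \<in> strip" using interior_subset by blast
        note d = Sum_diff[OF bc(1)[OF ws] bc(1)[OF zs]]
        note q = Sum_cmult[OF d, of "inverse (w - z)"]
        have "pairing k b (\<lambda>x. inverse (w - z) * (f w x - f z x) - D x) =
          inverse (w - z) * (pairing k b (f w) - pairing k b (f z)) - pairing k b D"
          by (simp add: pairing_diff[OF b q D(1)] pairing_cmult[OF b d] pairing_diff[OF b bc(1)[OF ws] bc(1)[OF zs]])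
        with C(2)[OF Sum_diff[OF q D(1)]] show ?case
          by (simp add: divide_inverse mult.commute)
      qed
    qed
    then have "((\<lambda>w. (pairing k b (f w) - pairing k b (f z)) / (w - z)) \<longlongrightarrow> pairing k b D) (at z)"
      by (rule LIM_zero_cancel)
    then show "\<exists>f'. ((\<lambda>w. pairing k b (f w)) has_field_derivative f') (at z)"
      by (auto simp: has_field_derivative_iff)
  qed
qed

end

lemma cnj_sgn_mult: "z * cnj (sgn z) = of_real (cmod z)"
proof (cases "z = 0")
  case False
  then show ?thesis
    by (simp add: sgn_div_norm scaleR_conv_of_real complex_norm_square[symmetric] power2_eq_square field_simps)
qed simp

section \<open>The change of measure estimate on truncated sets\<close>

context interpolation_scale
begin

text \<open>Together the conditions make the set finite in measure and the dual elements below
  admissible: lower bounds on both endpoint weights, upper bounds on all that enters the dual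
  element. For positive n the sets increase and exhaust U.\<close>

definition truncation :: "(real^'n \<Rightarrow> complex) \<Rightarrow> nat \<Rightarrow> (real^'n) set" where
  "truncation v n = {x \<in> U. norm x \<le> n \<and> cmod (v x) \<le> n \<and> 1 / n \<le> \<omega> 0 x \<and> 1 / n \<le> \<omega> 1 x \<and>
     \<omega> 1 x \<le> n \<and> \<bar>\<gamma> x\<bar> \<le> n}"

lemma \<gamma>_measurable: "\<gamma> \<in> borel_measurable MU"
  using \<gamma>_lipschitz
  by (intro measurable_restrict_space1 continuous_lebesgue_measurable lipschitz_on_continuous_on)

lemma truncation_measurable:
  assumes v[measurable]: "v \<in> borel_measurable MU"
  shows "truncation v n \<in> sets MU" "emeasure MU (truncation v n) < \<infinity>"
proof -
  note \<gamma>_measurable[measurable] \<omega>_measurable[measurable]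
  have [measurable]: "(\<lambda>x. norm x) \<in> borel_measurable MU"
    by (intro measurable_restrict_space1 continuous_lebesgue_measurable continuous_intros)
  have "truncation v n = {x \<in> space MU. norm x \<le> n \<and> cmod (v x) \<le> n \<and> 1 / n \<le> \<omega> 0 x \<and> 1 / n \<le> \<omega> 1 x \<and>
     \<omega> 1 x \<le> n \<and> \<bar>\<gamma> x\<bar> \<le> n}" by (simp add: truncation_def)
  also have "\<dots> \<in> sets MU" by measurable
  finally show s: "truncation v n \<in> sets MU" .
  then have s': "truncation v n \<in> sets lebesgue"
    using U by (auto simp: sets_restrict_space_iff)
  have "truncation v n \<subseteq> cball 0 n" by (auto simp: truncation_def)
  then have "truncation v n \<in> lmeasurable"
    using s' bounded_subset[OF bounded_cball] by (intro bounded_set_imp_lmeasurable)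
  moreover have "emeasure MU (truncation v n) = emeasure lebesgue (truncation v n)"
    using U by (intro emeasure_restrict_space) (auto simp: truncation_def)
  ultimately show "emeasure MU (truncation v n) < \<infinity>"
    by (simp add: fmeasurable_def del: emeasure_completion)
qed

text \<open>A scalar function F on the strip is built with F(\<theta>) = S, the truncated p-th power
  integral of v. On the edges |F| \<le> S/2 + const * M^p, so \<open>three_lines\<close> gives S
  \<le> S/2 + const * M^p. The resulting constant does not involve n.\<close>

lemma truncated_bound:
  fixes k :: "'n option"
  assumes f: "f \<in> calderon_F (A 0) (A 1)" and M: "0 < M"
    and fM: "\<And>j t. j \<in> {0, 1} \<Longrightarrow> fnorm (A j) (f (Complex j t)) \<le> M" and n: "0 < n"
  defines "v \<equiv> \<lambda>x. with_gradient U (f (of_real \<theta>)) x $ k"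
  shows "integrable MU (\<lambda>x. indicator (truncation v n) x * (cmod (v x) powr p * \<omega> \<theta> x))"
    "(LINT x|MU. indicator (truncation v n) x * (cmod (v x) powr p * \<omega> \<theta> x)) \<le> K * exp 1 * (2 powr p * K) * M powr p"
proof -
  let ?E = "truncation v n"
  define \<kappa> where "\<kappa> x = real_of_int \<lfloor>\<gamma> x\<rfloor>" for x
  \<comment> \<open>A discretised substitute for \<omega> \<theta>, with \<open>\<kappa>\<close> in
    place of \<gamma>; it dominates \<omega> \<theta> up to the factor K * exp 1.\<close>
  define \<nu> where "\<nu> x = \<omega> 1 x * exp ((1 - \<theta>) * \<kappa> x)" for x
  \<comment> \<open>Weights aside, |v|^(p-1) times the conjugate sign of v is the norming element of
    v. The exponent (1 - \<theta>) \<kappa> (1 - 1/p) complements the (1 - \<theta>) \<kappa> / p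
    that the coefficients of \<open>F\<close> contribute at \<theta>, so that the total is that of
    \<nu>.\<close>
  define \<beta> where "\<beta> x = cnj (sgn (v x)) *
    of_real (cmod (v x) powr (p - 1) * \<omega> 1 x * exp ((1 - \<theta>) * \<kappa> x * (1 - 1 / p)))" for x
  define b where "b i x = (if x \<in> ?E \<and> \<lfloor>\<gamma> x\<rfloor> = i then \<beta> x else 0)" for i x
  define I where "I = {- int n - 1..int n + 1}"
  have \<theta>s: "complex_of_real \<theta> \<in> strip" using \<theta> by (simp add: strip_def)
  have fS: "f w \<in> fcarrier Sum" if "w \<in> strip" for w
    using f that by (auto simp: calderon_F_def bounded_continuous_into_def)
  have vm[measurable]: "v \<in> borel_measurable MU"
    unfolding v_def by (intro with_gradient_measurable U Sum_weakly_differentiable fS \<theta>s)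
  note \<gamma>_measurable[measurable] \<omega>_measurable[measurable]
  have E[measurable]: "?E \<in> sets MU" and Efin: "emeasure MU ?E < \<infinity>"
    using truncation_measurable[OF vm] by blast+
  have \<kappa>m[measurable]: "\<kappa> \<in> borel_measurable MU" unfolding \<kappa>_def[abs_def] by measurable
  have \<nu>m[measurable]: "\<nu> \<in> borel_measurable MU" unfolding \<nu>_def[abs_def] by measurable
  have \<beta>m[measurable]: "\<beta> \<in> borel_measurable MU"
  proof -
    have "(\<lambda>x. cnj (sgn (v x))) \<in> borel_measurable MU"
      by (rule borel_measurable_continuous_on[OF _ measurable_compose[OF vm borel_measurable_sgn]])
        (intro continuous_intros)
    then show ?thesis unfolding \<beta>_def[abs_def] by measurable
  qed
  have inE: "x \<in> U" "cmod (v x) \<le> n" "1 / n \<le> \<omega> 0 x" "1 / n \<le> \<omega> 1 x" "\<omega> 1 x \<le> n" "\<bar>\<gamma> x\<bar> \<le> n"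
    "\<bar>\<kappa> x\<bar> \<le> n + 1" "0 < \<omega> 1 x" "\<lfloor>\<gamma> x\<rfloor> \<in> I" if "x \<in> ?E" for x
  proof -
    show "x \<in> U" "cmod (v x) \<le> n" "1 / n \<le> \<omega> 0 x" "1 / n \<le> \<omega> 1 x" "\<omega> 1 x \<le> n" and g: "\<bar>\<gamma> x\<bar> \<le> n"
      using that by (auto simp: truncation_def)
    then show "0 < \<omega> 1 x" using \<omega>_pos by blast
    have "\<kappa> x \<le> \<gamma> x" "\<gamma> x \<le> \<kappa> x + 1" unfolding \<kappa>_def by linarith+
    then show "\<bar>\<kappa> x\<bar> \<le> n + 1" using g by linarith
    then show "\<lfloor>\<gamma> x\<rfloor> \<in> I" unfolding \<kappa>_def I_def by (simp add: abs_le_iff)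
  qed
  have exp_le: "exp (a * \<kappa> x) \<le> exp (n + 1)" if "x \<in> ?E" "0 \<le> a" "a \<le> 1" for a x
  proof -
    have "a * \<kappa> x \<le> \<bar>a * \<kappa> x\<bar>" by simp
    also have "\<dots> = a * \<bar>\<kappa> x\<bar>" using that by (simp add: abs_mult)
    also have "\<dots> \<le> 1 * real (n + 1)" using that inE(7)[OF that(1)] by (intro mult_mono) auto
    finally show ?thesis by simp
  qed
  have adm: "admissible (b i)" for i
    unfolding admissible_def
  proof (intro conjI exI ballI allI impI)
    show "b i \<in> borel_measurable MU" unfolding b_def[abs_def] by measurable
    show "?E \<in> sets MU" "emeasure MU ?E < \<infinity>" by (fact E, fact Efin)
    show "0 < 1 / real n" using n by simp
    show "1 / real n \<le> \<omega> 0 x" "1 / real n \<le> \<omega> 1 x" if "x \<in> ?E" for x using inE[OF that] by auto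
    show "b i x = 0" if "x \<notin> ?E" for x using that by (simp add: b_def)
    show "0 \<le> real n powr (p - 1) * real n * exp (n + 1)" by simp
    fix x
    show "cmod (b i x) \<le> real n powr (p - 1) * real n * exp (n + 1)"
    proof (cases "x \<in> ?E")
      case True
      have "0 \<le> (1 - \<theta>) * (1 - 1 / p)" "(1 - \<theta>) * (1 - 1 / p) \<le> 1"
        using \<theta> p by (auto intro!: mult_le_one)
      from exp_le[OF True this] have "exp ((1 - \<theta>) * \<kappa> x * (1 - 1 / p)) \<le> exp (n + 1)" by (simp add: mult_ac)
      moreover have "cmod (v x) powr (p - 1) \<le> real n powr (p - 1)"
        using inE(2)[OF True] p by (intro powr_mono2) auto
      moreover have "cmod (\<beta> x) \<le> cmod (v x) powr (p - 1) * \<omega> 1 x * exp ((1 - \<theta>) * \<kappa> x * (1 - 1 / p))"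
        using inE(8)[OF True] by (auto simp: \<beta>_def norm_mult norm_sgn)
      moreover have "cmod (v x) powr (p - 1) * \<omega> 1 x * exp ((1 - \<theta>) * \<kappa> x * (1 - 1 / p)) \<le> real n powr (p - 1) * real n * exp (n + 1)"
        using calculation(1,2) inE(5,8)[OF True] by (intro mult_mono) auto
      ultimately show ?thesis by (auto simp: b_def)
    qed (simp add: b_def)
  qed
  have Sint: "integrable MU (\<lambda>x. indicator ?E x * (cmod (v x) powr p * \<nu> x))"
  proof (rule Bochner_Integration.integrable_bound)
    show "integrable MU (\<lambda>x. (real n powr p * (real n * exp (n + 1))) * indicator ?E x)"
      using E Efin by (intro integrable_mult_right integrable_real_indicator) auto
    show "(\<lambda>x. indicator ?E x * (cmod (v x) powr p * \<nu> x)) \<in> borel_measurable MU" by measurable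
    show "AE x in MU. norm (indicator ?E x * (cmod (v x) powr p * \<nu> x)) \<le>
      norm ((real n powr p * (real n * exp (n + 1))) * indicator ?E x)"
    proof (rule AE_I2)
      fix x
      show "norm (indicator ?E x * (cmod (v x) powr p * \<nu> x)) \<le> norm ((real n powr p * (real n * exp (n + 1))) * indicator ?E x)"
      proof (cases "x \<in> ?E")
        case True
        have "cmod (v x) powr p * (\<omega> 1 x * exp ((1 - \<theta>) * \<kappa> x)) \<le> real n powr p * (real n * exp (n + 1))"
          using inE[OF True] exp_le[OF True, of "1 - \<theta>"] \<theta> p by (intro mult_mono powr_mono2) auto
        then show ?thesis using True inE(8)[OF True] by (simp add: \<nu>_def abs_mult)
      qed simp
    qed
  qed
  define S where "S = (LINT x|MU. indicator ?E x * (cmod (v x) powr p * \<nu> x))"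
  \<comment> \<open>On the set where the integer part of \<gamma> is i, the coefficient is a
    discretised p-th root of the weight ratio \<omega>_w / \<omega>_1, continued from real to
    complex w. The functionals \<open>b i\<close> themselves do not depend on w.\<close>
  define F where "F w = (\<Sum>i\<in>I. exp ((1 - w) * of_int i / of_real p) * pairing k (b i) (f w))" for w
  have F_int: "F w = (LINT x|MU. with_gradient U (f w) x $ k * (indicator ?E x * (exp ((1 - w) * of_real (\<kappa> x) / of_real p) * \<beta> x)))"
    if w: "w \<in> strip" for w
  proof -
    have i: "integrable MU (\<lambda>x. with_gradient U (f w) x $ k * b i x)" for i
      using pairing_Sum[OF adm, of k i] fS[OF w] by blast
    have pt: "(\<Sum>i\<in>I. exp ((1 - w) * of_int i / of_real p) * b i x) = indicator ?E x * (exp ((1 - w) * of_real (\<kappa> x) / of_real p) * \<beta> x)" for x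
    proof (cases "x \<in> ?E")
      case True
      have "(\<Sum>i\<in>I. exp ((1 - w) * of_int i / of_real p) * b i x) =
        (\<Sum>i\<in>I. if i = \<lfloor>\<gamma> x\<rfloor> then exp ((1 - w) * of_int i / of_real p) * \<beta> x else 0)"
        using True by (intro sum.cong) (auto simp: b_def)
      also have "\<dots> = exp ((1 - w) * of_int \<lfloor>\<gamma> x\<rfloor> / of_real p) * \<beta> x"
        using inE(9)[OF True] by (simp add: I_def)
      finally show ?thesis using True by (simp add: \<kappa>_def)
    qed (simp add: b_def)
    have "F w = (\<Sum>i\<in>I. LINT x|MU. exp ((1 - w) * of_int i / of_real p) * (with_gradient U (f w) x $ k * b i x))"
      unfolding F_def pairing_def using i by simp
    also have "\<dots> = (LINT x|MU. (\<Sum>i\<in>I. exp ((1 - w) * of_int i / of_real p) * (with_gradient U (f w) x $ k * b i x)))"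
      using i by (intro Bochner_Integration.integral_sum[symmetric] integrable_mult_right)
    also have "(\<lambda>x. \<Sum>i\<in>I. exp ((1 - w) * of_int i / of_real p) * (with_gradient U (f w) x $ k * b i x)) =
       (\<lambda>x. with_gradient U (f w) x $ k * (indicator ?E x * (exp ((1 - w) * of_real (\<kappa> x) / of_real p) * \<beta> x)))"
      unfolding pt[symmetric] by (simp add: sum_distrib_left mult_ac)
    finally show ?thesis .
  qed
  have F\<theta>: "F (of_real \<theta>) = of_real S"
  proof -
    have "v x * (indicator ?E x * (exp ((1 - of_real \<theta>) * of_real (\<kappa> x) / of_real p) * \<beta> x)) =
       of_real (indicator ?E x * (cmod (v x) powr p * \<nu> x))" for x
    proof -
      have e: "exp ((1 - complex_of_real \<theta>) * of_real (\<kappa> x) / of_real p) = of_real (exp ((1 - \<theta>) * \<kappa> x / p))"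
        by (simp add: exp_of_real[symmetric])
      have e2: "exp ((1 - \<theta>) * \<kappa> x / p) * exp ((1 - \<theta>) * \<kappa> x * (1 - 1 / p)) = exp ((1 - \<theta>) * \<kappa> x)"
        by (simp add: exp_add[symmetric] right_diff_distrib)
      have v: "cmod (v x) * cmod (v x) powr (p - 1) = cmod (v x) powr p"
        using p by (cases "v x = 0") (auto simp: powr_diff)
      have "v x * (exp ((1 - of_real \<theta>) * of_real (\<kappa> x) / of_real p) * \<beta> x) =
         (v x * cnj (sgn (v x))) * of_real (exp ((1 - \<theta>) * \<kappa> x / p) *
           (cmod (v x) powr (p - 1) * \<omega> 1 x * exp ((1 - \<theta>) * \<kappa> x * (1 - 1 / p))))"
        unfolding e \<beta>_def by simp
      also have "\<dots> = of_real ((cmod (v x) * cmod (v x) powr (p - 1)) * (\<omega> 1 x *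
         (exp ((1 - \<theta>) * \<kappa> x / p) * exp ((1 - \<theta>) * \<kappa> x * (1 - 1 / p)))))"
        unfolding cnj_sgn_mult by simp
      also have "\<dots> = of_real (cmod (v x) powr p * \<nu> x)" unfolding e2 v \<nu>_def ..
      finally show ?thesis by (simp add: indicator_def)
    qed
    moreover have "with_gradient U (f (of_real \<theta>)) x $ k = v x" for x by (simp add: v_def)
    ultimately show ?thesis unfolding F_int[OF \<theta>s] S_def
      by (simp only: integral_complex_of_real)
  qed
  have S0: "0 \<le> S" unfolding S_def
    by (intro integral_nonneg_AE AE_I2) (auto simp: indicator_def \<nu>_def intro!: mult_nonneg_nonneg less_imp_le[OF \<omega>_pos])
  \<comment> \<open>The first term is the half of \<open>S\<close> to be absorbed; the second is the
    remainder of \<open>powr_product_bound\<close>, with K from the comparison with the edge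
    weight.\<close>
  define B where "B = S / 2 + 2 powr (p - 1) * K * M powr p"
  have B0: "0 < B" using S0 K_pos M by (simp add: B_def add_nonneg_pos)
  have edge: "cmod (F (Complex j t)) \<le> B" if j: "j \<in> {0, 1}" for j t
  proof -
    let ?w = "Complex j t" and ?D = "\<lambda>x. cmod (with_gradient U (f (Complex j t)) x $ k)"
    have w: "?w \<in> strip" using j by (auto simp: strip_def)
    have fA: "f ?w \<in> fcarrier (A j)" using f j by (auto simp: calderon_F_def bounded_continuous_into_def)
    then have fW: "f ?w \<in> fcarrier (W j)" by (rule A_sub)
    have i: "integrable MU (\<lambda>x. ?D x powr p * \<omega> j x)" by (rule W_integrable[OF fW])
    \<comment> \<open>The modulus of the coefficient on the edge is exp ((1 - j) \<kappa> / p),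
      independent of t. The factor \<open>?u\<close> is scaled so that \<omega> 1 x * ?u powr p is
      the integrand of \<open>S\<close>, and \<open>powr_product_bound\<close> then separates it
      from \<open>f ?w\<close>.\<close>
    have pt: "cmod (with_gradient U (f ?w) x $ k * (indicator ?E x * (exp ((1 - ?w) * of_real (\<kappa> x) / of_real p) * \<beta> x)))
      \<le> indicator ?E x * (cmod (v x) powr p * \<nu> x) / 2 + 2 powr (p - 1) * K * (?D x powr p * \<omega> j x)"
      if x: "x \<in> U" for x
    proof (cases "x \<in> ?E")
      case True
      let ?a = "exp ((1 - j) * \<kappa> x / p) * ?D x" and ?u = "cmod (v x) * exp ((1 - \<theta>) * \<kappa> x / p)"
      have \<omega>1: "0 < \<omega> 1 x" by (rule inE(8)[OF True])
      have ne: "cmod (exp ((1 - ?w) * of_real (\<kappa> x) / of_real p)) = exp ((1 - j) * \<kappa> x / p)"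
        by (simp add: norm_exp_eq_Re)
      have \<beta>le: "cmod (\<beta> x) \<le> \<omega> 1 x * ?u powr (p - 1)"
      proof -
        have "?u powr (p - 1) = cmod (v x) powr (p - 1) * exp ((1 - \<theta>) * \<kappa> x / p * (p - 1))"
          by (simp add: powr_mult powr_def[of "exp _"] mult.commute)
        also have "(1 - \<theta>) * \<kappa> x / p * (p - 1) = (1 - \<theta>) * \<kappa> x * (1 - 1 / p)"
          using p by (simp add: field_simps)
        finally show ?thesis using \<omega>1 by (auto simp: \<beta>_def norm_mult norm_sgn)
      qed
      have "cmod (with_gradient U (f ?w) x $ k * (exp ((1 - ?w) * of_real (\<kappa> x) / of_real p) * \<beta> x)) = ?a * cmod (\<beta> x)"
        unfolding norm_mult ne by simp
      also have "\<dots> \<le> ?a * (\<omega> 1 x * ?u powr (p - 1))" by (intro mult_left_mono \<beta>le) auto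
      also have "\<dots> = \<omega> 1 x * (?a * ?u powr (p - 1))" by simp
      also have "\<dots> \<le> \<omega> 1 x * (?u powr p / 2 + 2 powr (p - 1) * ?a powr p)"
        using \<omega>1 p by (intro mult_left_mono powr_product_bound) auto
      also have "?u powr p = cmod (v x) powr p * exp ((1 - \<theta>) * \<kappa> x)"
        using p by (simp add: powr_mult powr_def[of "exp _"])
      also have "?a powr p = exp ((1 - j) * \<kappa> x) * ?D x powr p"
        using p by (simp add: powr_mult powr_def[of "exp _"])
      also have "\<omega> 1 x * (cmod (v x) powr p * exp ((1 - \<theta>) * \<kappa> x) / 2 + 2 powr (p - 1) * (exp ((1 - j) * \<kappa> x) * ?D x powr p))
         = cmod (v x) powr p * \<nu> x / 2 + 2 powr (p - 1) * (\<omega> 1 x * exp ((1 - j) * \<kappa> x)) * ?D x powr p"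
        by (simp add: \<nu>_def algebra_simps)
      \<comment> \<open>Rounding \<gamma> down costs nothing here, since 1 - j is non-negative. The
        price is paid when \<nu> is compared with \<omega> \<theta>, in the factor
        \<open>exp 1\<close>.\<close>
      also have "\<dots> \<le> cmod (v x) powr p * \<nu> x / 2 + 2 powr (p - 1) * (K * \<omega> j x) * ?D x powr p"
      proof -
        have "\<kappa> x \<le> \<gamma> x" unfolding \<kappa>_def by linarith
        then have "(1 - j) * \<kappa> x \<le> (1 - j) * \<gamma> x" using j by (intro mult_left_mono) auto
        then have "\<omega> 1 x * exp ((1 - j) * \<kappa> x) \<le> \<omega> 1 x * exp ((1 - j) * \<gamma> x)" using \<omega>1 by simp
        also have "\<dots> \<le> K * \<omega> j x" using j x by (intro \<omega>_ratio) auto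
        finally show ?thesis by (intro add_left_mono mult_right_mono mult_left_mono) auto
      qed
      finally show ?thesis using True by (simp add: mult_ac)
    next
      case False
      then show ?thesis using K_pos \<omega>_pos[OF x, of j] by simp
    qed
    have "cmod (F ?w) \<le> (LINT x|MU. cmod (with_gradient U (f ?w) x $ k * (indicator ?E x * (exp ((1 - ?w) * of_real (\<kappa> x) / of_real p) * \<beta> x))))"
      unfolding F_int[OF w] by (rule integral_norm_bound)
    also have "\<dots> \<le> (LINT x|MU. indicator ?E x * (cmod (v x) powr p * \<nu> x) / 2 + 2 powr (p - 1) * K * (?D x powr p * \<omega> j x))"
    proof (rule integral_mono_AE')
      show "integrable MU (\<lambda>x. indicator ?E x * (cmod (v x) powr p * \<nu> x) / 2 + 2 powr (p - 1) * K * (?D x powr p * \<omega> j x))"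
        using Sint i by auto
      show "AE x in MU. cmod (with_gradient U (f ?w) x $ k * (indicator ?E x * (exp ((1 - ?w) * of_real (\<kappa> x) / of_real p) * \<beta> x)))
        \<le> indicator ?E x * (cmod (v x) powr p * \<nu> x) / 2 + 2 powr (p - 1) * K * (?D x powr p * \<omega> j x)"
        using pt by (intro AE_I2) simp
      show "AE x in MU. 0 \<le> indicator ?E x * (cmod (v x) powr p * \<nu> x) / 2 + 2 powr (p - 1) * K * (?D x powr p * \<omega> j x)"
        using pt by (intro AE_I2 order_trans[OF norm_ge_zero pt]) simp
    qed
    also have "\<dots> = S / 2 + 2 powr (p - 1) * K * (LINT x|MU. ?D x powr p * \<omega> j x)"
      using Sint i by (simp add: S_def)
    also have "(LINT x|MU. ?D x powr p * \<omega> j x) \<le> M powr p"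
    proof -
      have "(LINT x|MU. ?D x powr p * \<omega> j x) \<le> energy p U (\<omega> j) (f ?w)"
        unfolding energy_def
        by (rule member_le_sum[of k UNIV "\<lambda>k. LINT x|MU. cmod (with_gradient U (f ?w) x $ k) powr p * \<omega> j x"])
          (auto intro!: integral_nonneg_AE AE_I2 mult_nonneg_nonneg less_imp_le[OF \<omega>_pos])
      also have "\<dots> = fnorm (W j) (f ?w) powr p" using W1_norm_powr[of U "\<omega> j" p "f ?w"] \<omega>_pos p by simp
      also have "\<dots> \<le> M powr p" using fM[OF j, of t] p W_norm_nonneg by (intro powr_mono2) (auto simp: A_norm)
      finally show ?thesis .
    qed
    finally show ?thesis using K_pos by (simp add: B_def mult_left_mono)
  qed
  have hol: "F holomorphic_on interior strip" unfolding F_def[abs_def] using p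
    by (intro holomorphic_intros pairing_holomorphic(1)[OF adm f]) auto
  have cont: "continuous_on strip F" unfolding F_def[abs_def] using p
    by (intro continuous_intros pairing_holomorphic(2)[OF adm f]) auto
  have "\<exists>M. \<forall>z\<in>strip. cmod (F z) \<le> M"
  proof -
    obtain P where P: "\<And>i w. w \<in> strip \<Longrightarrow> cmod (pairing k (b i) (f w)) \<le> P i"
      using pairing_holomorphic(3)[OF adm f, of k] by metis
    have "cmod (F w) \<le> (\<Sum>i\<in>I. exp \<bar>of_int i\<bar> * P i)" if w: "w \<in> strip" for w
      unfolding F_def
    proof (rule sum_norm_le)
      fix i
      have "Re ((1 - w) * of_int i / of_real p) = (1 - Re w) / p * of_int i" by simp
      also have "\<dots> \<le> \<bar>(1 - Re w) / p * of_int i\<bar>" by (rule abs_ge_self)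
      also have "\<dots> = \<bar>(1 - Re w) / p\<bar> * \<bar>of_int i\<bar>" by (rule abs_mult)
      also have "\<dots> \<le> 1 * \<bar>of_int i\<bar>" using w p by (intro mult_right_mono) (auto simp: strip_def divide_le_eq)
      finally have "cmod (exp ((1 - w) * of_int i / of_real p)) \<le> exp \<bar>of_int i\<bar>" unfolding norm_exp_eq_Re by simp
      then show "cmod (exp ((1 - w) * of_int i / of_real p) * pairing k (b i) (f w)) \<le> exp \<bar>of_int i\<bar> * P i"
        unfolding norm_mult using P[OF w, of i] by (intro mult_mono) auto
    qed
    then show ?thesis by blast
  qed
  then obtain M' where M': "\<And>z. z \<in> strip \<Longrightarrow> cmod (F z) \<le> M'" by blast
  \<comment> \<open>By \<open>Sint\<close>, \<open>S\<close> is a genuine finite integral, so S/2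
    can be subtracted; 2 * 2^(p-1) = 2^p gives the constant.\<close>
  have "S \<le> B" using three_lines[OF hol cont M' edge B0 \<theta>s] F\<theta> S0 by simp
  then have S: "S \<le> 2 powr p * K * M powr p" unfolding B_def by (simp add: powr_diff)
  have le: "indicator ?E x * (cmod (v x) powr p * \<omega> \<theta> x) \<le> K * exp 1 * (indicator ?E x * (cmod (v x) powr p * \<nu> x))" for x
  proof (cases "x \<in> ?E")
    case True
    have "\<omega> \<theta> x * exp ((\<theta> - 1) * \<gamma> x) \<le> K * \<omega> 1 x" using \<theta> inE(1)[OF True] by (intro \<omega>_ratio) auto
    then have "\<omega> \<theta> x * exp ((\<theta> - 1) * \<gamma> x) * exp ((1 - \<theta>) * \<gamma> x) \<le> K * \<omega> 1 x * exp ((1 - \<theta>) * \<gamma> x)"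
      by (rule mult_right_mono) simp
    then have "\<omega> \<theta> x \<le> K * \<omega> 1 x * exp ((1 - \<theta>) * \<gamma> x)"
      by (simp add: mult.assoc exp_add[symmetric] distrib_right[symmetric])
    also have "\<dots> \<le> K * \<omega> 1 x * (exp 1 * exp ((1 - \<theta>) * \<kappa> x))"
    proof -
      have "\<gamma> x - \<kappa> x \<le> 1" unfolding \<kappa>_def by linarith
      then have "(1 - \<theta>) * (\<gamma> x - \<kappa> x) \<le> (1 - \<theta>) * 1" using \<theta> by (intro mult_left_mono) auto
      then have "(1 - \<theta>) * \<gamma> x \<le> 1 + (1 - \<theta>) * \<kappa> x" using \<theta> by (simp add: right_diff_distrib)
      then have "exp ((1 - \<theta>) * \<gamma> x) \<le> exp 1 * exp ((1 - \<theta>) * \<kappa> x)" by (simp add: exp_add[symmetric])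
      then show ?thesis using K_pos inE(8)[OF True] by (intro mult_left_mono) auto
    qed
    finally have "\<omega> \<theta> x \<le> K * exp 1 * \<nu> x" by (simp add: \<nu>_def mult_ac)
    then have "cmod (v x) powr p * \<omega> \<theta> x \<le> cmod (v x) powr p * (K * exp 1 * \<nu> x)" by (intro mult_left_mono) auto
    then show ?thesis using True by (simp add: mult_ac)
  qed simp
  have nn: "0 \<le> indicator ?E x * (cmod (v x) powr p * \<omega> \<theta> x)" for x
    using inE(1)[of x] \<omega>_pos[of x \<theta>] by (cases "x \<in> ?E") auto
  show int: "integrable MU (\<lambda>x. indicator ?E x * (cmod (v x) powr p * \<omega> \<theta> x))"
  proof (rule Bochner_Integration.integrable_bound)
    show "integrable MU (\<lambda>x. K * exp 1 * (indicator ?E x * (cmod (v x) powr p * \<nu> x)))"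
      using Sint by (rule integrable_mult_right)
    show "(\<lambda>x. indicator ?E x * (cmod (v x) powr p * \<omega> \<theta> x)) \<in> borel_measurable MU" by measurable
    show "AE x in MU. norm (indicator ?E x * (cmod (v x) powr p * \<omega> \<theta> x)) \<le> norm (K * exp 1 * (indicator ?E x * (cmod (v x) powr p * \<nu> x)))"
      using nn le by (intro AE_I2) (metis abs_of_nonneg order_trans real_norm_def)
  qed
  have "(LINT x|MU. indicator ?E x * (cmod (v x) powr p * \<omega> \<theta> x)) \<le> (LINT x|MU. K * exp 1 * (indicator ?E x * (cmod (v x) powr p * \<nu> x)))"
    using le Sint by (intro integral_mono int integrable_mult_right) auto
  also have "\<dots> = K * exp 1 * S" by (simp add: S_def)
  also have "\<dots> \<le> K * exp 1 * (2 powr p * K * M powr p)" using S K_pos by (intro mult_left_mono) auto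
  finally show "(LINT x|MU. indicator ?E x * (cmod (v x) powr p * \<omega> \<theta> x)) \<le> K * exp 1 * (2 powr p * K) * M powr p"
    by (simp add: mult_ac)
qed

end

section \<open>Removal of the truncation and equivalence of norms\<close>

context interpolation_scale
begin

text \<open>The p-th root of the constant of \<open>truncated_bound\<close>, summed over the
  function and its partial derivatives.\<close>

definition upper_const :: real where
  "upper_const = (real CARD('n option) * (K * exp 1 * (2 powr p * K))) powr (1 / p)"

lemma upper_const_pos: "0 < upper_const"
  unfolding upper_const_def using K_pos by simp

text \<open>The truncated integrals increase with n under a bound independent of n, so monotone
  convergence yields finiteness of the middle norm. Membership in \<open>A \<theta>\<close> then
  follows from \<open>A_sum\<close> and a decomposition of the value in the sum space.\<close>

lemma calderon_F_value:
  assumes f: "f \<in> calderon_F (A 0) (A 1)" and M: "0 < M"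
    and fM: "\<And>j t. j \<in> {0, 1} \<Longrightarrow> fnorm (A j) (f (Complex j t)) \<le> M"
  shows "f (of_real \<theta>) \<in> fcarrier (A \<theta>)" "fnorm (A \<theta>) (f (of_real \<theta>)) \<le> upper_const * M"
proof -
  let ?u = "f (of_real \<theta>)" and ?R = "K * exp 1 * (2 powr p * K) * M powr p"
  have "complex_of_real \<theta> \<in> strip" using \<theta> by (simp add: strip_def)
  then have uS: "?u \<in> fcarrier Sum" using f by (auto simp: calderon_F_def bounded_continuous_into_def)
  note wd = Sum_weakly_differentiable[OF uS]
  have main: "integrable MU (\<lambda>x. cmod (with_gradient U ?u x $ k) powr p * \<omega> \<theta> x) \<and>
     (LINT x|MU. cmod (with_gradient U ?u x $ k) powr p * \<omega> \<theta> x) \<le> ?R" for k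
  proof -
    let ?v = "\<lambda>x. with_gradient U ?u x $ k" and ?g = "\<lambda>x. cmod (with_gradient U ?u x $ k) powr p * \<omega> \<theta> x"
    let ?f = "\<lambda>n x. indicator (truncation ?v (Suc n)) x * ?g x"
    note tb = truncated_bound[OF f M fM zero_less_Suc, where k=k]
    have g0: "0 \<le> ?g x" if "x \<in> U" for x using \<omega>_pos[OF that, of \<theta>] by simp
    have mono_E: "truncation ?v m \<subseteq> truncation ?v n" if "0 < m" "m \<le> n" for m n
    proof
      fix x assume x: "x \<in> truncation ?v m"
      have "1 / real n \<le> 1 / real m" "real m \<le> real n" using that by (auto simp: frac_le)
      then show "x \<in> truncation ?v n" using x unfolding truncation_def by (auto intro: order_trans)
    qed
    have mono_f: "?f m x \<le> ?f n x" if "m \<le> n" "x \<in> U" for m n x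
      using mono_E[of "Suc m" "Suc n"] that g0[of x] by (auto simp: indicator_def)
    have inc: "incseq (\<lambda>n. LINT x|MU. ?f n x)"
      using mono_f by (intro incseq_SucI integral_mono_AE tb AE_I2) auto
    moreover have bd: "\<forall>n. (LINT x|MU. ?f n x) \<le> ?R" using tb(2) by blast
    ultimately obtain l where l: "(\<lambda>n. LINT x|MU. ?f n x) \<longlonglongrightarrow> l" by (rule incseq_convergent)
    have lim: "AE x in MU. (\<lambda>n. ?f n x) \<longlonglongrightarrow> ?g x"
    proof (rule AE_I2)
      fix x assume "x \<in> space MU"
      then have x: "x \<in> U" by simp
      obtain N where N: "max (max (norm x) (cmod (?v x))) (max (max (1 / \<omega> 0 x) (1 / \<omega> 1 x)) (max (\<omega> 1 x) \<bar>\<gamma> x\<bar>)) < real N"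
        using reals_Archimedean2 by blast
      have w: "0 < \<omega> 0 x" "0 < \<omega> 1 x" using \<omega>_pos[OF x] by auto
      have N0: "0 < real N" using N norm_ge_zero[of x] by linarith
      have "x \<in> truncation ?v N"
        unfolding truncation_def using N w N0 x by (auto simp: divide_less_eq field_simps)
      then have "x \<in> truncation ?v (Suc n)" if "N \<le> n" for n
        using mono_E[of N "Suc n"] N0 that by auto
      then have "\<forall>\<^sub>F n in sequentially. ?f n x = ?g x" by (intro eventually_sequentiallyI[of N]) simp
      then show "(\<lambda>n. ?f n x) \<longlonglongrightarrow> ?g x" by (rule tendsto_eventually)
    qed
    have m: "?g \<in> borel_measurable MU"
      by (intro cmod_powr_measurable with_gradient_measurable U wd \<omega>_measurable)
    have mo: "AE x in MU. mono (\<lambda>n. ?f n x)" using mono_f by (intro AE_I2 monoI) auto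
    have "integrable MU ?g" by (rule integrable_monotone_convergence[OF tb(1) mo lim l m])
    moreover have "integral\<^sup>L MU ?g = l" by (rule integral_monotone_convergence[OF tb(1) mo lim l m])
    moreover have "l \<le> ?R" using l bd by (intro LIMSEQ_le_const2) auto
    ultimately show ?thesis by simp
  qed
  then have W: "?u \<in> fcarrier (W \<theta>)" using wd W1_carrier_iff[OF U] by blast
  then show "?u \<in> fcarrier (A \<theta>)" using SumE[OF uS] A_sum by metis
  have "energy p U (\<omega> \<theta>) ?u \<le> (\<Sum>k\<in>(UNIV :: 'n option set). ?R)"
    unfolding energy_def using main by (intro sum_mono) blast
  then have "energy p U (\<omega> \<theta>) ?u \<le> (real CARD('n option) * (K * exp 1 * (2 powr p * K))) * M powr p" by (simp add: mult_ac)
  then have "energy p U (\<omega> \<theta>) ?u powr (1 / p) \<le> ((real CARD('n option) * (K * exp 1 * (2 powr p * K))) * M powr p) powr (1 / p)"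
    using p W_energy_nonneg by (intro powr_mono2) auto
  also have "\<dots> = upper_const * M" using M p K_pos by (simp add: upper_const_def powr_mult powr_powr)
  finally show "fnorm (A \<theta>) ?u \<le> upper_const * M" by (simp add: A_norm W1_norm)
qed

lemma calderon_norm_edge:
  assumes f: "f \<in> calderon_F (A 0) (A 1)" and j: "j \<in> {0, 1}"
  shows "fnorm (A j) (f (Complex j t)) \<le> calderon_norm (A 0) (A 1) f"
proof -
  have bdd: "bdd_above (range (\<lambda>t. fnorm (A j) (f (Complex j t))))"
    using f j by (auto simp: calderon_F_def bounded_continuous_into_def bdd_above_def)
  have "fnorm (A j) (f (Complex j t)) \<le> (SUP t. fnorm (A j) (f (Complex j t)))"
    using bdd by (intro cSUP_upper) auto
  then show ?thesis using j by (auto simp: calderon_norm_def)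
qed

theorem complex_interp_equiv: "complex_interp (A 0) (A 1) \<theta> \<cong>\<^sub>N A \<theta>"
proof -
  let ?N = "calderon_norm (A 0) (A 1)" and ?X = "complex_interp (A 0) (A 1) \<theta>"
  have N0: "0 \<le> ?N f" if "f \<in> calderon_F (A 0) (A 1)" for f
    using calderon_norm_edge[OF that, of 0 0] A_norm_nonneg[of 0] by (meson insertI1 order_trans)
  have val: "f (of_real \<theta>) \<in> fcarrier (A \<theta>)" "fnorm (A \<theta>) (f (of_real \<theta>)) \<le> upper_const * ?N f"
    if f: "f \<in> calderon_F (A 0) (A 1)" for f
  proof -
    \<comment> \<open>\<open>calderon_F_value\<close> asks for a positive bound while the norm of f
      may be 0, hence the margin e, removed by a limit.\<close>
    have M: "fnorm (A j) (f (Complex j t)) \<le> ?N f + e" if "j \<in> {0, 1}" "0 < e" for j t e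
      using calderon_norm_edge[OF f that(1), of t] that(2) by linarith
    have pos: "0 < ?N f + e" if "0 < e" for e using N0[OF f] that by linarith
    show "f (of_real \<theta>) \<in> fcarrier (A \<theta>)"
      by (rule calderon_F_value(1)[OF f pos[of 1] M[of _ 1]]) auto
    have "fnorm (A \<theta>) (f (of_real \<theta>)) \<le> upper_const * (?N f + e)" if "0 < e" for e
      by (rule calderon_F_value(2)[OF f pos[OF that] M[OF _ that]])
    moreover have "((\<lambda>e. upper_const * (?N f + e)) \<longlongrightarrow> upper_const * (?N f + 0)) (at_right 0)"
      by (intro tendsto_intros)
    ultimately show "fnorm (A \<theta>) (f (of_real \<theta>)) \<le> upper_const * ?N f"
      by (intro tendsto_lowerbound[where F="at_right 0"]) (auto simp: eventually_at_filter)
  qed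
  have carrier: "fcarrier ?X = fcarrier (A \<theta>)"
  proof
    show "fcarrier ?X \<subseteq> fcarrier (A \<theta>)" using val(1) by (auto simp: complex_interp_def)
    show "fcarrier (A \<theta>) \<subseteq> fcarrier ?X"
    proof
      fix \<phi> assume "\<phi> \<in> fcarrier (A \<theta>)"
      note e = extension_in_calderon_F(1,2)[OF this]
      show "\<phi> \<in> fcarrier ?X"
        unfolding complex_interp_def fun_space.simps by (rule CollectI, rule exI, rule conjI[OF e(2)[symmetric] e(1)])
    qed
  qed
  have norms: "1 / upper_const * fnorm (A \<theta>) \<phi> \<le> fnorm ?X \<phi> \<and>
      fnorm ?X \<phi> \<le> multiplier_const * ext_const * fnorm (A \<theta>) \<phi>"
    if \<phi>: "\<phi> \<in> fcarrier (A \<theta>)" for \<phi>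
  proof -
    let ?Z = "{?N f | f. f \<in> calderon_F (A 0) (A 1) \<and> f (of_real \<theta>) = \<phi>}"
    obtain f where f: "f \<in> calderon_F (A 0) (A 1)" "f (of_real \<theta>) = \<phi>" "?N f \<le> multiplier_const * ext_const * fnorm (A \<theta>) \<phi>"
      using that[OF extension_in_calderon_F[OF \<phi>]] .
    have X: "fnorm ?X \<phi> = Inf ?Z" by (simp add: complex_interp_def)
    have "1 / upper_const * fnorm (A \<theta>) \<phi> \<le> Inf ?Z"
    proof (rule cInf_greatest)
      fix z assume "z \<in> ?Z"
      then obtain f' where f': "f' \<in> calderon_F (A 0) (A 1)" "f' (of_real \<theta>) = \<phi>" "z = ?N f'" by blast
      show "1 / upper_const * fnorm (A \<theta>) \<phi> \<le> z"
        using val(2)[OF f'(1)] upper_const_pos unfolding f'(2,3) by (simp add: divide_le_eq mult.commute)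
    qed (use f in blast)
    moreover have "Inf ?Z \<le> ?N f"
      using f N0 by (intro cInf_lower bdd_belowI[of _ 0]) auto
    ultimately show ?thesis unfolding X using f(3) by linarith
  qed
  show ?thesis
    unfolding fspace_equiv_def
    using norms upper_const_pos multiplier_const_pos ext_const_pos
    by (intro conjI carrier exI[of _ "1 / upper_const"] exI[of _ "multiplier_const * ext_const"])
      (auto simp: carrier)
qed

end

section \<open>The scales \<open>W\<close> and \<open>W0\<close> as instances\<close>

context weight_scale
begin

lemma W_interpolation_scale:
  assumes "0 < \<theta>" "\<theta> < 1"
  shows "interpolation_scale U \<gamma> \<omega> L K p W \<theta>"
proof unfold_locales
  fix s s' B h h' \<phi>
  assume "s \<in> {0..1}" "s' \<in> {0..1}" "0 \<le> B" "smooth_line h" "\<And>t. (h has_vector_derivative h' t) (at t)"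
    "\<And>t. cmod (h t) \<le> B * exp ((s' - s) * t / p)" "\<And>t. cmod (h' t) \<le> B * exp ((s' - s) * t / p)"
    "\<phi> \<in> fcarrier (W s)"
  then show "(\<lambda>x. h (\<gamma> x) * \<phi> x) \<in> fcarrier (W s')" by (rule multiplier(1))
qed (use assms in \<open>auto intro: W_add W_cmult\<close>)

text \<open>Gaussian cutoffs in the direction of \<^term>\<open>\<gamma>\<close> absorb the exponential growth of the weight
  ratio, so that they carry the closure of the compactly supported functions from one weight to another.\<close>

lemma W0_sum:
  assumes \<theta>: "\<theta> \<in> {0..1}" and \<phi>: "\<phi> \<in> fcarrier (W \<theta>)"
    and a: "a0 \<in> fcarrier (W0 0)" "a1 \<in> fcarrier (W0 1)" "\<phi> = (\<lambda>x. a0 x + a1 x)"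
  shows "\<phi> \<in> fcarrier (W0 \<theta>)"
proof (rule W0_closed[OF \<phi>])
  fix e :: real assume e: "0 < e"
  let ?N = "\<lambda>n::nat. real (Suc n)"
  define E where "E n \<zeta> = exp (- (\<zeta>\<^sup>2) / of_real (?N n))" for n and \<zeta> :: complex
  define E' where "E' n \<zeta> = - 2 * \<zeta> / of_real (?N n) * E n \<zeta>" for n \<zeta>
  have N: "complex_of_real (?N n) \<noteq> 0" for n by (simp del: of_nat_Suc)
  have dE: "(E n has_field_derivative E' n \<zeta>) (at \<zeta>)" for n \<zeta>
    unfolding E_def[abs_def] E'_def using N[of n]
    by (auto intro!: derivative_eq_intros simp del: of_nat_Suc)
  have cE: "cmod (E n (of_real t)) = exp (- (t\<^sup>2) / ?N n)" for n t
    unfolding E_def norm_exp_eq_Re by (simp add: power2_eq_square del: of_nat_Suc)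
  have cE': "cmod (E' n (of_real t)) = 2 * \<bar>t\<bar> / ?N n * exp (- (t\<^sup>2) / ?N n)" for n t
    unfolding E'_def norm_mult cE by (simp add: norm_mult norm_divide del: of_nat_Suc)
  have cut: "(\<lambda>x. E n (of_real (\<gamma> x)) * a x) \<in> fcarrier (W0 \<theta>)" if j: "j \<in> {0, 1}" and aj: "a \<in> fcarrier (W0 j)" for n j a
  proof (rule W0_multiplier[OF _ \<theta> _ entire_line[OF dE] _ _ aj])
    show "j \<in> {0..1}" using j by auto
    let ?B = "2 * exp (?N n)"
    show "0 \<le> ?B" by simp
    have low: "exp (- \<bar>t\<bar>) \<le> exp ((\<theta> - j) * t / p)" for t
    proof -
      have "\<bar>(\<theta> - j) * t / p\<bar> = \<bar>\<theta> - j\<bar> * \<bar>t\<bar> / p" using p by (simp add: abs_mult)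
      also have "\<dots> \<le> \<bar>\<theta> - j\<bar> * \<bar>t\<bar> / 1" using p by (intro divide_left_mono) auto
      also have "\<dots> \<le> 1 * \<bar>t\<bar>" using \<theta> j by (simp, intro mult_left_le_one_le) auto
      finally have "- \<bar>t\<bar> \<le> (\<theta> - j) * t / p" by linarith
      then show ?thesis by simp
    qed
    \<comment> \<open>Completing the square gives t^2 / N \<ge> 2 |t| - N. Of the resulting decay
      exp (-2 |t|), one factor exp (-|t|) pays for the change of weight and the other absorbs the
      factor |t| in the derivative of the cutoff.\<close>
    have g: "exp (- (t\<^sup>2) / ?N n) \<le> exp (?N n) * exp (- 2 * \<bar>t\<bar>)" for t
    proof -
      have sq: "(a - N)\<^sup>2 / N = a\<^sup>2 / N - 2 * a + N" if "0 < N" for a N :: real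
        using that by (simp add: power2_eq_square field_simps)
      have "0 \<le> (\<bar>t\<bar> - ?N n)\<^sup>2 / ?N n" by simp
      also have "\<dots> = t\<^sup>2 / ?N n - 2 * \<bar>t\<bar> + ?N n" using sq[of "?N n" "\<bar>t\<bar>"] by simp
      finally show ?thesis unfolding exp_add[symmetric] by (simp del: of_nat_Suc)
    qed
    have tt: "2 * \<bar>t\<bar> / ?N n \<le> 2 * exp \<bar>t\<bar>" for t
    proof -
      have "2 * \<bar>t\<bar> / ?N n \<le> 2 * \<bar>t\<bar> / 1" by (intro divide_left_mono) auto
      also have "\<dots> \<le> 2 * exp \<bar>t\<bar>" using exp_ge_add_one_self[of "\<bar>t\<bar>"] by linarith
      finally show ?thesis .
    qed
    fix t
    have "exp (?N n) * exp (- 2 * \<bar>t\<bar>) \<le> ?B * exp (- \<bar>t\<bar>)"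
      by (intro mult_mono) auto
    then have "cmod (E n (of_real t)) \<le> ?B * exp (- \<bar>t\<bar>)" unfolding cE using g[of t] by linarith
    also have "\<dots> \<le> ?B * exp ((\<theta> - j) * t / p)" using low[of t] by (intro mult_left_mono) auto
    finally show "cmod (E n (of_real t)) \<le> ?B * exp ((\<theta> - j) * t / p)" .
    have "cmod (E' n (of_real t)) \<le> 2 * exp \<bar>t\<bar> * (exp (?N n) * exp (- 2 * \<bar>t\<bar>))"
      unfolding cE' by (intro mult_mono tt g) auto
    also have "\<dots> = ?B * (exp \<bar>t\<bar> * exp (- 2 * \<bar>t\<bar>))" by simp
    also have "exp \<bar>t\<bar> * exp (- 2 * \<bar>t\<bar>) = exp (- \<bar>t\<bar>)" by (simp add: exp_add[symmetric])
    also have "?B * exp (- \<bar>t\<bar>) \<le> ?B * exp ((\<theta> - j) * t / p)" using low[of t] by (intro mult_left_mono) auto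
    finally show "cmod (E' n (of_real t)) \<le> ?B * exp ((\<theta> - j) * t / p)" .
  qed
  have lim0: "(\<lambda>n. 1 / ?N n) \<longlonglongrightarrow> 0"
    using LIMSEQ_inverse_real_of_nat by (simp add: inverse_eq_divide)
  have d1: "((\<lambda>\<zeta>. 1 - E n \<zeta>) has_field_derivative - E' n \<zeta>) (at \<zeta>)" for n \<zeta>
    using DERIV_diff[OF DERIV_const[of 1] dE] by simp
  have limE: "(\<lambda>n. E n (of_real t)) \<longlonglongrightarrow> 1" for t
  proof -
    have "(\<lambda>n. exp (of_real (- (t\<^sup>2) * (1 / ?N n)))) \<longlonglongrightarrow> exp (complex_of_real (- (t\<^sup>2) * 0))"
      by (intro tendsto_intros lim0)
    then show ?thesis by (simp add: E_def)
  qed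
  \<comment> \<open>In the middle norm itself the cutoffs tend to the identity by dominated
    convergence: they and their derivatives are bounded uniformly in n, and source and target weight
    coincide.\<close>
  have "(\<lambda>n. fnorm (W \<theta>) (\<lambda>x. (1 - E n (of_real (\<gamma> x))) * \<phi> x)) \<longlonglongrightarrow> 0"
  proof (rule multiplier_tendsto[OF \<theta> \<theta> _ entire_line[OF d1] _ _ _ _ \<phi>, of 2])
    fix n t
    have "cmod (1 - E n (of_real t)) \<le> 1 + cmod (E n (of_real t))"
      using norm_triangle_ineq4[of 1 "E n (of_real t)"] by simp
    also have "\<dots> \<le> 2" unfolding cE by simp
    finally show "cmod (1 - E n (of_real t)) \<le> 2 * exp ((\<theta> - \<theta>) * t / p)" by simp
    have "2 * \<bar>t\<bar> \<le> 1 + t\<^sup>2"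
      using zero_le_power2[of "1 - \<bar>t\<bar>"] by (simp add: power2_eq_square algebra_simps)
    then have "2 * \<bar>t\<bar> / ?N n \<le> (1 + t\<^sup>2) / ?N n" by (rule divide_right_mono) simp
    also have "\<dots> \<le> 1 + t\<^sup>2 / ?N n" by (simp add: add_divide_distrib)
    also have "\<dots> \<le> exp (t\<^sup>2 / ?N n)" by (rule exp_ge_add_one_self)
    finally have "2 * \<bar>t\<bar> / ?N n * exp (- (t\<^sup>2) / ?N n) \<le> exp (t\<^sup>2 / ?N n) * exp (- (t\<^sup>2) / ?N n)"
      by (rule mult_right_mono) simp
    also have "\<dots> = 1" by (simp add: exp_add[symmetric])
    finally have "cmod (- E' n (of_real t)) \<le> 1" unfolding norm_minus_cancel cE' .
    then show "cmod (- E' n (of_real t)) \<le> 2 * exp ((\<theta> - \<theta>) * t / p)" by simp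
  next
    fix t
    show "(\<lambda>n. 1 - E n (of_real t)) \<longlonglongrightarrow> 0"
      using tendsto_diff[OF tendsto_const limE, of 1 t] by simp
    have "(\<lambda>n. - (- 2 * of_real t * of_real (1 / ?N n) * E n (of_real t))) \<longlonglongrightarrow> - (- 2 * of_real t * complex_of_real 0 * 1)"
      by (intro tendsto_intros lim0 limE)
    then show "(\<lambda>n. - E' n (of_real t)) \<longlonglongrightarrow> 0" by (simp add: E'_def)
  qed simp
  from order_tendstoD(2)[OF this e] obtain n where n: "fnorm (W \<theta>) (\<lambda>x. (1 - E n (of_real (\<gamma> x))) * \<phi> x) < e"
    unfolding eventually_sequentially by blast
  have "(\<lambda>x. E n (of_real (\<gamma> x)) * a0 x + E n (of_real (\<gamma> x)) * a1 x) \<in> fcarrier (W0 \<theta>)"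
    using a by (intro W0_add cut[of 0] cut[of 1]) auto
  then have "(\<lambda>x. E n (of_real (\<gamma> x)) * \<phi> x) \<in> fcarrier (W0 \<theta>)" by (simp add: a(3) distrib_left)
  then show "\<exists>\<psi>\<in>fcarrier (W0 \<theta>). fnorm (W \<theta>) (\<lambda>x. \<phi> x - \<psi> x) < e"
    using n by (intro bexI[of _ "\<lambda>x. E n (of_real (\<gamma> x)) * \<phi> x"]) (simp add: left_diff_distrib)
qed

lemma W0_interpolation_scale:
  assumes "0 < \<theta>" "\<theta> < 1"
  shows "interpolation_scale U \<gamma> \<omega> L K p W0 \<theta>"
proof unfold_locales
  show "\<phi> \<in> fcarrier (W s)" if "\<phi> \<in> fcarrier (W0 s)" for s \<phi> using that by (simp add: W1_0_carrier_iff)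
  show "fnorm (W0 s) = fnorm (W s)" for s by (rule W1_0_norm)
  fix s s' B h h' \<phi>
  assume "s \<in> {0..1}" "s' \<in> {0..1}" "0 \<le> B" "smooth_line h" "\<And>t. (h has_vector_derivative h' t) (at t)"
    "\<And>t. cmod (h t) \<le> B * exp ((s' - s) * t / p)" "\<And>t. cmod (h' t) \<le> B * exp ((s' - s) * t / p)"
    "\<phi> \<in> fcarrier (W0 s)"
  then show "(\<lambda>x. h (\<gamma> x) * \<phi> x) \<in> fcarrier (W0 s')" by (rule W0_multiplier)
qed (use assms in \<open>auto intro: W0_add W0_cmult W0_sum\<close>)

end

section \<open>Exponentially related weights\<close>

lemma compactly_bounded_iff:
  "compactly_bounded U \<omega> \<longleftrightarrow>
    (\<forall>K. compact K \<and> K \<subseteq> U \<longrightarrow> (\<exists>c>0. \<exists>C. \<forall>x\<in>K. c \<le> \<omega> x \<and> \<omega> x \<le> C))"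
proof -
  have "(0 < (INF x\<in>K. ereal (\<omega> x)) \<and> (SUP x\<in>K. ereal (\<omega> x)) < \<infinity>) \<longleftrightarrow>
    (\<exists>c>0. \<exists>C. \<forall>x\<in>K. c \<le> \<omega> x \<and> \<omega> x \<le> C)" (is "?l \<longleftrightarrow> ?r") for K
  proof
    assume l: ?l
    then obtain c where c: "0 < ereal c" "ereal c < (INF x\<in>K. ereal (\<omega> x))" using ereal_dense2 by blast
    obtain C where C: "(SUP x\<in>K. ereal (\<omega> x)) < ereal C" using l ereal_dense2[of _ "\<infinity>"] by blast
    have "c \<le> \<omega> x \<and> \<omega> x \<le> C" if "x \<in> K" for x
      using less_INF_D[OF c(2) that] SUP_lessD[OF C that] by simp
    then show ?r using c(1) by auto
  next
    assume ?r
    then obtain c C where c: "0 < c" "\<And>x. x \<in> K \<Longrightarrow> c \<le> \<omega> x \<and> \<omega> x \<le> C" by blast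
    have "ereal c \<le> (INF x\<in>K. ereal (\<omega> x))" "(SUP x\<in>K. ereal (\<omega> x)) \<le> ereal C"
      using c(2) by (auto intro!: INF_greatest SUP_least)
    then show ?l
      using c(1) less_le_trans[of 0 "ereal c"] le_less_trans[of _ "ereal C" "\<infinity>"] by simp
  qed
  then show ?thesis unfolding compactly_bounded_def by simp
qed

lemma lipschitz_bounded_on_compact:
  fixes g :: "real^'n \<Rightarrow> real"
  assumes "L-lipschitz_on U g" "compact K" "K \<subseteq> U"
  obtains R where "\<And>x. x \<in> K \<Longrightarrow> \<bar>g x\<bar> \<le> R"
proof -
  have "compact (g ` K)"
    using assms by (intro compact_continuous_image lipschitz_on_continuous_on[OF lipschitz_on_subset])
  then show ?thesis using that by (metis bounded_iff compact_imp_bounded imageI real_norm_def)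
qed

lemma compactly_bounded_exp:
  fixes g :: "real^'n \<Rightarrow> real"
  assumes g: "L-lipschitz_on U g" and \<omega>: "compactly_bounded U \<omega>"
    and eq: "\<And>x. x \<in> U \<Longrightarrow> \<omega>' x = \<omega> x * exp (g x)"
  shows "compactly_bounded U \<omega>'"
  unfolding compactly_bounded_iff
proof (intro allI impI, elim conjE)
  fix K assume K: "compact K" "K \<subseteq> U"
  obtain R where R: "\<And>x. x \<in> K \<Longrightarrow> \<bar>g x\<bar> \<le> R" using lipschitz_bounded_on_compact[OF g K] by metis
  obtain c C where "0 < c" and "\<forall>x\<in>K. c \<le> \<omega> x \<and> \<omega> x \<le> C"
    using \<omega>[unfolded compactly_bounded_iff, rule_format, OF conjI[OF K]] by (elim exE conjE)
  then have c: "0 < c" "\<And>x. x \<in> K \<Longrightarrow> c \<le> \<omega> x \<and> \<omega> x \<le> C" by blast+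
  have "c * exp (- R) \<le> \<omega>' x \<and> \<omega>' x \<le> C * exp R" if x: "x \<in> K" for x
  proof -
    have "- R \<le> g x" "g x \<le> R" using R[OF x] by linarith+
    then have "exp (- R) \<le> exp (g x)" "exp (g x) \<le> exp R" by simp_all
    moreover have "c \<le> \<omega> x" "\<omega> x \<le> C" "0 \<le> \<omega> x" "0 \<le> C" using c(1) c(2)[OF x] by linarith+
    ultimately have "c * exp (- R) \<le> \<omega> x * exp (g x)" "\<omega> x * exp (g x) \<le> C * exp R"
      by (intro mult_mono; simp)+
    then show ?thesis using eq[of x] K(2) x by auto
  qed
  then show "\<exists>c>0. \<exists>C. \<forall>x\<in>K. c \<le> \<omega>' x \<and> \<omega>' x \<le> C" using c(1)
    by (intro exI[of _ "c * exp (- R)"] conjI exI[of _ "C * exp R"]) auto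
qed

lemma locally_lipschitz_exp:
  fixes g :: "real^'n \<Rightarrow> real"
  assumes g: "L-lipschitz_on U g" and eq: "\<And>x. x \<in> U \<Longrightarrow> r x = exp (g x)"
  shows "locally_lipschitz_on U r"
  unfolding locally_lipschitz_on_def
proof (intro allI impI, elim conjE)
  fix K assume K: "compact K" "K \<subseteq> U"
  obtain R where R: "\<And>x. x \<in> K \<Longrightarrow> \<bar>g x\<bar> \<le> R" using lipschitz_bounded_on_compact[OF g K] by metis
  have "smooth_line (\<lambda>t. exp (complex_of_real t))" by (rule entire_line(1)[OF DERIV_exp])
  then obtain M where M: "0 \<le> M" "\<And>s t. \<bar>s\<bar> \<le> R \<Longrightarrow> \<bar>t\<bar> \<le> R \<Longrightarrow>
      cmod (exp (complex_of_real s) - exp (complex_of_real t)) \<le> M * \<bar>s - t\<bar>"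
    using smooth_line_lipschitz[of "\<lambda>t. exp (complex_of_real t)" R] by metis
  have L0: "0 \<le> L" using g by (rule lipschitz_on_nonneg)
  have "(M * L)-lipschitz_on K r"
  proof (rule lipschitz_onI)
    fix x y assume xy: "x \<in> K" "y \<in> K"
    have "\<bar>exp (g x) - exp (g y)\<bar> \<le> M * \<bar>g x - g y\<bar>"
      using M(2)[OF R[OF xy(1)] R[OF xy(2)]] by (simp add: exp_of_real of_real_diff[symmetric] del: of_real_diff)
    also have "\<dots> \<le> M * (L * dist x y)"
      using lipschitz_onD[OF g, of x y] xy K(2) M(1) by (intro mult_left_mono) (auto simp: dist_real_def)
    finally have "\<bar>exp (g x) - exp (g y)\<bar> \<le> M * L * dist x y" by (simp add: mult.assoc)
    moreover have "r x = exp (g x)" "r y = exp (g y)" using eq xy K(2) by blast+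
    ultimately show "dist (r x) (r y) \<le> M * L * dist x y" by (simp add: dist_real_def)
  qed (use M(1) L0 in simp)
  then show "\<exists>L. L-lipschitz_on K r" by blast
qed

lemma interp_weight_eq:
  assumes "0 < \<omega>1 x" "\<omega>0 x = \<omega>1 x * exp (g x)"
  shows "interp_weight \<omega>0 \<omega>1 s x = \<omega>1 x * exp ((1 - s) * g x)"
proof -
  have "interp_weight \<omega>0 \<omega>1 s x = (\<omega>1 x powr (1 - s) * \<omega>1 x powr s) * exp (g x) powr (1 - s)"
    using assms by (simp add: interp_weight_def powr_mult)
  also have "\<omega>1 x powr (1 - s) * \<omega>1 x powr s = \<omega>1 x" using assms by (simp add: powr_add[symmetric])
  finally show ?thesis by (simp add: powr_def)
qed

text \<open>Between s and s' the quantity \<omega>_s exp (s \<gamma>) changes by the factor exp ((s'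
  - s)(\<gamma> - g)), and \<gamma> - g is bounded by C on U; hence K = exp C. The same \<gamma> and
  K serve for every p.\<close>

lemma weight_scale_exponential:
  fixes U :: "(real^'n) set" and g \<omega>0 \<omega>1 :: "real^'n \<Rightarrow> real"
  assumes U: "open U" "U \<noteq> {}" and g: "L-lipschitz_on U g"
    and \<omega>: "weight_on U \<omega>0" "weight_on U \<omega>1"
    and eq: "\<And>x. x \<in> U \<Longrightarrow> \<omega>0 x = \<omega>1 x * exp (g x)"
  obtains \<gamma> K where "\<And>p. 1 \<le> p \<Longrightarrow> weight_scale U \<gamma> (interp_weight \<omega>0 \<omega>1) L K p"
proof -
  obtain G where G: "L-lipschitz_on UNIV G" "\<And>x. x \<in> U \<Longrightarrow> G x = g x"
    using lipschitz_extension_real[OF g U(2)] by metis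
  obtain \<gamma> C where \<gamma>: "\<And>k. C_k k (\<lambda>x. complex_of_real (\<gamma> x))" "L-lipschitz_on UNIV \<gamma>"
    "\<And>x. \<bar>\<gamma> x - G x\<bar> \<le> C"
    using smooth_approximation[OF G(1)] by metis
  have pos: "0 < \<omega>0 x" "0 < \<omega>1 x" if "x \<in> U" for x using \<omega> that by (auto simp: weight_on_def)
  have [measurable]: "\<omega>0 \<in> borel_measurable (lebesgue_on U)" "\<omega>1 \<in> borel_measurable (lebesgue_on U)"
    using \<omega> by (auto simp: weight_on_def)
  have "weight_scale U \<gamma> (interp_weight \<omega>0 \<omega>1) L (exp C) p" if "1 \<le> p" for p
  proof
    show "interp_weight \<omega>0 \<omega>1 s \<in> borel_measurable (lebesgue_on U)" for s
      unfolding interp_weight_def[abs_def] by measurable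
    show "0 < interp_weight \<omega>0 \<omega>1 s x" if "x \<in> U" for s x
      using pos[OF that] by (simp add: interp_weight_def)
    fix s s' :: real and x assume s: "s \<in> {0..1}" "s' \<in> {0..1}" and x: "x \<in> U"
    note w = interp_weight_eq[of \<omega>1 x \<omega>0 g, OF pos(2)[OF x] eq[OF x]]
    have "(s' - s) * (\<gamma> x - g x) \<le> \<bar>s' - s\<bar> * \<bar>\<gamma> x - g x\<bar>" by (metis abs_ge_self abs_mult)
    also have "\<dots> \<le> 1 * C" using s \<gamma>(3)[of x] G(2)[OF x] by (intro mult_mono) auto
    finally have "exp ((1 - s) * g x + (s' - s) * (\<gamma> x - g x)) \<le> exp ((1 - s) * g x + C)" by simp
    then have "\<omega>1 x * exp ((1 - s') * g x + (s' - s) * \<gamma> x) \<le> \<omega>1 x * exp ((1 - s) * g x + C)"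
      using pos(2)[OF x] by (intro mult_left_mono) (auto simp: algebra_simps)
    then show "interp_weight \<omega>0 \<omega>1 s' x * exp ((s' - s) * \<gamma> x) \<le> exp C * interp_weight \<omega>0 \<omega>1 s x"
      unfolding w by (simp add: exp_add mult_ac)
  qed (use U \<gamma> that in auto)
  then show ?thesis by (rule that)
qed

theorem theorem1p22:
  fixes U :: "(real ^ 'n) set"
    and g \<omega>0 \<omega>1 :: "real ^ 'n \<Rightarrow> real"
  assumes "open U" and "U \<noteq> {}"
    and "\<exists>L. L-lipschitz_on U g"
    and "weight_on U \<omega>0" and "weight_on U \<omega>1"
    and "compactly_bounded U \<omega>0 \<or> compactly_bounded U \<omega>1"
    and "\<And>x. x \<in> U \<Longrightarrow> \<omega>0 x = \<omega>1 x * exp (g x)"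
  shows
    "(compactly_bounded U \<omega>0 \<and> compactly_bounded U \<omega>1 \<and>
      locally_lipschitz_on U (weight_ratio \<omega>0 \<omega>1)) \<and>
     (U = UNIV \<longrightarrow>
       (\<forall>p \<theta>. 1 \<le> p \<and> 0 < \<theta> \<and> \<theta> < 1 \<longrightarrow>
         complex_interp (W1 p UNIV \<omega>0) (W1 p UNIV \<omega>1) \<theta>
           \<cong>\<^sub>N W1 p UNIV (interp_weight \<omega>0 \<omega>1 \<theta>))) \<and>
     ((\<exists>q\<ge>1. \<forall>\<phi> \<in> fcarrier (W1_0 q U \<omega>0) \<inter> fcarrier (W1_0 q U \<omega>1).
         \<exists>\<psi>. (\<forall>n. \<psi> n \<in> Lip_c U) \<and>
           (fconverges (W1 q U \<omega>0) \<psi> \<phi> \<and> fbounded_seq (W1 q U \<omega>1) \<psi> \<or>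
            fconverges (W1 q U \<omega>1) \<psi> \<phi> \<and> fbounded_seq (W1 q U \<omega>0) \<psi>)) \<longrightarrow>
       (\<forall>p \<theta>. 1 \<le> p \<and> 0 < \<theta> \<and> \<theta> < 1 \<longrightarrow>
         complex_interp (W1_0 p U \<omega>0) (W1_0 p U \<omega>1) \<theta>
           \<cong>\<^sub>N W1_0 p U (interp_weight \<omega>0 \<omega>1 \<theta>))) \<and>
     (\<forall>p\<ge>1.
       W1_0 p U \<omega>0 = W1 p U \<omega>0 \<and> W1_0 p U \<omega>1 = W1 p U \<omega>1 \<and>
       (\<forall>\<theta>. 0 < \<theta> \<and> \<theta> < 1 \<longrightarrow> calW_0 p U \<theta> \<omega>0 \<omega>1 = calW p U \<theta> \<omega>0 \<omega>1) \<longrightarrow>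
       (\<forall>\<theta>. 0 < \<theta> \<and> \<theta> < 1 \<longrightarrow>
         complex_interp (W1 p U \<omega>0) (W1 p U \<omega>1) \<theta>
           \<cong>\<^sub>N W1 p U (interp_weight \<omega>0 \<omega>1 \<theta>)))"
proof -
  obtain L where g: "L-lipschitz_on U g" using assms(3) by blast
  have pos: "0 < \<omega>0 x" "0 < \<omega>1 x" if "x \<in> U" for x
    using assms(4,5) that by (auto simp: weight_on_def)
  obtain \<gamma> K where scale: "\<And>p. 1 \<le> p \<Longrightarrow> weight_scale U \<gamma> (interp_weight \<omega>0 \<omega>1) L K p"
    using weight_scale_exponential[OF assms(1,2) g assms(4,5,7)] by metis
  \<comment> \<open>The endpoint weights are recovered on U, where they are positive; the spaces see
    the weights only there.\<close>
  have ends: "interp_weight \<omega>0 \<omega>1 0 x = \<omega>0 x" "interp_weight \<omega>0 \<omega>1 1 x = \<omega>1 x" if "x \<in> U" for x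
    using pos[OF that] by (auto simp: interp_weight_def)
  have W: "complex_interp (W1 p U \<omega>0) (W1 p U \<omega>1) \<theta> \<cong>\<^sub>N W1 p U (interp_weight \<omega>0 \<omega>1 \<theta>)"
    if "1 \<le> p" "0 < \<theta>" "\<theta> < 1" for p \<theta>
    using interpolation_scale.complex_interp_equiv[OF weight_scale.W_interpolation_scale[OF scale[OF that(1)] that(2,3)]]
    by (simp add: W1_cong[of U _ \<omega>0, OF ends(1)] W1_cong[of U _ \<omega>1, OF ends(2)])
  have W0: "complex_interp (W1_0 p U \<omega>0) (W1_0 p U \<omega>1) \<theta> \<cong>\<^sub>N W1_0 p U (interp_weight \<omega>0 \<omega>1 \<theta>)"
    if "1 \<le> p" "0 < \<theta>" "\<theta> < 1" for p \<theta>
    using interpolation_scale.complex_interp_equiv[OF weight_scale.W0_interpolation_scale[OF scale[OF that(1)] that(2,3)]]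
    by (simp add: W1_0_cong[of U _ \<omega>0, OF ends(1)] W1_0_cong[of U _ \<omega>1, OF ends(2)])
  \<comment> \<open>With -g the two weights exchange roles, so one lemma gives both
    directions.\<close>
  have "L-lipschitz_on U (\<lambda>x. - g x)" using g by (simp add: lipschitz_on_def dist_real_def abs_minus_commute)
  from compactly_bounded_exp[OF this, of \<omega>0 \<omega>1]
  have "compactly_bounded U \<omega>0 \<Longrightarrow> compactly_bounded U \<omega>1"
    using assms(7) by (simp add: exp_minus)
  moreover have "compactly_bounded U \<omega>1 \<Longrightarrow> compactly_bounded U \<omega>0"
    using compactly_bounded_exp[OF g _ assms(7)] .
  moreover have "weight_ratio \<omega>0 \<omega>1 x = exp (g x)" if "x \<in> U" for x
    using pos[OF that] assms(7)[OF that] by (simp add: weight_ratio_def)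
  then have "locally_lipschitz_on U (weight_ratio \<omega>0 \<omega>1)" by (rule locally_lipschitz_exp[OF g])
  ultimately show ?thesis using assms(6) W W0 by blast
qed

end
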